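(* Let $k$ be a field with $\operatorname{char} k\ne2$, let $q\in k^\times$ be not a root of unity, let $C_0\neq 0$ be in the center of $U_q(\mathfrak{sl}_2)$, and let $A$ be the associated quantized symplectic oscillator algebra of rank $1$. Suppose $r\in k^\times$ and $r\ne\pm q^n$ for any $n\in\mathbb{Z}_{\ge0}$. Then: (1) $Z(r)$ is a direct sum of $U_q(\mathfrak{sl}_2)$-Verma modules $Z_C(q^{-i}r)$, one copy for each $i\in\mathbb{Z}_{\ge0}$. (2) The (nonzero) submodules of $Z(r)$ are precisely of the form $Z(t)=k[Y,F]v_t$, where $t=q^{-n}r$ for every root $n\in\mathbb{Z}_{\ge0}$ of $\alpha_{r,n+1}$ (that is, every $n\in\mathbb{Z}_{\ge0}$ with $\alpha_{r,n+1}=0$). In particular, all these submodules lie in a chain, and $Z(r)$ has finite length.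
   Context: $U_q(\mathfrak{sl}_2)$ is the $k$-algebra generated by $E,F,K,K^{-1}$ with $KK^{-1}=K^{-1}K=1$, $KEK^{-1}=q^2E$, $KFK^{-1}=q^{-2}F$, $EF-FE=\frac{K-K^{-1}}{q-q^{-1}}$. For $C_0$ in its center, $A$ is the $k$-algebra generated by $E,F,K,K^{-1},X,Y$ with these relations together with $EX=qXE$, $EY=X+q^{-1}YE$, $FX=YK^{-1}+XF$, $FY=YF$, $KXK^{-1}=qX$, $KYK^{-1}=q^{-1}Y$, $qYX-XY=C_0$. The subalgebra generated by $E,F,K^{\pm1}$ is $U_q(\mathfrak{sl}_2)$, and the subalgebra generated by $Y,F$ is a polynomial ring $k[Y,F]$. For $r\in k^\times$: $Z_C(r)$ is the Verma module of highest weight $r$ over $U_q(\mathfrak{sl}_2)$; $Z(r)=A/(AE+AX+A(K-r))$ is the Verma module over $A$ of highest weight $r$. The scalar $c_{0,r}$ is the one by which $C_0$ acts on $Z_C(r)$. Put $\{a\}=\frac{a-a^{-1}}{q-q^{-1}}$ for $a\in k^\times$ and $\alpha_{r,m}=\sum_{j=0}^{m-2}\{q^{1-j}r\}c_{0,q^{-j}r}$ for $m\ge1$ (so $\alpha_{r,1}=0$, the empty sum). A maximal vector of weight $t$ in $Z(r)$ is a nonzero vector $v$ with $Ev=Xv=0$ and $Kv=tv$; $v_t$ denotes such a vector of weight $t$ in $Z(r)$. The notation $Z(t)=k[Y,F]v_t$ means that the submodule $k[Y,F]v_t$ of $Z(r)$ is a copy of the Verma module $Z(t)$ with highest weight vector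 $v_t$.
   Formalization: For the root n=1 with r=±q^{-1} and c_{0,r}≠0 no submodule Z(q^{-1}r) is claimed: there α_{r,2}={qr}c_{0,r}=0, yet XYv_r=-c_{0,r}v_r≠0, so no maximal vector of that weight exists (e.g. C_0=1, r=q^{-1}). *)

theory Defs
  imports
    "HOL-Algebra.Algebra"
    "HOL-Algebra.Algebraic_Closure_Type"
    "HOL-Library.Poly_Mapping"
begin

section \<open>Algebras given by generators and relations\<close>

text \<open>Words under concatenation form a monoid (written additively, as the
  convolution product of \<^theory>\<open>HOL-Library.Poly_Mapping\<close> expects), so the finitely supported
  functions on words form the free associative unital algebra.\<close>

instantiation list :: (type) monoid_add
begin
definition zero_list :: "'a list" where "zero_list = []"
definition plus_list :: "'a list \<Rightarrow> 'a list \<Rightarrow> 'a list" where "plus_list xs ys = xs @ ys"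
instance by standard (simp_all add: zero_list_def plus_list_def)
end

type_synonym ('g, 'k) free_alg = "'g list \<Rightarrow>\<^sub>0 'k"

definition free_gen :: "'g \<Rightarrow> ('g, 'k::field) free_alg" where
  "free_gen g = Poly_Mapping.single [g] 1"

definition free_scal :: "'k::field \<Rightarrow> ('g, 'k) free_alg" where
  "free_scal a = Poly_Mapping.single [] a"

definition free_map :: "('g \<Rightarrow> 'h) \<Rightarrow> ('g, 'k::field) free_alg \<Rightarrow> ('h, 'k) free_alg" where
  "free_map f p = (\<Sum>w\<in>Poly_Mapping.keys p.
     Poly_Mapping.single (map f w) (Poly_Mapping.lookup p w))"

definition pres_ideal :: "('g, 'k::field) free_alg set \<Rightarrow> ('g, 'k) free_alg set" where
  "pres_ideal rels = Idl\<^bsub>ring_of_type_algebra\<^esub> rels"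

definition pres_alg :: "('g, 'k::field) free_alg set \<Rightarrow> ('g, 'k) free_alg set ring" where
  "pres_alg rels = ring_of_type_algebra Quot (pres_ideal rels)"

definition pres_class ::
  "('g, 'k::field) free_alg set \<Rightarrow> ('g, 'k) free_alg \<Rightarrow> ('g, 'k) free_alg set" where
  "pres_class rels p = pres_ideal rels +>\<^bsub>ring_of_type_algebra\<^esub> p"

abbreviation pres_gen :: "('g, 'k::field) free_alg set \<Rightarrow> 'g \<Rightarrow> ('g, 'k) free_alg set" where
  "pres_gen rels g \<equiv> pres_class rels (free_gen g)"

abbreviation pres_scal :: "('g, 'k::field) free_alg set \<Rightarrow> 'k \<Rightarrow> ('g, 'k) free_alg set" where
  "pres_scal rels a \<equiv> pres_class rels (free_scal a)"

definition ring_center :: "('a, 'm) ring_scheme \<Rightarrow> 'a set" where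
  "ring_center R = {z \<in> carrier R. \<forall>x\<in>carrier R. z \<otimes>\<^bsub>R\<^esub> x = x \<otimes>\<^bsub>R\<^esub> z}"


section \<open>Left modules over a noncommutative ring\<close>

text \<open>The record \<^type>\<open>module_ext\<close> and the locale \<^locale>\<open>submodule\<close> do not need
  commutativity of the ring of scalars. The ring multiplication and unit fields that the record
  inherits carry no meaning for a module.\<close>

text \<open>The quotient of R, as a left module over itself, by the left ideal J.\<close>

definition quot_module :: "('a, 'm) ring_scheme \<Rightarrow> 'a set \<Rightarrow> ('a, 'a set) module" where
  "quot_module R J =
     \<lparr>carrier = a_rcosets\<^bsub>R\<^esub> J, monoid.mult = (\<lambda>_ _. J), one = J, ring.zero = J, add = set_add R,
      module.smult = (\<lambda>a C. \<Union>x\<in>C. J +>\<^bsub>R\<^esub> (a \<otimes>\<^bsub>R\<^esub> x))\<rparr>"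

text \<open>Restriction of scalars along a map h of rings.\<close>

definition restrict_scalars :: "('c \<Rightarrow> 'a) \<Rightarrow> ('a, 'b) module \<Rightarrow> ('c, 'b) module" where
  "restrict_scalars h M =
     \<lparr>carrier = carrier M, monoid.mult = monoid.mult M, monoid.one = monoid.one M, ring.zero = ring.zero M, add = add M,
      module.smult = (\<lambda>u m. h u \<odot>\<^bsub>M\<^esub> m)\<rparr>"

definition mod_hom ::
  "('a, 'm) ring_scheme \<Rightarrow> ('a, 'b) module \<Rightarrow> ('a, 'c) module \<Rightarrow> ('b \<Rightarrow> 'c) set" where
  "mod_hom R M N = {h \<in> carrier M \<rightarrow> carrier N.
     (\<forall>x\<in>carrier M. \<forall>y\<in>carrier M. h (x \<oplus>\<^bsub>M\<^esub> y) = h x \<oplus>\<^bsub>N\<^esub> h y) \<and>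
     (\<forall>a\<in>carrier R. \<forall>x\<in>carrier M. h (a \<odot>\<^bsub>M\<^esub> x) = a \<odot>\<^bsub>N\<^esub> h x)}"

text \<open>h is an isomorphism of the module M onto the submodule S of N.\<close>

definition mod_iso_onto ::
  "('a, 'm) ring_scheme \<Rightarrow> ('a, 'b) module \<Rightarrow> ('a, 'c) module \<Rightarrow> 'c set \<Rightarrow> ('b \<Rightarrow> 'c) \<Rightarrow> bool"
  where
  "mod_iso_onto R M N S h \<longleftrightarrow>
     submodule S R N \<and> h \<in> mod_hom R M N \<and> inj_on h (carrier M) \<and> h ` carrier M = S"

definition internal_direct_sum ::
  "('a, 'm) ring_scheme \<Rightarrow> ('a, 'b) module \<Rightarrow> ('i \<Rightarrow> 'b set) \<Rightarrow> bool" where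
  "internal_direct_sum R M N \<longleftrightarrow>
     (\<forall>i. submodule (N i) R M) \<and>
     (\<forall>m\<in>carrier M. \<exists>!x. (\<forall>i. x i \<in> N i) \<and> finite {i. x i \<noteq> \<zero>\<^bsub>M\<^esub>} \<and>
        m = (\<Oplus>\<^bsub>M\<^esub>i\<in>{i. x i \<noteq> \<zero>\<^bsub>M\<^esub>}. x i))"

text \<open>Existence of a finite composition series.\<close>

definition finite_length :: "('a, 'm) ring_scheme \<Rightarrow> ('a, 'b) module \<Rightarrow> bool" where
  "finite_length R M \<longleftrightarrow>
     (\<exists>(l::nat) S. S 0 = {\<zero>\<^bsub>M\<^esub>} \<and> S l = carrier M \<and> (\<forall>i\<le>l. submodule (S i) R M) \<and>
        (\<forall>i<l. S i \<subset> S (Suc i) \<and>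
           \<not> (\<exists>N. submodule N R M \<and> S i \<subset> N \<and> N \<subset> S (Suc i))))"


section \<open>The quantum group\<close>

datatype usl_gen = gE | gF | gK | gKi

definition usl_rels :: "'k::field \<Rightarrow> (usl_gen, 'k) free_alg set" where
  "usl_rels q =
     (let e = free_gen gE; f = free_gen gF; k = free_gen gK; ki = free_gen gKi in
      {k * ki - 1,
       ki * k - 1,
       k * e * ki - free_scal (q ^ 2) * e,
       k * f * ki - free_scal (inverse (q ^ 2)) * f,
       e * f - f * e - free_scal (inverse (q - inverse q)) * (k - ki)})"

definition usl :: "'k::field \<Rightarrow> (usl_gen, 'k) free_alg set ring" where
  "usl q = pres_alg (usl_rels q)"

definition usl_verma ::
  "'k::field \<Rightarrow> 'k \<Rightarrow> ((usl_gen, 'k) free_alg set, (usl_gen, 'k) free_alg set set) module" where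
  "usl_verma q r =
     (let U = usl q; e = pres_gen (usl_rels q) gE; k = pres_gen (usl_rels q) gK;
          r' = pres_scal (usl_rels q) r in
      quot_module U ((carrier U #>\<^bsub>U\<^esub> e) <+>\<^bsub>U\<^esub> (carrier U #>\<^bsub>U\<^esub> (k \<ominus>\<^bsub>U\<^esub> r'))))"

definition c0 :: "'k::field \<Rightarrow> (usl_gen, 'k) free_alg set \<Rightarrow> 'k \<Rightarrow> 'k" where
  "c0 q C r = (THE a. \<forall>m\<in>carrier (usl_verma q r).
     C \<odot>\<^bsub>usl_verma q r\<^esub> m = pres_scal (usl_rels q) a \<odot>\<^bsub>usl_verma q r\<^esub> m)"

definition qbrace :: "'k::field \<Rightarrow> 'k \<Rightarrow> 'k" where
  "qbrace q a = (a - inverse a) / (q - inverse q)"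

text \<open>Meant for m at least 1; the upper summation limit is m - 2, so that
  the sum is empty for m = 1.\<close>

definition alpha :: "'k::field \<Rightarrow> (usl_gen, 'k) free_alg set \<Rightarrow> 'k \<Rightarrow> nat \<Rightarrow> 'k" where
  "alpha q C r m =
     (\<Sum>j<m - 1. qbrace q (q powi (1 - int j) * r) * c0 q C (q powi (- int j) * r))"


section \<open>The quantized symplectic oscillator algebra of rank 1\<close>

datatype osc_gen = Usl usl_gen | gX | gY

text \<open>An element C of the quantum group is a coset in the free algebra; the last
  relation is imposed for each of its representatives (any one of them would do, given the
  relations of the quantum group).\<close>

definition osc_rels ::
  "'k::field \<Rightarrow> (usl_gen, 'k) free_alg set \<Rightarrow> (osc_gen, 'k) free_alg set" where
  "osc_rels q C =
     (let e = free_gen (Usl gE); f = free_gen (Usl gF); k = free_gen (Usl gK);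
          ki = free_gen (Usl gKi); x = free_gen gX; y = free_gen gY in
      free_map Usl ` usl_rels q \<union>
      {e * x - free_scal q * x * e,
       e * y - (x + free_scal (inverse q) * y * e),
       f * x - (y * ki + x * f),
       f * y - y * f,
       k * x * ki - free_scal q * x,
       k * y * ki - free_scal (inverse q) * y} \<union>
      {free_scal q * y * x - x * y - free_map Usl c | c. c \<in> C})"

definition osc ::
  "'k::field \<Rightarrow> (usl_gen, 'k) free_alg set \<Rightarrow> (osc_gen, 'k) free_alg set ring" where
  "osc q C = pres_alg (osc_rels q C)"

text \<open>The canonical homomorphism from the quantum group to the oscillator algebra, well defined
  on cosets.\<close>

definition usl_to_osc :: "'k::field \<Rightarrow> (usl_gen, 'k) free_alg set \<Rightarrow>
    (usl_gen, 'k) free_alg set \<Rightarrow> (osc_gen, 'k) free_alg set" where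
  "usl_to_osc q C u = the_elem ((\<lambda>p. pres_class (osc_rels q C) (free_map Usl p)) ` u)"

definition osc_verma_ideal ::
  "'k::field \<Rightarrow> (usl_gen, 'k) free_alg set \<Rightarrow> 'k \<Rightarrow> (osc_gen, 'k) free_alg set set" where
  "osc_verma_ideal q C r =
     (let A = osc q C; e = pres_gen (osc_rels q C) (Usl gE); x = pres_gen (osc_rels q C) gX;
          k = pres_gen (osc_rels q C) (Usl gK); r' = pres_scal (osc_rels q C) r in
      (carrier A #>\<^bsub>A\<^esub> e) <+>\<^bsub>A\<^esub> (carrier A #>\<^bsub>A\<^esub> x) <+>\<^bsub>A\<^esub> (carrier A #>\<^bsub>A\<^esub> (k \<ominus>\<^bsub>A\<^esub> r')))"

definition osc_verma :: "'k::field \<Rightarrow> (usl_gen, 'k) free_alg set \<Rightarrow> 'k \<Rightarrow>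
    ((osc_gen, 'k) free_alg set, (osc_gen, 'k) free_alg set set) module" where
  "osc_verma q C r = quot_module (osc q C) (osc_verma_ideal q C r)"

text \<open>The image of 1 in the Verma module.\<close>

definition osc_verma_gen ::
  "'k::field \<Rightarrow> (usl_gen, 'k) free_alg set \<Rightarrow> 'k \<Rightarrow> (osc_gen, 'k) free_alg set set" where
  "osc_verma_gen q C r = osc_verma_ideal q C r +>\<^bsub>osc q C\<^esub> \<one>\<^bsub>osc q C\<^esub>"

definition maximal_vector :: "'k::field \<Rightarrow> (usl_gen, 'k) free_alg set \<Rightarrow> 'k \<Rightarrow> 'k \<Rightarrow>
    (osc_gen, 'k) free_alg set set \<Rightarrow> bool" where
  "maximal_vector q C r t v \<longleftrightarrow>
     (let Z = osc_verma q C r; g = pres_gen (osc_rels q C) in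
      v \<in> carrier Z \<and> v \<noteq> \<zero>\<^bsub>Z\<^esub> \<and>
      g (Usl gE) \<odot>\<^bsub>Z\<^esub> v = \<zero>\<^bsub>Z\<^esub> \<and> g gX \<odot>\<^bsub>Z\<^esub> v = \<zero>\<^bsub>Z\<^esub> \<and>
      g (Usl gK) \<odot>\<^bsub>Z\<^esub> v = pres_scal (osc_rels q C) t \<odot>\<^bsub>Z\<^esub> v)"

text \<open>The subalgebra k[Y,F] of A, and its orbit k[Y,F]v.\<close>

definition kYF ::
  "'k::field \<Rightarrow> (usl_gen, 'k) free_alg set \<Rightarrow> (osc_gen, 'k) free_alg set set" where
  "kYF q C = generate_ring (osc q C)
     (range (pres_scal (osc_rels q C)) \<union>
      {pres_gen (osc_rels q C) gY, pres_gen (osc_rels q C) (Usl gF)})"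

definition kYF_span :: "'k::field \<Rightarrow> (usl_gen, 'k) free_alg set \<Rightarrow> 'k \<Rightarrow>
    (osc_gen, 'k) free_alg set set \<Rightarrow> (osc_gen, 'k) free_alg set set set" where
  "kYF_span q C r v = {p \<odot>\<^bsub>osc_verma q C r\<^esub> v | p. p \<in> kYF q C}"

end

theory Submission
  imports Defs "HOL-Computational_Algebra.Polynomial"
begin

text \<open>Call a weight vector U-maximal if E kills it. Let z(0) be the highest weight vector of Z(r).
  If z(i) is U-maximal of weight q^-i r and X z(i) = lam(i) z(i-1), then E Y z(i) = lam(i) z(i-1),
  while E F z(i-1) is a multiple of z(i-1) whose factor is not 0 because r is generic. So for a
  suitable scalar mu(i) the vector z(i+1) = Y z(i) - mu(i) F z(i-1) is again U-maximal. The central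
  element acts on z(i) by its scalar on the Verma module of weight q^-i r, so the relation
  qYX - XY = C expresses X z(i+1) as a multiple of z(i), with a recursion that gives lam(i+1) from
  lam(i). After multiplication by a brace the recursion telescopes to alpha (\<open>lam_alpha\<close>).

  The vectors F^j z(i) form a basis of Z(r). They span, since these formulas determine the action
  of all generators on them. For independence, the formulas are taken as a definition of operators
  on a space with basis indexed by pairs (i, j), the relations are verified there
  (\<open>osc_rels_hold\<close>), and the quotient of A by the defining left ideal is compared with that space
  (\<open>annihilator_eq_left_span\<close>). The rows of this basis are the copies of Verma modules of the
  quantum group in the first assertion.

  These Verma modules are simple and have different highest weights, so a submodule is a sum of
  rows (\<open>stable_bv\<close>). Applying Y leads from row i to row i + 1, and applying X leads back to row
  i - 1 unless lam(i) = 0. Hence the nonzero submodules consist of the rows from some n on, with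
  lam(n) = 0 (\<open>stable_classification\<close>). For such n the recursion restarts at z(n), so these rows
  form a copy of Z(q^-n r) (\<open>shift_intertwine\<close>). The vanishing of lam(n) and that of alpha
  at n + 1 are equivalent, except for n = 1 and r inverse to q up to sign (\<open>lam_eq_0\<close>).

  Finite length follows because alpha has finitely many zeros. By the arguments of Harish-Chandra, the
  scalar of a nonzero central element is a nonzero Laurent polynomial in the highest weight s
  (\<open>c0_laurent\<close>), invariant under the exchange of s and 1/(q^2 s) (\<open>coef_symmetric\<close>). By the
  invariance no summand of alpha contributes a term linear in n, and alpha is a nonzero Laurent
  polynomial in q^n (\<open>finite_alpha_zeros\<close>).

  The modules of the theorem are sets of cosets of cosets in free algebras. The predicate
  \<open>realises\<close> identifies them with spaces of finitely supported functions, where the arguments above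
  take place.\<close>

section \<open>Linear algebra of finitely supported functions\<close>

abbreviation coef :: "('i \<Rightarrow>\<^sub>0 'k::zero) \<Rightarrow> 'i \<Rightarrow> 'k" where
  "coef \<equiv> Poly_Mapping.lookup"

abbreviation supp :: "('i \<Rightarrow>\<^sub>0 'k::zero) \<Rightarrow> 'i set" where
  "supp \<equiv> Poly_Mapping.keys"

definition scale_fs :: "'k::field \<Rightarrow> ('i \<Rightarrow>\<^sub>0 'k) \<Rightarrow> ('i \<Rightarrow>\<^sub>0 'k)" (infixr "*\<^sub>s" 75) where
  "a *\<^sub>s v = Poly_Mapping.map ((*) a) v"

lemma lookup_scale_fs [simp]: "coef (a *\<^sub>s v) i = a * coef v i"
  by (simp add: scale_fs_def map.rep_eq when_def)

interpretation fs: vector_space "scale_fs :: 'k::field \<Rightarrow> ('i \<Rightarrow>\<^sub>0 'k) \<Rightarrow> ('i \<Rightarrow>\<^sub>0 'k)"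
  by unfold_locales
     (auto intro!: poly_mapping_eqI simp: lookup_add algebra_simps)

interpretation fsp: vector_space_pair
  "scale_fs :: 'k::field \<Rightarrow> ('i \<Rightarrow>\<^sub>0 'k) \<Rightarrow> ('i \<Rightarrow>\<^sub>0 'k)"
  "scale_fs :: 'k::field \<Rightarrow> ('j \<Rightarrow>\<^sub>0 'k) \<Rightarrow> ('j \<Rightarrow>\<^sub>0 'k)"
  by unfold_locales

abbreviation lin :: "(('i \<Rightarrow>\<^sub>0 'k::field) \<Rightarrow> ('j \<Rightarrow>\<^sub>0 'k)) \<Rightarrow> bool" where
  "lin \<equiv> Vector_Spaces.linear scale_fs scale_fs"

lemma linI:
  assumes "\<And>u v. f (u + v) = f u + f v" "\<And>a v. f (a *\<^sub>s v) = a *\<^sub>s f v"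
  shows "lin f"
  using assms by unfold_locales auto

lemma lin_comp: "lin f \<Longrightarrow> lin g \<Longrightarrow> lin (\<lambda>v. f (g v))"
  by (rule linI) (simp_all add: fsp.linear_add fsp.linear_scale)

lemma lin_id: "lin (\<lambda>v. v)"
  by (rule linI) simp_all

abbreviation bv :: "'i \<Rightarrow> ('i \<Rightarrow>\<^sub>0 'k::field)" where
  "bv i \<equiv> Poly_Mapping.single i 1"

definition lin_ext :: "('i \<Rightarrow> ('j \<Rightarrow>\<^sub>0 'k)) \<Rightarrow> ('i \<Rightarrow>\<^sub>0 'k::field) \<Rightarrow> ('j \<Rightarrow>\<^sub>0 'k)" where
  "lin_ext f v = (\<Sum>i\<in>supp v. coef v i *\<^sub>s f i)"

lemma lin_ext_superset:
  assumes "finite S" "supp v \<subseteq> S"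
  shows "lin_ext f v = (\<Sum>i\<in>S. coef v i *\<^sub>s f i)"
  unfolding lin_ext_def
  by (rule sum.mono_neutral_left) (use assms in \<open>auto simp: in_keys_iff\<close>)

lemma lin_lin_ext: "lin (lin_ext f)"
proof (rule linI)
  fix u v :: "'b \<Rightarrow>\<^sub>0 'a"
  let ?S = "supp u \<union> supp v"
  have "lin_ext f (u + v) = (\<Sum>i\<in>?S. coef (u + v) i *\<^sub>s f i)"
    by (rule lin_ext_superset) (auto simp: keys_add)
  also have "\<dots> = lin_ext f u + lin_ext f v"
    by (simp add: lin_ext_superset[of ?S] lookup_add fs.scale_left_distrib sum.distrib)
  finally show "lin_ext f (u + v) = lin_ext f u + lin_ext f v" .
next
  fix a and v :: "'b \<Rightarrow>\<^sub>0 'a"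
  have "lin_ext f (a *\<^sub>s v) = (\<Sum>i\<in>supp v. coef (a *\<^sub>s v) i *\<^sub>s f i)"
    by (rule lin_ext_superset) (auto simp: in_keys_iff)
  then show "lin_ext f (a *\<^sub>s v) = a *\<^sub>s lin_ext f v"
    by (simp add: lin_ext_def fs.scale_sum_right)
qed

lemma lin_ext_single [simp]: "lin_ext f (Poly_Mapping.single i a) = a *\<^sub>s f i"
  by (cases "a = 0") (simp_all add: lin_ext_def)

(* The rule rewrites the basis vector at index 0 to the unit of a ring structure that has no
   meaning on index types of bases. *)
declare single_one [simp del]

lemma bv_nz [simp]: "(bv i :: 'i \<Rightarrow>\<^sub>0 'k::field) \<noteq> 0"
  by (metis lookup_single_eq lookup_zero one_neq_zero)

lemma scale_bv: "a *\<^sub>s bv i = Poly_Mapping.single i a"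
  by (rule poly_mapping_eqI) (simp add: lookup_single when_def)

lemma bv_expansion: "v = (\<Sum>i\<in>supp v. coef v i *\<^sub>s bv i)"
  by (rule poly_mapping_eqI)
     (auto simp: lookup_sum lookup_single when_def in_keys_iff if_distrib cong: if_cong)

lemma lin_eqI:
  assumes "lin f" "lin g" "\<And>i. f (bv i) = g (bv i)"
  shows "f v = g v"
proof -
  have "f v = (\<Sum>i\<in>supp v. coef v i *\<^sub>s f (bv i))"
    by (subst bv_expansion) (simp add: fsp.linear_sum[OF assms(1)] fsp.linear_scale[OF assms(1)])
  also have "\<dots> = g v"
    by (subst (3) bv_expansion)
       (simp add: fsp.linear_sum[OF assms(2)] fsp.linear_scale[OF assms(2)] assms(3))
  finally show ?thesis .
qed

lemma lin_expand:
  assumes "lin f"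
  shows "f v = (\<Sum>i\<in>supp v. coef v i *\<^sub>s f (bv i))"
  by (subst bv_expansion) (simp add: fsp.linear_sum[OF assms] fsp.linear_scale[OF assms])

lemma lin_scale_fs: "lin f \<Longrightarrow> lin (\<lambda>v. a *\<^sub>s f v)"
  by (rule linI) (simp_all add: fsp.linear_add fsp.linear_scale fs.scale_right_distrib mult.commute)

lemma lin_add: "lin f \<Longrightarrow> lin g \<Longrightarrow> lin (\<lambda>v. f v + g v)"
  by (rule linI) (simp_all add: fsp.linear_add fsp.linear_scale fs.scale_right_distrib algebra_simps)

lemma lin_diff: "lin f \<Longrightarrow> lin g \<Longrightarrow> lin (\<lambda>v. f v - g v)"
  by (rule linI) (simp_all add: fsp.linear_add fsp.linear_scale fs.scale_right_diff_distrib algebra_simps)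

lemma lin_zero: "lin (\<lambda>v. 0)"
  by (rule linI) simp_all

text \<open>Representatives modulo a subspace can be chosen linearly, because the subspace has a
  complement. Congruences modulo the subspace then become equations between representatives.\<close>

lemma exists_normal_form:
  fixes L :: "('i \<Rightarrow>\<^sub>0 'k::field) set"
  assumes "fs.subspace L"
  obtains nf :: "('i \<Rightarrow>\<^sub>0 'k) \<Rightarrow> ('i \<Rightarrow>\<^sub>0 'k)"
    where "lin nf" "\<And>p. nf p = 0 \<longleftrightarrow> p \<in> L" "\<And>p. p - nf p \<in> L"
proof -
  have "\<exists>g\<in>{g. lin g}. range g \<subseteq> L \<and> (\<forall>v\<in>L. g v = v)"
    using fsp.linear_exists_left_inverse_on[of "\<lambda>v. v" L] lin_id assms by auto
  then obtain g where g: "lin g" "range g \<subseteq> L" "\<And>v. v \<in> L \<Longrightarrow> g v = v" by auto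
  show thesis
  proof (rule that[of "\<lambda>p. p - g p"])
    show "lin (\<lambda>p. p - g p)" by (intro lin_diff lin_id g(1))
    show "p - g p = 0 \<longleftrightarrow> p \<in> L" for p
      using g by (metis eq_iff_diff_eq_0 rangeI subsetD)
    show "p - (p - g p) \<in> L" for p using g by auto
  qed
qed


section \<open>Representations of free algebras\<close>

lemma free_scal_mult: "free_scal a * p = a *\<^sub>s p"
  by (simp add: free_scal_def scale_fs_def mult_map_scale_conv_mult zero_list_def)

lemma mult_single_list:
  "Poly_Mapping.single u a * Poly_Mapping.single w b = Poly_Mapping.single (u @ w) (a * b)"
  by (simp add: mult_single plus_list_def)

lemma one_eq_bv: "(1 :: ('g, 'k::field) free_alg) = bv []"
  by (metis single_one zero_list_def)

lemma scale_mult_left: "(a *\<^sub>s p) * (s :: ('g, 'k::field) free_alg) = a *\<^sub>s (p * s)"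
  by (simp add: free_scal_mult[symmetric] mult.assoc)

lemma lin_mult_left: "lin (\<lambda>p. p * (s :: ('g, 'k::field) free_alg))"
  by (rule linI) (simp_all add: scale_mult_left algebra_simps)

lemma mult_scale_right: "(p :: ('g, 'k::field) free_alg) * (a *\<^sub>s s) = a *\<^sub>s (p * s)"
proof -
  have "p * free_scal a = a *\<^sub>s p"
  proof (rule lin_eqI[where f = "\<lambda>p. p * free_scal a"])
    show "bv i * free_scal a = a *\<^sub>s bv i" for i :: "'g list"
      by (simp add: free_scal_def mult_single_list scale_bv)
  qed (intro lin_mult_left lin_scale_fs lin_id)+
  then have "p * (free_scal a * s) = (a *\<^sub>s p) * s" by (simp add: mult.assoc[symmetric])
  then show ?thesis by (simp add: free_scal_mult scale_mult_left)
qed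

lemma lin_mult_right: "lin (\<lambda>s. (p :: ('g, 'k::field) free_alg) * s)"
  by (rule linI) (simp_all add: mult_scale_right algebra_simps)

text \<open>Operators for the generators extend to a representation of the free algebra; the last letter
  of a word acts first.\<close>

definition act :: "('g \<Rightarrow> ('j \<Rightarrow>\<^sub>0 'k) \<Rightarrow> ('j \<Rightarrow>\<^sub>0 'k)) \<Rightarrow> ('g, 'k::field) free_alg \<Rightarrow>
    ('j \<Rightarrow>\<^sub>0 'k) \<Rightarrow> ('j \<Rightarrow>\<^sub>0 'k)" where
  "act \<rho> p v = lin_ext (\<lambda>w. foldr \<rho> w v) p"

lemma lin_act_left: "lin (\<lambda>p. act \<rho> p v)"
  unfolding act_def by (rule lin_lin_ext)

lemma lin_foldr: "(\<And>g. lin (\<rho> g)) \<Longrightarrow> lin (foldr \<rho> w)"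
  by (induction w) (simp_all add: lin_id id_def comp_def lin_comp)

lemma lin_sum: "(\<And>i. i \<in> S \<Longrightarrow> lin (f i)) \<Longrightarrow> lin (\<lambda>v. \<Sum>i\<in>S. f i v)"
  by (induction S rule: infinite_finite_induct) (simp_all add: lin_zero lin_add)

lemma lin_act: "(\<And>g. lin (\<rho> g)) \<Longrightarrow> lin (act \<rho> p)"
  unfolding act_def lin_ext_def by (intro lin_sum lin_scale_fs lin_foldr) auto

lemma act_simps:
  "act \<rho> (p + p') v = act \<rho> p v + act \<rho> p' v"
  "act \<rho> (p - p') v = act \<rho> p v - act \<rho> p' v"
  "act \<rho> 0 v = 0"
  "act \<rho> (a *\<^sub>s p) v = a *\<^sub>s act \<rho> p v"
  using fsp.linear_add[OF lin_act_left] fsp.linear_diff[OF lin_act_left]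
    fsp.linear_0[OF lin_act_left] fsp.linear_scale[OF lin_act_left]
  by blast+

lemma act_one: "act \<rho> 1 v = v"
  by (simp add: act_def one_eq_bv)

lemma act_free_gen: "act \<rho> (free_gen g) v = \<rho> g v"
  by (simp add: act_def free_gen_def)

lemma act_free_scal: "act \<rho> (free_scal a) v = a *\<^sub>s v"
  by (simp add: act_def free_scal_def)

lemma act_mult:
  assumes "\<And>g. lin (\<rho> g)"
  shows "act \<rho> (p * s) v = act \<rho> p (act \<rho> s v)"
proof -
  note l = lin_act[of \<rho>, OF assms] lin_act_left
  have 1: "act \<rho> (bv w * s) v = act \<rho> (bv w) (act \<rho> s v)" for w
  proof (rule lin_eqI[where f = "\<lambda>s. act \<rho> (bv w * s) v" and g = "\<lambda>s. act \<rho> (bv w) (act \<rho> s v)"])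
    show "act \<rho> (bv w * bv i) v = act \<rho> (bv w) (act \<rho> (bv i) v)" for i
      by (simp add: act_def mult_single_list)
  qed (intro lin_comp[OF lin_act_left lin_mult_right] lin_comp[OF l(1) lin_act_left])+
  show ?thesis
    by (rule lin_eqI[where f = "\<lambda>p. act \<rho> (p * s) v" and g = "\<lambda>p. act \<rho> p (act \<rho> s v)"])
       (intro lin_comp[OF lin_act_left lin_mult_left] lin_act_left 1)+
qed

text \<open>Every later comparison of modules goes through this fact: a linear map need only commute with
  the generators.\<close>

lemma act_intertwine:
  assumes "lin T" "\<And>g v. T (\<rho> g v) = \<rho>' g (T v)"
  shows "T (act \<rho> p v) = act \<rho>' p (T v)"
proof -
  have "T (foldr \<rho> w v) = foldr \<rho>' w (T v)" for w
    by (induction w) (simp_all add: assms(2))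
  then show ?thesis
    by (simp add: act_def lin_ext_def fsp.linear_sum[OF assms(1)] fsp.linear_scale[OF assms(1)])
qed

lemma act_invariant:
  assumes "fs.subspace N" "\<And>g v. v \<in> N \<Longrightarrow> \<rho> g v \<in> N" "v \<in> N"
  shows "act \<rho> p v \<in> N"
proof -
  have "foldr \<rho> w v \<in> N" for w by (induction w) (use assms in auto)
  then show ?thesis
    unfolding act_def lin_ext_def by (intro fs.subspace_sum fs.subspace_scale assms(1)) auto
qed

lemma free_map_eq: "free_map f p = lin_ext (\<lambda>w. bv (map f w)) p"
  by (simp add: free_map_def lin_ext_def scale_bv)

lemma lin_free_map: "lin (free_map f)"
  unfolding free_map_eq[abs_def] by (rule lin_lin_ext)

lemma free_map_mult:
  fixes p s :: "('g, 'k::field) free_alg"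
  shows "free_map f (p * s) = free_map f p * free_map f s"
proof -
  have 1: "free_map f (bv w * s) = free_map f (bv w) * free_map f s" for w
  proof (rule lin_eqI[where f = "\<lambda>s. free_map f (bv w * s)"
        and g = "\<lambda>s. free_map f (bv w) * free_map f s"])
    show "free_map f (bv w * bv i) = free_map f (bv w) * free_map f (bv i :: ('g, 'k) free_alg)" for i
      by (simp add: free_map_eq mult_single_list)
  qed (rule lin_comp[OF lin_free_map lin_mult_right] lin_comp[OF lin_mult_right lin_free_map])+
  show ?thesis
    by (rule lin_eqI[where f = "\<lambda>p. free_map f (p * s)" and g = "\<lambda>p. free_map f p * free_map f s"])
       (intro lin_comp[OF lin_free_map lin_mult_left] lin_comp[OF lin_mult_left lin_free_map] 1)+
qed

lemma free_map_simps:
  "free_map f (p + s) = free_map f p + free_map f s"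
  "free_map f (p - s) = free_map f p - free_map f s"
  "free_map f 0 = 0"
  "free_map f (a *\<^sub>s p) = a *\<^sub>s free_map f p"
  "free_map f 1 = 1"
  "free_map f (free_gen g) = free_gen (f g)"
  "free_map f (free_scal a) = free_scal a"
  using fsp.linear_add[OF lin_free_map] fsp.linear_diff[OF lin_free_map]
    fsp.linear_0[OF lin_free_map] fsp.linear_scale[OF lin_free_map]
  by (blast, blast, blast, blast,
      simp_all add: free_map_eq one_eq_bv free_gen_def free_scal_def scale_bv)

lemma act_free_map: "act \<rho> (free_map f p) v = act (\<lambda>g. \<rho> (f g)) p v"
proof (rule lin_eqI[where f = "\<lambda>p. act \<rho> (free_map f p) v"])
  show "act \<rho> (free_map f (bv w)) v = act (\<lambda>g. \<rho> (f g)) (bv w) v" for w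
    by (simp add: free_map_eq act_def foldr_map comp_def)
qed (intro lin_comp[OF lin_act_left lin_free_map] lin_act_left)+

section \<open>Presented algebras and their cyclic modules\<close>

abbreviation free_ring :: "('g, 'k::field) free_alg ring" where
  "free_ring \<equiv> ring_of_type_algebra"

lemma free_ring_simps [simp]:
  "carrier free_ring = UNIV" "add free_ring = (+)" "monoid.mult free_ring = (*)"
  "ring.zero free_ring = 0" "monoid.one free_ring = 1"
  by (simp_all add: ring_of_type_algebra_def)

lemma ring_free_ring: "ring (free_ring :: ('g, 'k::field) free_alg ring)"
proof -
  have "\<exists>y. x + y = 0" for x :: "('g, 'k) free_alg"
    by (rule exI[of _ "- x"]) simp
  then show ?thesis
    unfolding ring_of_type_algebra_def
    by unfold_locales (auto simp: algebra_simps Units_def)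
qed

definition left_ideal :: "('g, 'k::field) free_alg set \<Rightarrow> bool" where
  "left_ideal L \<longleftrightarrow> 0 \<in> L \<and> (\<forall>x\<in>L. \<forall>y\<in>L. x + y \<in> L) \<and> (\<forall>a. \<forall>x\<in>L. a * x \<in> L)"

lemma left_ideal_subspace: "left_ideal L \<Longrightarrow> fs.subspace L"
  unfolding left_ideal_def fs.subspace_def by (metis free_scal_mult)

lemma left_idealD:
  assumes "left_ideal L"
  shows "0 \<in> L" "x \<in> L \<Longrightarrow> y \<in> L \<Longrightarrow> x + y \<in> L" "x \<in> L \<Longrightarrow> y \<in> L \<Longrightarrow> x - y \<in> L"
    "x \<in> L \<Longrightarrow> a * x \<in> L" "x \<in> L \<Longrightarrow> c *\<^sub>s x \<in> L" "x \<in> L \<Longrightarrow> - x \<in> L"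
  using assms fs.subspace_diff[OF left_ideal_subspace[OF assms]]
    fs.subspace_scale[OF left_ideal_subspace[OF assms]]
    fs.subspace_neg[OF left_ideal_subspace[OF assms]]
  unfolding left_ideal_def by auto

lemma ideal_pres_ideal: "ideal (pres_ideal rels) free_ring"
  unfolding pres_ideal_def by (rule ring.genideal_ideal[OF ring_free_ring]) simp

lemma left_ideal_pres_ideal: "left_ideal (pres_ideal rels)"
  using additive_subgroup.zero_closed[OF ideal.axioms(1)[OF ideal_pres_ideal, of rels]]
    additive_subgroup.a_closed[OF ideal.axioms(1)[OF ideal_pres_ideal, of rels]]
    ideal.I_l_closed[OF ideal_pres_ideal, of _ rels]
  unfolding left_ideal_def by auto

lemma pres_ideal_mult_right: "x \<in> pres_ideal rels \<Longrightarrow> x * a \<in> pres_ideal rels"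
  using ideal.I_r_closed[OF ideal_pres_ideal, of x rels a] by simp

lemma rels_subset_pres_ideal: "rels \<subseteq> pres_ideal rels"
  unfolding pres_ideal_def by (rule ring.genideal_self[OF ring_free_ring]) simp

lemma pres_ideal_minimal:
  assumes "left_ideal S" "\<And>x a. x \<in> S \<Longrightarrow> x * a \<in> S" "rels \<subseteq> S"
  shows "pres_ideal rels \<subseteq> S"
proof -
  have inv: "inv\<^bsub>add_monoid free_ring\<^esub> x = - x" for x :: "('a, 'b) free_alg"
    using group.inv_equality[OF abelian_group.a_group[OF ring.is_abelian_group[OF ring_free_ring]],
        of "- x" x] by simp
  have "subgroup S (add_monoid free_ring)"
    by (rule subgroup.intro) (use left_idealD[OF assms(1)] inv in auto)
  then have "ideal S free_ring"
    using left_idealD[OF assms(1)] assms(2) by (intro idealI ring_free_ring) auto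
  then show ?thesis
    unfolding pres_ideal_def by (rule ring.genideal_minimal[OF ring_free_ring _ assms(3)])
qed

text \<open>The annihilator of a representation is a two-sided ideal.\<close>

lemma pres_ideal_annihilates:
  assumes "\<And>g. lin (\<rho> g)" "\<And>p v. p \<in> rels \<Longrightarrow> act \<rho> p v = 0" "x \<in> pres_ideal rels"
  shows "act \<rho> x v = 0"
proof -
  have "pres_ideal rels \<subseteq> {p. \<forall>v. act \<rho> p v = 0}"
  proof (rule pres_ideal_minimal)
    show "left_ideal {p. \<forall>v. act \<rho> p v = 0}"
      unfolding left_ideal_def
      by (auto simp: act_simps act_mult assms(1) fsp.linear_0[OF lin_act[OF assms(1)]])
  qed (use assms in \<open>auto simp: act_mult\<close>)
  then show ?thesis using assms(3) by auto
qed

lemma pres_class_eq_set: "pres_class rels p = {s. s - p \<in> pres_ideal rels}"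
proof -
  have "pres_class rels p = {h + p | h. h \<in> pres_ideal rels}"
    by (auto simp: pres_class_def a_r_coset_def r_coset_def)
  also have "\<dots> = {s. s - p \<in> pres_ideal rels}"
    by (auto simp: algebra_simps) (metis add.commute diff_add_cancel)
  finally show ?thesis .
qed

lemma pres_class_self: "p \<in> pres_class rels p"
  using left_idealD(1)[OF left_ideal_pres_ideal] by (simp add: pres_class_eq_set)

lemma pres_class_eq_iff: "pres_class rels p = pres_class rels s \<longleftrightarrow> p - s \<in> pres_ideal rels"
proof
  assume "pres_class rels p = pres_class rels s"
  then have "p \<in> pres_class rels s"
    using pres_class_self by metis
  then show "p - s \<in> pres_ideal rels" by (simp add: pres_class_eq_set)
next
  assume a: "p - s \<in> pres_ideal rels"
  have "t - p \<in> pres_ideal rels \<longleftrightarrow> t - s \<in> pres_ideal rels" for t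
    using left_idealD(2)[OF left_ideal_pres_ideal, OF _ a, of "t - p"]
      left_idealD(3)[OF left_ideal_pres_ideal, OF _ a, of "t - s"] by auto
  then show "pres_class rels p = pres_class rels s" by (simp add: pres_class_eq_set)
qed

lemma carrier_pres_alg: "carrier (pres_alg rels) = range (pres_class rels)"
  by (auto simp: pres_alg_def FactRing_def A_RCOSETS_def RCOSETS_def pres_class_def a_r_coset_def)

lemma pres_alg_mult:
  "pres_class rels p \<otimes>\<^bsub>pres_alg rels\<^esub> pres_class rels s = pres_class rels (p * s)"
  using ideal.rcoset_mult_add[OF ideal_pres_ideal, of p s rels]
  by (simp add: pres_alg_def FactRing_def pres_class_def)

lemma pres_alg_add:
  "pres_class rels p \<oplus>\<^bsub>pres_alg rels\<^esub> pres_class rels s = pres_class rels (p + s)"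
proof -
  have "abelian_subgroup (pres_ideal rels) free_ring"
    by (rule abelian_subgroupI3[OF ideal.axioms(1)[OF ideal_pres_ideal]
          ring.is_abelian_group[OF ring_free_ring]])
  from abelian_subgroup.a_rcos_sum[OF this, of p s] show ?thesis
    by (simp add: pres_alg_def FactRing_def pres_class_def)
qed

lemma pres_alg_zero: "\<zero>\<^bsub>pres_alg rels\<^esub> = pres_class rels 0"
  by (simp add: pres_alg_def FactRing_def pres_class_eq_set)

lemma pres_alg_one: "\<one>\<^bsub>pres_alg rels\<^esub> = pres_class rels 1"
  by (simp add: pres_alg_def FactRing_def pres_class_def)

lemma ring_pres_alg: "ring (pres_alg rels)"
  unfolding pres_alg_def by (rule ideal.quotient_is_ring[OF ideal_pres_ideal])

lemma pres_alg_minus: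
  "pres_class rels p \<ominus>\<^bsub>pres_alg rels\<^esub> pres_class rels s = pres_class rels (p - s)"
proof -
  interpret ring "pres_alg rels" by (rule ring_pres_alg)
  have "\<ominus>\<^bsub>pres_alg rels\<^esub> pres_class rels s = pres_class rels (- s)"
    by (rule minus_equality) (auto simp: pres_alg_add pres_alg_zero carrier_pres_alg)
  then show ?thesis by (simp add: a_minus_def pres_alg_add)
qed

text \<open>Three generators are enough for the defining left ideals of both kinds of Verma modules; for
  the quantum group one of them is 0. The relations are included, so this is the preimage in the
  free algebra of a left ideal of the presented algebra.\<close>

definition left_span :: "('g, 'k::field) free_alg set \<Rightarrow> ('g, 'k) free_alg \<Rightarrow> ('g, 'k) free_alg \<Rightarrow>
    ('g, 'k) free_alg \<Rightarrow> ('g, 'k) free_alg set" where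
  "left_span rels g1 g2 g3 = {i + a * g1 + b * g2 + c * g3 | i a b c. i \<in> pres_ideal rels}"

lemma left_spanI:
  "i \<in> pres_ideal rels \<Longrightarrow> x = i + a * g1 + b * g2 + c * g3 \<Longrightarrow> x \<in> left_span rels g1 g2 g3"
  unfolding left_span_def by blast

lemma left_spanE:
  assumes "x \<in> left_span rels g1 g2 g3"
  obtains i a b c where "i \<in> pres_ideal rels" "x = i + a * g1 + b * g2 + c * g3"
  using assms unfolding left_span_def by blast

lemma left_ideal_left_span: "left_ideal (left_span rels g1 g2 g3)"
  unfolding left_ideal_def
proof (intro conjI ballI allI)
  note li = left_idealD[OF left_ideal_pres_ideal[of rels]]
  show "0 \<in> left_span rels g1 g2 g3" by (rule left_spanI[OF li(1), of _ 0 _ 0 _ 0]) simp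
  fix x assume "x \<in> left_span rels g1 g2 g3"
  then obtain i a b c where i: "i \<in> pres_ideal rels" and x: "x = i + a * g1 + b * g2 + c * g3"
    by (rule left_spanE)
  show "d * x \<in> left_span rels g1 g2 g3" for d
    by (rule left_spanI[OF li(4)[OF i], of _ d "d * a" _ "d * b" _ "d * c"])
      (simp add: x algebra_simps)
  fix y assume "y \<in> left_span rels g1 g2 g3"
  then obtain i' a' b' c' where i': "i' \<in> pres_ideal rels"
    and y: "y = i' + a' * g1 + b' * g2 + c' * g3"
    by (rule left_spanE)
  show "x + y \<in> left_span rels g1 g2 g3"
    by (rule left_spanI[OF li(2)[OF i i'], of _ "a + a'" _ "b + b'" _ "c + c'"])
      (simp add: x y algebra_simps)
qed

lemma left_span_superset:
  "pres_ideal rels \<subseteq> left_span rels g1 g2 g3"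
  "g1 \<in> left_span rels g1 g2 g3" "g2 \<in> left_span rels g1 g2 g3" "g3 \<in> left_span rels g1 g2 g3"
proof -
  note z = left_idealD(1)[OF left_ideal_pres_ideal[of rels]]
  show "pres_ideal rels \<subseteq> left_span rels g1 g2 g3"
  proof
    fix i assume "i \<in> pres_ideal rels"
    then show "i \<in> left_span rels g1 g2 g3" by (rule left_spanI[of _ _ _ 0 _ 0 _ 0]) simp
  qed
  show "g1 \<in> left_span rels g1 g2 g3" by (rule left_spanI[OF z, of _ 1 _ 0 _ 0]) simp
  show "g2 \<in> left_span rels g1 g2 g3" by (rule left_spanI[OF z, of _ 0 _ 1 _ 0]) simp
  show "g3 \<in> left_span rels g1 g2 g3" by (rule left_spanI[OF z, of _ 0 _ 0 _ 1]) simp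
qed

lemma left_span_minimal:
  assumes "left_ideal M" "pres_ideal rels \<subseteq> M" "g1 \<in> M" "g2 \<in> M" "g3 \<in> M"
  shows "left_span rels g1 g2 g3 \<subseteq> M"
  using assms by (auto elim!: left_spanE intro!: left_idealD(2,4)[OF assms(1)])

lemma image_left_span:
  "pres_class rels ` left_span rels g1 g2 g3 =
     {pres_class rels (a * g1 + b * g2 + c * g3) | a b c. True}"
proof (intro subset_antisym subsetI)
  fix Z assume "Z \<in> pres_class rels ` left_span rels g1 g2 g3"
  then obtain i a b c where i: "i \<in> pres_ideal rels"
    and Z: "Z = pres_class rels (i + a * g1 + b * g2 + c * g3)"
    by (auto elim: left_spanE)
  have "Z = pres_class rels (a * g1 + b * g2 + c * g3)"
    unfolding Z pres_class_eq_iff using i by (simp add: algebra_simps)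
  then show "Z \<in> {pres_class rels (a * g1 + b * g2 + c * g3) | a b c. True}" by blast
next
  fix Z assume "Z \<in> {pres_class rels (a * g1 + b * g2 + c * g3) | a b c. True}"
  then obtain a b c where Z: "Z = pres_class rels (a * g1 + b * g2 + c * g3)" by blast
  have "a * g1 + b * g2 + c * g3 \<in> left_span rels g1 g2 g3"
    by (rule left_spanI[OF left_idealD(1)[OF left_ideal_pres_ideal], of _ a _ b _ c]) simp
  then show "Z \<in> pres_class rels ` left_span rels g1 g2 g3" unfolding Z by (rule imageI)
qed

text \<open>The class of p in the quotient of the presented algebra by the left ideal that the left
  ideal L of the free algebra induces.\<close>

definition quot_class :: "('g, 'k::field) free_alg set \<Rightarrow> ('g, 'k) free_alg set \<Rightarrow>
    ('g, 'k) free_alg \<Rightarrow> ('g, 'k) free_alg set set" where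
  "quot_class rels L p = pres_class rels ` {s. s - p \<in> L}"

context
  fixes rels L :: "('g, 'k::field) free_alg set"
  assumes L: "left_ideal L" "pres_ideal rels \<subseteq> L"
begin

lemma quot_class_rcoset:
  "pres_class rels ` L +>\<^bsub>pres_alg rels\<^esub> pres_class rels p = quot_class rels L p"
proof -
  have "pres_class rels ` L +>\<^bsub>pres_alg rels\<^esub> pres_class rels p = (\<lambda>l. pres_class rels (l + p)) ` L"
    by (auto simp: a_r_coset_def r_coset_def pres_alg_add)
  also have "\<dots> = pres_class rels ` ((\<lambda>l. l + p) ` L)" by (simp add: image_image)
  also have "(\<lambda>l. l + p) ` L = {s. s - p \<in> L}"
    by (auto intro: image_eqI[where x = "_ - p"])
  finally show ?thesis by (simp add: quot_class_def)
qed

lemma quot_class_eq_iff: "quot_class rels L p = quot_class rels L s \<longleftrightarrow> p - s \<in> L"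
proof
  assume "quot_class rels L p = quot_class rels L s"
  moreover have "pres_class rels p \<in> quot_class rels L p"
    using left_idealD(1)[OF L(1)] by (auto simp: quot_class_def)
  ultimately obtain t where "pres_class rels p = pres_class rels t" "t - s \<in> L"
    by (auto simp: quot_class_def)
  then have "p - t \<in> L" "t - s \<in> L" using L(2) by (auto simp: pres_class_eq_iff)
  then show "p - s \<in> L" using left_idealD(2)[OF L(1)] by fastforce
next
  assume a: "p - s \<in> L"
  have "t - p \<in> L \<longleftrightarrow> t - s \<in> L" for t
    using left_idealD(2)[OF L(1), OF _ a, of "t - p"]
      left_idealD(3)[OF L(1), OF _ a, of "t - s"] by auto
  then show "quot_class rels L p = quot_class rels L s" by (simp add: quot_class_def)
qed

lemma carrier_quot_module:
  "carrier (quot_module (pres_alg rels) (pres_class rels ` L)) = range (quot_class rels L)"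
  by (auto simp: quot_module_def A_RCOSETS_def RCOSETS_def carrier_pres_alg
      quot_class_rcoset[symmetric] a_r_coset_def)

lemma quot_module_zero:
  "\<zero>\<^bsub>quot_module (pres_alg rels) (pres_class rels ` L)\<^esub> = quot_class rels L 0"
  by (simp add: quot_module_def quot_class_def)

lemma quot_module_add:
  "quot_class rels L p \<oplus>\<^bsub>quot_module (pres_alg rels) (pres_class rels ` L)\<^esub> quot_class rels L s =
   quot_class rels L (p + s)"
proof -
  have "quot_class rels L p \<oplus>\<^bsub>quot_module (pres_alg rels) (pres_class rels ` L)\<^esub> quot_class rels L s
     = {pres_class rels (a + b) | a b. a - p \<in> L \<and> b - s \<in> L}"
    by (auto simp: quot_module_def set_add_def set_mult_def quot_class_def pres_alg_add)
  also have "\<dots> = quot_class rels L (p + s)"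
  proof (intro subset_antisym subsetI)
    fix Z assume "Z \<in> {pres_class rels (a + b) | a b. a - p \<in> L \<and> b - s \<in> L}"
    then obtain a b where "Z = pres_class rels (a + b)" "a - p \<in> L" "b - s \<in> L" by auto
    then show "Z \<in> quot_class rels L (p + s)"
      using left_idealD(2)[OF L(1), of "a - p" "b - s"]
      by (auto simp: quot_class_def algebra_simps intro!: imageI)
  next
    fix Z assume "Z \<in> quot_class rels L (p + s)"
    then obtain t where "Z = pres_class rels t" "t - (p + s) \<in> L" by (auto simp: quot_class_def)
    then have "Z = pres_class rels ((t - s) + s) \<and> (t - s) - p \<in> L \<and> s - s \<in> L"
      using left_idealD(1)[OF L(1)] by (simp add: algebra_simps)
    then show "Z \<in> {pres_class rels (a + b) | a b. a - p \<in> L \<and> b - s \<in> L}" by blast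
  qed
  finally show ?thesis .
qed

lemma quot_module_smult:
  "pres_class rels a \<odot>\<^bsub>quot_module (pres_alg rels) (pres_class rels ` L)\<^esub> quot_class rels L p =
   quot_class rels L (a * p)"
proof -
  have "pres_class rels a \<odot>\<^bsub>quot_module (pres_alg rels) (pres_class rels ` L)\<^esub> quot_class rels L p
     = (\<Union>s\<in>{s. s - p \<in> L}. quot_class rels L (a * s))"
    by (simp add: quot_module_def quot_class_def[of rels L p] pres_alg_mult quot_class_rcoset)
  also have "\<dots> = (\<Union>s\<in>{s. s - p \<in> L}. quot_class rels L (a * p))"
    using left_idealD(4)[OF L(1), of "_ - p" a]
    by (intro SUP_cong refl) (simp add: quot_class_eq_iff right_diff_distrib[symmetric])
  also have "\<dots> = quot_class rels L (a * p)"
  proof -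
    have "p \<in> {s. s - p \<in> L}" using left_idealD(1)[OF L(1)] by simp
    then show ?thesis by blast
  qed
  finally show ?thesis .
qed

end


section \<open>Realising modules on spaces of finitely supported functions\<close>

text \<open>A module over a presented algebra, whose elements are cosets of cosets, is transported along
  a bijection to a type of finitely supported functions on which generator g acts by the operator
  of index g. All questions about submodules, sums and homomorphisms become linear algebra there.\<close>

definition realises :: "('g, 'k::field) free_alg set \<Rightarrow> (('g, 'k) free_alg set, 'b) module \<Rightarrow>
    ('g \<Rightarrow> ('j \<Rightarrow>\<^sub>0 'k) \<Rightarrow> ('j \<Rightarrow>\<^sub>0 'k)) \<Rightarrow> ('b \<Rightarrow> ('j \<Rightarrow>\<^sub>0 'k)) \<Rightarrow> bool" where
  "realises rels M \<rho> \<Phi> \<longleftrightarrow>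
     (\<forall>g. lin (\<rho> g)) \<and> bij_betw \<Phi> (carrier M) UNIV \<and>
     (\<forall>x\<in>carrier M. \<forall>y\<in>carrier M. x \<oplus>\<^bsub>M\<^esub> y \<in> carrier M \<and> \<Phi> (x \<oplus>\<^bsub>M\<^esub> y) = \<Phi> x + \<Phi> y) \<and>
     \<zero>\<^bsub>M\<^esub> \<in> carrier M \<and> \<Phi> \<zero>\<^bsub>M\<^esub> = 0 \<and>
     (\<forall>p. \<forall>x\<in>carrier M. pres_class rels p \<odot>\<^bsub>M\<^esub> x \<in> carrier M \<and>
        \<Phi> (pres_class rels p \<odot>\<^bsub>M\<^esub> x) = act \<rho> p (\<Phi> x))"

text \<open>A cyclic vector realises the quotient by its annihilator.\<close>

lemma quot_module_realised:
  fixes rels L :: "('g, 'k::field) free_alg set"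
  assumes L: "left_ideal L" "pres_ideal rels \<subseteq> L"
    and \<rho>: "\<And>g. lin (\<rho> g)"
    and ker: "\<And>p. act \<rho> p u = 0 \<longleftrightarrow> p \<in> L"
    and surj: "\<And>v. \<exists>p. act \<rho> p u = v"
  obtains \<Phi> where "realises rels (quot_module (pres_alg rels) (pres_class rels ` L)) \<rho> \<Phi>"
    "\<And>p. \<Phi> (quot_class rels L p) = act \<rho> p u"
proof -
  define \<Phi> where "\<Phi> Z = act \<rho> (SOME p. Z = quot_class rels L p) u" for Z
  have eq: "act \<rho> p u = act \<rho> s u \<longleftrightarrow> p - s \<in> L" for p s
    using ker[of "p - s"] by (simp add: act_simps)
  have \<Phi>: "\<Phi> (quot_class rels L p) = act \<rho> p u" for p
  proof -
    have "quot_class rels L p = quot_class rels L (SOME s. quot_class rels L p = quot_class rels L s)"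
      by (rule someI[of "\<lambda>s. quot_class rels L p = quot_class rels L s"]) simp
    then show ?thesis by (simp add: \<Phi>_def eq quot_class_eq_iff[OF L])
        (metis eq)
  qed
  have "realises rels (quot_module (pres_alg rels) (pres_class rels ` L)) \<rho> \<Phi>"
    unfolding realises_def
  proof (intro conjI allI)
    show "bij_betw \<Phi> (carrier (quot_module (pres_alg rels) (pres_class rels ` L))) UNIV"
    proof (rule bij_betwI')
      fix x y assume "x \<in> carrier (quot_module (pres_alg rels) (pres_class rels ` L))"
        "y \<in> carrier (quot_module (pres_alg rels) (pres_class rels ` L))"
      then show "(\<Phi> x = \<Phi> y) = (x = y)"
        unfolding carrier_quot_module[OF L] by (elim rangeE) (simp add: \<Phi> quot_class_eq_iff[OF L] eq)
    next
      fix v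
      obtain p where "act \<rho> p u = v" using surj by blast
      then show "\<exists>x\<in>carrier (quot_module (pres_alg rels) (pres_class rels ` L)). v = \<Phi> x"
        by (auto simp: carrier_quot_module[OF L] \<Phi>)
    qed simp
  qed (auto simp: carrier_quot_module[OF L] quot_module_zero[OF L] quot_module_add[OF L]
         quot_module_smult[OF L] \<Phi> act_simps act_mult \<rho>)
  then show thesis using that \<Phi> by blast
qed

definition stable :: "('g \<Rightarrow> ('j \<Rightarrow>\<^sub>0 'k) \<Rightarrow> ('j \<Rightarrow>\<^sub>0 'k)) \<Rightarrow> ('j \<Rightarrow>\<^sub>0 'k::field) set \<Rightarrow> bool" where
  "stable \<rho> V \<longleftrightarrow> fs.subspace V \<and> (\<forall>g. \<forall>v\<in>V. \<rho> g v \<in> V)"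

context
  fixes rels :: "('g, 'k::field) free_alg set" and M :: "(('g, 'k) free_alg set, 'b) module"
    and \<rho> :: "'g \<Rightarrow> ('j \<Rightarrow>\<^sub>0 'k) \<Rightarrow> ('j \<Rightarrow>\<^sub>0 'k)" and \<Phi> :: "'b \<Rightarrow> ('j \<Rightarrow>\<^sub>0 'k)"
  assumes realises: "realises rels M \<rho> \<Phi>"
begin

lemma realisesD:
  "lin (\<rho> g)"
  "x \<in> carrier M \<Longrightarrow> y \<in> carrier M \<Longrightarrow> x \<oplus>\<^bsub>M\<^esub> y \<in> carrier M"
  "x \<in> carrier M \<Longrightarrow> y \<in> carrier M \<Longrightarrow> \<Phi> (x \<oplus>\<^bsub>M\<^esub> y) = \<Phi> x + \<Phi> y"
  "\<zero>\<^bsub>M\<^esub> \<in> carrier M" "\<Phi> \<zero>\<^bsub>M\<^esub> = 0"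
  "x \<in> carrier M \<Longrightarrow> pres_class rels p \<odot>\<^bsub>M\<^esub> x \<in> carrier M"
  "x \<in> carrier M \<Longrightarrow> \<Phi> (pres_class rels p \<odot>\<^bsub>M\<^esub> x) = act \<rho> p (\<Phi> x)"
  "x \<in> carrier M \<Longrightarrow> y \<in> carrier M \<Longrightarrow> \<Phi> x = \<Phi> y \<longleftrightarrow> x = y"
  "\<exists>x\<in>carrier M. \<Phi> x = v"
  using realises unfolding realises_def bij_betw_def inj_on_def
  by (auto simp: image_iff) (metis UNIV_I image_iff)

lemma realises_eqI: "x \<in> carrier M \<Longrightarrow> y \<in> carrier M \<Longrightarrow> \<Phi> x = \<Phi> y \<Longrightarrow> x = y"
  by (simp add: realisesD(8))

lemma realised_neg:
  assumes "x \<in> carrier M"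
  shows "pres_class rels (free_scal (- 1)) \<odot>\<^bsub>M\<^esub> x \<oplus>\<^bsub>M\<^esub> x = \<zero>\<^bsub>M\<^esub>"
  using assms by (intro realises_eqI) (simp_all add: realisesD(1-7) act_free_scal)

lemma realised_abelian_group: "abelian_group M"
proof (rule abelian_groupI)
  fix x assume x: "x \<in> carrier M"
  show "\<exists>y\<in>carrier M. y \<oplus>\<^bsub>M\<^esub> x = \<zero>\<^bsub>M\<^esub>"
    using realised_neg[OF x] realisesD(6)[OF x] by blast
qed (auto intro!: realises_eqI simp: realisesD(1-7) algebra_simps)

lemma submodule_iff_stable:
  "submodule N (pres_alg rels) M \<longleftrightarrow> N \<subseteq> carrier M \<and> stable \<rho> (\<Phi> ` N)"
proof
  assume N: "submodule N (pres_alg rels) M"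
  interpret N: submodule N "pres_alg rels" M by (rule N)
  have sub: "N \<subseteq> carrier M" using N.subset by simp
  have smult: "pres_class rels p \<odot>\<^bsub>M\<^esub> x \<in> N" if "x \<in> N" for p x
    using that by (simp add: carrier_pres_alg)
  have act_in: "act \<rho> p (\<Phi> x) \<in> \<Phi> ` N" if "x \<in> N" for p x
  proof -
    have "act \<rho> p (\<Phi> x) = \<Phi> (pres_class rels p \<odot>\<^bsub>M\<^esub> x)"
      using sub that by (auto simp: realisesD(7))
    then show ?thesis using smult[OF that] by simp
  qed
  have "fs.subspace (\<Phi> ` N)"
    unfolding fs.subspace_def
  proof (intro conjI ballI allI)
    show "0 \<in> \<Phi> ` N" using N.one_closed realisesD(5) by (metis image_eqI monoid.simps(2))
  next
    fix u v assume "u \<in> \<Phi> ` N" "v \<in> \<Phi> ` N"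
    then obtain x y where xy: "x \<in> N" "y \<in> N" "u = \<Phi> x" "v = \<Phi> y" by blast
    have "u + v = \<Phi> (x \<oplus>\<^bsub>M\<^esub> y)"
      using xy(1,2) sub unfolding xy(3,4) by (intro realisesD(3)[symmetric]) blast+
    moreover have "x \<oplus>\<^bsub>M\<^esub> y \<in> N" using N.m_closed[OF xy(1,2)] by simp
    ultimately show "u + v \<in> \<Phi> ` N" by (rule image_eqI)
  next
    fix a v assume "v \<in> \<Phi> ` N"
    then show "a *\<^sub>s v \<in> \<Phi> ` N" using act_in[of _ "free_scal a"] by (auto simp: act_free_scal)
  qed
  moreover have "\<rho> g v \<in> \<Phi> ` N" if "v \<in> \<Phi> ` N" for g v
    using that act_in[of _ "free_gen g"] by (auto simp: act_free_gen)
  ultimately show "N \<subseteq> carrier M \<and> stable \<rho> (\<Phi> ` N)" using sub by (simp add: stable_def)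
next
  assume a: "N \<subseteq> carrier M \<and> stable \<rho> (\<Phi> ` N)"
  then have sub: "fs.subspace (\<Phi> ` N)" by (simp add: stable_def)
  have mem: "x \<in> N \<longleftrightarrow> \<Phi> x \<in> \<Phi> ` N" if "x \<in> carrier M" for x
  proof
    assume "\<Phi> x \<in> \<Phi> ` N"
    then obtain y where "y \<in> N" "\<Phi> x = \<Phi> y" by blast
    then show "x \<in> N" using a that realises_eqI[of x y] by auto
  qed simp
  have smult: "pres_class rels p \<odot>\<^bsub>M\<^esub> x \<in> N" if "x \<in> N" for p x
  proof -
    have "act \<rho> p (\<Phi> x) \<in> \<Phi> ` N"
      by (rule act_invariant) (use a that in \<open>auto simp: stable_def\<close>)
    then show ?thesis using that a by (subst mem) (auto simp: realisesD(1-7))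
  qed
  show "submodule N (pres_alg rels) M"
  proof (intro submodule.intro subgroup.intro, unfold submodule_axioms_def)
    show "N \<subseteq> carrier (add_monoid M)" using a by simp
    show "\<one>\<^bsub>add_monoid M\<^esub> \<in> N" using mem[OF realisesD(4)] fs.subspace_0[OF sub]
      by (simp add: realisesD(1-7))
    show "x \<otimes>\<^bsub>add_monoid M\<^esub> y \<in> N" if "x \<in> N" "y \<in> N" for x y
    proof -
      have "\<Phi> (x \<oplus>\<^bsub>M\<^esub> y) \<in> \<Phi> ` N"
        using that a fs.subspace_add[OF sub] by (auto simp: realisesD(1-7) subset_iff)
      then show ?thesis using that a mem[of "x \<oplus>\<^bsub>M\<^esub> y"] by (auto simp: realisesD(1-7) subset_iff)
    qed
    show "inv\<^bsub>add_monoid M\<^esub> x \<in> N" if "x \<in> N" for x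
    proof -
      have xc: "x \<in> carrier M" using that a by auto
      have "inv\<^bsub>add_monoid M\<^esub> x = pres_class rels (free_scal (- 1)) \<odot>\<^bsub>M\<^esub> x"
        using group.inv_equality[OF abelian_group.a_group[OF realised_abelian_group],
            of "pres_class rels (free_scal (- 1)) \<odot>\<^bsub>M\<^esub> x" x] xc realised_neg[OF xc]
        by (simp add: realisesD(1-7))
      then show ?thesis using smult[OF that] by simp
    qed
    show "\<forall>a x. a \<in> carrier (pres_alg rels) \<longrightarrow> x \<in> N \<longrightarrow> a \<odot>\<^bsub>M\<^esub> x \<in> N"
      using smult by (auto simp: carrier_pres_alg)
  qed
qed

lemma image_preimage: "\<Phi> ` {x \<in> carrier M. \<Phi> x \<in> V} = V"
proof -
  have "v \<in> \<Phi> ` {x \<in> carrier M. \<Phi> x \<in> V}" if "v \<in> V" for v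
    using realisesD(9)[of v] that by blast
  then show ?thesis by blast
qed

lemma submodule_preimage:
  "stable \<rho> V \<Longrightarrow> submodule {x \<in> carrier M. \<Phi> x \<in> V} (pres_alg rels) M"
  by (simp add: submodule_iff_stable image_preimage)

lemma preimage_image: "N \<subseteq> carrier M \<Longrightarrow> {x \<in> carrier M. \<Phi> x \<in> \<Phi> ` N} = N"
  by (auto dest!: realises_eqI[rotated 2] simp: subset_iff)

lemma realised_finsum:
  assumes "finite S" "f \<in> S \<rightarrow> carrier M"
  shows "(\<Oplus>\<^bsub>M\<^esub>i\<in>S. f i) \<in> carrier M \<and> \<Phi> (\<Oplus>\<^bsub>M\<^esub>i\<in>S. f i) = (\<Sum>i\<in>S. \<Phi> (f i))"
  using assms
proof (induction S)
  case empty
  interpret abelian_group M by (rule realised_abelian_group)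
  show ?case by (simp add: realisesD(1-7))
next
  case (insert i S)
  interpret abelian_group M by (rule realised_abelian_group)
  from insert show ?case by (simp add: realisesD(1-7))
qed

lemma internal_direct_sum_realised:
  assumes stable: "\<And>i. stable \<rho> (V i)"
    and dec: "\<And>v. \<exists>!y. (\<forall>i. y i \<in> V i) \<and> finite {i. y i \<noteq> 0} \<and> v = (\<Sum>i\<in>{i. y i \<noteq> 0}. y i)"
  shows "internal_direct_sum (pres_alg rels) M (\<lambda>i. {x \<in> carrier M. \<Phi> x \<in> V i})"
  unfolding internal_direct_sum_def
proof (intro conjI allI ballI)
  show "submodule {x \<in> carrier M. \<Phi> x \<in> V i} (pres_alg rels) M" for i
    by (rule submodule_preimage[OF stable])
next
  fix m assume m: "m \<in> carrier M"
  let ?Q = "\<lambda>v y. (\<forall>i. y i \<in> V i) \<and> finite {i. y i \<noteq> 0} \<and> v = (\<Sum>i\<in>{i. y i \<noteq> 0}. y i)"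
  let ?P = "\<lambda>x. (\<forall>i. x i \<in> {x \<in> carrier M. \<Phi> x \<in> V i}) \<and> finite {i. x i \<noteq> \<zero>\<^bsub>M\<^esub>} \<and>
        m = (\<Oplus>\<^bsub>M\<^esub>i\<in>{i. x i \<noteq> \<zero>\<^bsub>M\<^esub>}. x i)"
  have iff: "?P x \<longleftrightarrow> ?Q (\<Phi> m) (\<lambda>i. \<Phi> (x i))" if x: "\<And>i. x i \<in> carrier M" for x
  proof -
    have z: "\<Phi> (x i) \<noteq> 0 \<longleftrightarrow> x i \<noteq> \<zero>\<^bsub>M\<^esub>" for i
      using realisesD(8)[OF x[of i] realisesD(4)] by (simp add: realisesD(1-7))
    have "m = (\<Oplus>\<^bsub>M\<^esub>i\<in>{i. x i \<noteq> \<zero>\<^bsub>M\<^esub>}. x i) \<longleftrightarrow> \<Phi> m = (\<Sum>i\<in>{i. x i \<noteq> \<zero>\<^bsub>M\<^esub>}. \<Phi> (x i))"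
      if "finite {i. x i \<noteq> \<zero>\<^bsub>M\<^esub>}"
    proof -
      have f: "x \<in> {i. x i \<noteq> \<zero>\<^bsub>M\<^esub>} \<rightarrow> carrier M" using x by auto
      show ?thesis
        using realised_finsum[OF that f] realisesD(8)[OF m, of "\<Oplus>\<^bsub>M\<^esub>i\<in>{i. x i \<noteq> \<zero>\<^bsub>M\<^esub>}. x i"]
        by auto
    qed
    then show ?thesis unfolding z using x by auto
  qed
  obtain y where y: "?Q (\<Phi> m) y" "\<And>y'. ?Q (\<Phi> m) y' \<Longrightarrow> y' = y"
    using dec[of "\<Phi> m"] by (elim ex1E) blast
  have "\<forall>i. \<exists>x\<in>carrier M. \<Phi> x = y i" using realisesD(9) by blast
  then obtain x where x: "\<And>i. x i \<in> carrier M" "\<And>i. \<Phi> (x i) = y i" by metis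
  show "\<exists>!x. ?P x"
  proof (rule ex1I[of _ x])
    show "?P x" by (rule iff[of x, OF x(1), THEN iffD2]) (use y(1) in \<open>simp add: x(2)\<close>)
  next
    fix x' assume P: "?P x'"
    then have x': "\<And>i. x' i \<in> carrier M" by auto
    have "(\<lambda>i. \<Phi> (x' i)) = y" by (rule y(2)) (use iff[of x', OF x'] P in blast)
    then have "\<Phi> (x' i) = \<Phi> (x i)" for i unfolding x(2) by (rule fun_cong)
    then show "x' = x" using realises_eqI[OF x' x(1)] by blast
  qed
qed

end

lemma mod_iso_onto_realised:
  assumes M: "realises rels M \<rho> \<Phi>" and M': "realises rels M' \<rho>' \<Phi>'"
    and T: "lin T" "inj T" "\<And>g v. T (\<rho> g v) = \<rho>' g (T v)"
  shows "\<exists>h. mod_iso_onto (pres_alg rels) M M' {x \<in> carrier M'. \<Phi>' x \<in> range T} h \<and>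
    (\<forall>x\<in>carrier M. h x \<in> carrier M' \<and> \<Phi>' (h x) = T (\<Phi> x))"
proof -
  have "\<forall>x. \<exists>y\<in>carrier M'. \<Phi>' y = T (\<Phi> x)" using realisesD(9)[OF M'] by blast
  then obtain h where h: "\<And>x. h x \<in> carrier M'" "\<And>x. \<Phi>' (h x) = T (\<Phi> x)" by metis
  have eqI: "x = y" if "x \<in> carrier M'" "y \<in> carrier M'" "\<Phi>' x = \<Phi>' y" for x y
    using realisesD(8)[OF M'] that by blast
  have "stable \<rho>' (range T)"
    unfolding stable_def fs.subspace_def
    by (auto simp: T(3)[symmetric] fsp.linear_add[OF T(1), symmetric]
        fsp.linear_scale[OF T(1), symmetric] intro: range_eqI[of _ _ 0] simp: fsp.linear_0[OF T(1)])
  then have sub: "submodule {x \<in> carrier M'. \<Phi>' x \<in> range T} (pres_alg rels) M'"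
    by (rule submodule_preimage[OF M'])
  have "mod_iso_onto (pres_alg rels) M M' {x \<in> carrier M'. \<Phi>' x \<in> range T} h"
    unfolding mod_iso_onto_def
  proof (intro conjI sub)
    show "h \<in> mod_hom (pres_alg rels) M M'"
      unfolding mod_hom_def
    proof (intro CollectI conjI ballI)
      fix x y assume "x \<in> carrier M" "y \<in> carrier M"
      then show "h (x \<oplus>\<^bsub>M\<^esub> y) = h x \<oplus>\<^bsub>M'\<^esub> h y"
        by (intro eqI) (simp_all add: h realisesD(1-7)[OF M] realisesD(1-7)[OF M'] fsp.linear_add[OF T(1)])
    next
      fix a x assume "a \<in> carrier (pres_alg rels)" "x \<in> carrier M"
      then show "h (a \<odot>\<^bsub>M\<^esub> x) = a \<odot>\<^bsub>M'\<^esub> h x"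
        by (auto intro!: eqI simp: carrier_pres_alg h realisesD(1-7)[OF M] realisesD(1-7)[OF M']
            act_intertwine[OF T(1), of \<rho> \<rho>', OF T(3)])
    qed (use h in auto)
    show "inj_on h (carrier M)"
      by (rule inj_onI) (metis T(2) h(2) injD realisesD(8)[OF M])
    show "h ` carrier M = {x \<in> carrier M'. \<Phi>' x \<in> range T}"
    proof (intro subset_antisym subsetI)
      fix y assume "y \<in> {x \<in> carrier M'. \<Phi>' x \<in> range T}"
      then obtain v where v: "y \<in> carrier M'" "\<Phi>' y = T v" by auto
      obtain x where "x \<in> carrier M" "\<Phi> x = v" using realisesD(9)[OF M] by blast
      then have "y = h x" using v h by (intro eqI) auto
      then show "y \<in> h ` carrier M" using \<open>x \<in> carrier M\<close> by blast
    qed (use h in auto)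
  qed
  then show ?thesis using h by blast
qed

section \<open>Operators satisfying the relations of the quantum group\<close>

locale quantum_parameter =
  fixes q :: "'k::field"
  assumes q_nz: "q \<noteq> 0" and q_power: "n > 0 \<Longrightarrow> q ^ n \<noteq> 1"
begin

lemma q_power_eq_iff: "q ^ m = q ^ n \<longleftrightarrow> m = n"
proof (induction m n rule: linorder_wlog)
  case (le m n)
  show ?case
  proof
    assume "q ^ m = q ^ n"
    moreover have "q ^ n = q ^ m * q ^ (n - m)" using le by (simp add: power_add[symmetric])
    ultimately have "q ^ m * 1 = q ^ m * q ^ (n - m)" by simp
    then have "q ^ (n - m) = 1" using q_nz by simp
    then show "m = n" using q_power[of "n - m"] le by (cases "m = n") auto
  qed simp
qed auto

definition dq :: 'k where "dq = q - inverse q"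

lemma dq_nz: "dq \<noteq> 0"
  using q_power[of 2] q_nz by (auto simp: dq_def field_simps power2_eq_square)

lemma dq_mult: "q * dq = q ^ 2 - 1"
  using q_nz by (simp add: dq_def field_simps power2_eq_square)

lemma qq: "q * q - 1 \<noteq> 0"
  using dq_nz dq_mult q_nz by (metis mult_eq_0_iff power2_eq_square)

lemma dq_eq: "dq = (q * q - 1) / q"
  using q_nz by (simp add: dq_def field_simps)

lemma qbrace_eq: "a \<noteq> 0 \<Longrightarrow> qbrace q a = q * (a * a - 1) / (a * (q * q - 1))"
  using q_nz qq by (simp add: qbrace_def field_simps)

text \<open>The scalar by which E takes the j-th basis vector of the Verma module of highest weight s
  to the preceding one.\<close>

definition ecoef :: "nat \<Rightarrow> 'k \<Rightarrow> 'k" where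
  "ecoef j s = qbrace q (q ^ j) * qbrace q (q * s / q ^ j)"

lemma ecoef_0 [simp]: "ecoef 0 s = 0"
  by (simp add: ecoef_def qbrace_def)

lemma qbrace_eq_0_iff: "a \<noteq> 0 \<Longrightarrow> qbrace q a = 0 \<longleftrightarrow> a ^ 2 = 1"
proof -
  assume a: "a \<noteq> 0"
  have "qbrace q a = 0 \<longleftrightarrow> a = inverse a" using dq_nz by (simp add: qbrace_def dq_def)
  also have "\<dots> \<longleftrightarrow> a ^ 2 = 1" using a by (simp add: field_simps power2_eq_square)
  finally show ?thesis .
qed

lemma ecoef_nz:
  assumes "s \<noteq> 0" "j > 0" "(q * s) ^ 2 \<noteq> q ^ (2 * j)"
  shows "ecoef j s \<noteq> 0"
proof -
  have "(q ^ j) ^ 2 \<noteq> 1" using q_power[of "j * 2"] assms(2) by (simp add: power_mult)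
  moreover have "(q * s / q ^ j) ^ 2 \<noteq> 1"
    using assms(3) q_nz by (simp add: power_divide power_mult[symmetric] mult.commute)
  ultimately show ?thesis using assms(1) q_nz by (simp add: ecoef_def qbrace_eq_0_iff)
qed

lemma ecoef_Suc:
  assumes "s \<noteq> 0"
  shows "ecoef (Suc j) s = ecoef j s + (s / q ^ (2 * j) - q ^ (2 * j) / s) / dq"
proof -
  define Q where "Q = q ^ j"
  have [simp]: "Q \<noteq> 0" using q_nz by (simp add: Q_def)
  have Q2: "q ^ (2 * j) = Q * Q" by (simp add: Q_def power_add[symmetric] mult_2)
  show ?thesis
    unfolding ecoef_def Q2 power_Suc Q_def[symmetric]
    using q_nz assms qq
    by (simp add: qbrace_eq dq_eq divide_simps) (simp add: algebra_simps)
qed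

end

text \<open>The relations are those that also hold for multiplication in an algebra followed by reduction
  to normal form; there the composition of K and its inverse is the reduction and not the
  identity.\<close>

locale uq_ops = quantum_parameter q for q :: "'k::field" +
  fixes E F K Ki :: "('i \<Rightarrow>\<^sub>0 'k) \<Rightarrow> ('i \<Rightarrow>\<^sub>0 'k)"
  assumes linE: "lin E" and linF: "lin F" and linK: "lin K" and linKi: "lin Ki"
    and EF: "E (F v) = F (E v) + inverse dq *\<^sub>s (K v - Ki v)"
    and KF: "K (F v) = inverse (q ^ 2) *\<^sub>s F (K v)"
    and KiF: "Ki (F v) = q ^ 2 *\<^sub>s F (Ki v)"
    and KE: "K (E v) = q ^ 2 *\<^sub>s E (K v)"
    and KiE: "Ki (E v) = inverse (q ^ 2) *\<^sub>s E (Ki v)"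
begin

lemmas lin_simps =
  fsp.linear_add[OF linE] fsp.linear_add[OF linF] fsp.linear_add[OF linK] fsp.linear_add[OF linKi]
  fsp.linear_diff[OF linE] fsp.linear_diff[OF linF] fsp.linear_diff[OF linK] fsp.linear_diff[OF linKi]
  fsp.linear_scale[OF linE] fsp.linear_scale[OF linF] fsp.linear_scale[OF linK] fsp.linear_scale[OF linKi]
  fsp.linear_0[OF linE] fsp.linear_0[OF linF] fsp.linear_0[OF linK] fsp.linear_0[OF linKi]

lemma lin_F_power: "lin (F ^^ j)"
  by (induction j) (simp_all add: lin_id id_def comp_def lin_comp linF)

lemmas F_power_simps = fsp.linear_add[OF lin_F_power] fsp.linear_diff[OF lin_F_power]
  fsp.linear_scale[OF lin_F_power] fsp.linear_0[OF lin_F_power]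

lemma K_F_power: "K ((F ^^ j) v) = inverse (q ^ (2 * j)) *\<^sub>s (F ^^ j) (K v)"
  by (induction j) (simp_all add: KF lin_simps power_add power2_eq_square mult_ac)

lemma Ki_F_power: "Ki ((F ^^ j) v) = q ^ (2 * j) *\<^sub>s (F ^^ j) (Ki v)"
  by (induction j) (simp_all add: KiF lin_simps power_add power2_eq_square mult_ac)

text \<open>Moving E past one more F adds a term in K and its inverse, which has to pass the remaining
  powers of F. The resulting geometric sums combine to the brace of q^j.\<close>

lemma E_F_power:
  "E ((F ^^ j) v) = (F ^^ j) (E v) + qbrace q (q ^ j) *\<^sub>s (F ^^ (j - 1))
     (inverse dq *\<^sub>s ((q / q ^ j) *\<^sub>s K v - (q ^ j / q) *\<^sub>s Ki v))"
proof (induction j)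
  case 0
  show ?case by (simp add: qbrace_def)
next
  case (Suc j)
  define Q where "Q = q ^ j"
  have [simp]: "Q \<noteq> 0" using q_nz by (simp add: Q_def)
  have Q2: "q ^ (2 * j) = Q * Q" by (simp add: Q_def power_add[symmetric] mult_2)
  have F1: "qbrace q Q *\<^sub>s F ((F ^^ (j - Suc 0)) w) = qbrace q Q *\<^sub>s (F ^^ j) w" for w
    by (cases j) (simp_all add: qbrace_def Q_def)
  have c1: "inverse (Q * Q) * inverse dq + qbrace q Q * (inverse dq * (q / Q)) =
      qbrace q (q * Q) * (inverse dq * (q / (q * Q)))"
    and c2: "(Q * Q) * inverse dq + qbrace q Q * (inverse dq * (Q / q)) =
      qbrace q (q * Q) * (inverse dq * (q * Q / q))"
    using q_nz qq by (simp_all add: qbrace_eq dq_eq divide_simps) (simp_all add: algebra_simps)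
  have "E ((F ^^ Suc j) v) = F (E ((F ^^ j) v)) + inverse dq *\<^sub>s (K ((F ^^ j) v) - Ki ((F ^^ j) v))"
    by (simp add: EF)
  also have "F (E ((F ^^ j) v)) = (F ^^ Suc j) (E v) + qbrace q Q *\<^sub>s (F ^^ j)
      (inverse dq *\<^sub>s ((q / Q) *\<^sub>s K v - (Q / q) *\<^sub>s Ki v))"
    by (simp add: Suc.IH lin_simps F1 Q_def[symmetric] del: fs.scale_scale fs.scale_cancel_left)
  also have "K ((F ^^ j) v) = inverse (Q * Q) *\<^sub>s (F ^^ j) (K v)"
    by (simp add: K_F_power Q2)
  also have "Ki ((F ^^ j) v) = (Q * Q) *\<^sub>s (F ^^ j) (Ki v)"
    by (simp add: Ki_F_power Q2)
  also have "(F ^^ Suc j) (E v) + qbrace q Q *\<^sub>s (F ^^ j)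
      (inverse dq *\<^sub>s ((q / Q) *\<^sub>s K v - (Q / q) *\<^sub>s Ki v)) +
      inverse dq *\<^sub>s (inverse (Q * Q) *\<^sub>s (F ^^ j) (K v) - (Q * Q) *\<^sub>s (F ^^ j) (Ki v)) =
      (F ^^ Suc j) (E v) + ((inverse (Q * Q) * inverse dq + qbrace q Q * (inverse dq * (q / Q))) *\<^sub>s
        (F ^^ j) (K v) - ((Q * Q) * inverse dq + qbrace q Q * (inverse dq * (Q / q))) *\<^sub>s (F ^^ j) (Ki v))"
    by (simp add: F_power_simps fs.scale_right_diff_distrib fs.scale_left_distrib mult_ac)
  also have "\<dots> = (F ^^ Suc j) (E v) + qbrace q (q * Q) *\<^sub>s (F ^^ j)
      (inverse dq *\<^sub>s ((q / (q * Q)) *\<^sub>s K v - (q * Q / q) *\<^sub>s Ki v))"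
    unfolding c1 c2 by (simp add: F_power_simps fs.scale_right_diff_distrib)
  finally show ?case by (simp add: Q_def)
qed

lemma E_F_power_maximal:
  assumes "E v = 0" "K v = s *\<^sub>s v" "Ki v = inverse s *\<^sub>s v"
  shows "E ((F ^^ j) v) = ecoef j s *\<^sub>s (F ^^ (j - 1)) v"
proof -
  have c: "(q / q ^ j * s - q ^ j / q * inverse s) * inverse dq = qbrace q (q * s / q ^ j)"
    using q_nz by (cases "s = 0") (simp_all add: qbrace_def dq_def field_simps)
  have "inverse dq *\<^sub>s ((q / q ^ j) *\<^sub>s s *\<^sub>s v - (q ^ j / q) *\<^sub>s inverse s *\<^sub>s v) =
      qbrace q (q * s / q ^ j) *\<^sub>s v"
    by (simp add: fs.scale_left_diff_distrib[symmetric] c[symmetric] mult.commute)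
  then show ?thesis
    by (simp add: E_F_power assms F_power_simps ecoef_def del: fs.scale_scale)
       (simp add: ecoef_def)
qed

end


section \<open>Verma modules of the quantum group\<close>

context quantum_parameter
begin

fun verma_op :: "'k \<Rightarrow> usl_gen \<Rightarrow> (nat \<Rightarrow>\<^sub>0 'k) \<Rightarrow> (nat \<Rightarrow>\<^sub>0 'k)" where
  "verma_op s gE = lin_ext (\<lambda>j. ecoef j s *\<^sub>s bv (j - 1))"
| "verma_op s gF = lin_ext (\<lambda>j. bv (Suc j))"
| "verma_op s gK = lin_ext (\<lambda>j. (s / q ^ (2 * j)) *\<^sub>s bv j)"
| "verma_op s gKi = lin_ext (\<lambda>j. (q ^ (2 * j) / s) *\<^sub>s bv j)"

lemma lin_verma_op: "lin (verma_op s g)"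
  by (cases g) (simp_all add: lin_lin_ext)

lemma verma_op_bv [simp]:
  "verma_op s gE (bv j) = ecoef j s *\<^sub>s bv (j - 1)"
  "verma_op s gF (bv j) = bv (Suc j)"
  "verma_op s gK (bv j) = (s / q ^ (2 * j)) *\<^sub>s bv j"
  "verma_op s gKi (bv j) = (q ^ (2 * j) / s) *\<^sub>s bv j"
  by simp_all

declare verma_op.simps [simp del]

lemmas verma_lin_simps = fsp.linear_add[OF lin_verma_op] fsp.linear_diff[OF lin_verma_op]
  fsp.linear_scale[OF lin_verma_op] fsp.linear_0[OF lin_verma_op]

lemma verma_rels:
  assumes "s \<noteq> 0" "p \<in> usl_rels q"
  shows "act (verma_op s) p v = 0"
proof (rule lin_eqI[where f = "act (verma_op s) p" and g = "\<lambda>v. 0"])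
  fix j
  note simps = act_simps act_one act_free_gen act_free_scal act_mult[OF lin_verma_op] free_scal_mult
    verma_lin_simps
  consider "p = free_gen gK * free_gen gKi - 1" | "p = free_gen gKi * free_gen gK - 1"
    | "p = free_gen gK * free_gen gE * free_gen gKi - free_scal (q ^ 2) * free_gen gE"
    | "p = free_gen gK * free_gen gF * free_gen gKi - free_scal (inverse (q ^ 2)) * free_gen gF"
    | "p = free_gen gE * free_gen gF - free_gen gF * free_gen gE -
        free_scal (inverse (q - inverse q)) * (free_gen gK - free_gen gKi)"
    using assms(2) unfolding usl_rels_def Let_def by blast
  then show "act (verma_op s) p (bv j) = 0"
  proof cases
    case 1
    then show ?thesis using assms(1) q_nz by (simp add: simps)
  next
    case 2
    then show ?thesis using assms(1) q_nz by (simp add: simps)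
  next
    case 3
    have "q ^ (2 * j) / s * (ecoef j s * (s / q ^ (2 * (j - 1)))) = q ^ 2 * ecoef j s"
      using assms(1) q_nz by (cases j) (simp_all add: field_simps power2_eq_square)
    with 3 show ?thesis by (simp add: simps)
  next
    case 4
    show ?thesis unfolding 4 using assms(1) q_nz by (simp add: simps field_simps power2_eq_square)
  next
    case 5
    have "ecoef j s *\<^sub>s bv (Suc (j - Suc 0)) = (ecoef j s *\<^sub>s bv j :: nat \<Rightarrow>\<^sub>0 'k)"
      by (cases j) simp_all
    then show ?thesis unfolding 5
      by (simp add: simps ecoef_Suc[OF assms(1)] dq_def[symmetric]
          fs.scale_left_distrib fs.scale_left_diff_distrib fs.scale_right_diff_distrib
          divide_inverse algebra_simps) auto
  qed
qed (intro lin_act lin_verma_op lin_zero)+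

text \<open>A maximal vector of weight s generates an image of the Verma module of highest weight s.\<close>

lemma verma_intertwine:
  assumes "uq_ops q (\<rho> gE) (\<rho> gF) (\<rho> gK) (\<rho> gKi)"
    and v: "\<rho> gE v = 0" "\<rho> gK v = s *\<^sub>s v" "\<rho> gKi v = inverse s *\<^sub>s v"
  shows "lin_ext (\<lambda>j. (\<rho> gF ^^ j) v) (verma_op s g w) = \<rho> g (lin_ext (\<lambda>j. (\<rho> gF ^^ j) v) w)"
proof -
  interpret uq_ops q "\<rho> gE" "\<rho> gF" "\<rho> gK" "\<rho> gKi" by (rule assms(1))
  have lin\<rho>: "lin (\<rho> g)" for g by (cases g) (simp_all add: linE linF linK linKi)
  note T = fsp.linear_scale[OF lin_lin_ext]
  show ?thesis
  proof (rule lin_eqI[where f = "\<lambda>w. lin_ext (\<lambda>j. (\<rho> gF ^^ j) v) (verma_op s g w)"])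
    show "lin_ext (\<lambda>j. (\<rho> gF ^^ j) v) (verma_op s g (bv j)) =
        \<rho> g (lin_ext (\<lambda>j. (\<rho> gF ^^ j) v) (bv j))" for j
      by (cases g)
         (simp_all add: T E_F_power_maximal[OF v] K_F_power Ki_F_power v F_power_simps divide_inverse
            mult.commute)
  qed (intro lin_comp[OF lin_lin_ext lin_verma_op] lin_comp[OF lin\<rho> lin_lin_ext])+
qed

end

lemma left_ideal_annihilator:
  assumes "\<And>g. lin (\<rho> g)"
  shows "left_ideal {p. act \<rho> p v = 0}"
  by (simp add: left_ideal_def act_simps act_mult assms fsp.linear_0[OF lin_act[OF assms]])

text \<open>Conjugation by an invertible k scales x, so k and its inverse commute with x up to a
  scalar.\<close>

lemma commute_up_to_scalar:
  assumes "k * ki - 1 \<in> pres_ideal rels" "ki * k - 1 \<in> pres_ideal rels"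
    and "k * x * ki - c *\<^sub>s x \<in> pres_ideal rels" and "c \<noteq> 0"
  shows "k * x - c *\<^sub>s (x * k) \<in> pres_ideal rels"
    "ki * x - inverse c *\<^sub>s (x * ki) \<in> pres_ideal rels"
proof -
  note li = left_idealD[OF left_ideal_pres_ideal[of rels]]
  have "(k * x * ki - c *\<^sub>s x) * k - (k * x) * (ki * k - 1) \<in> pres_ideal rels"
    by (intro li(3) li(4) pres_ideal_mult_right assms)
  then show "k * x - c *\<^sub>s (x * k) \<in> pres_ideal rels"
    by (simp add: scale_mult_left algebra_simps)
  have "inverse c *\<^sub>s ((ki * k - 1) * (x * ki)) - inverse c *\<^sub>s (ki * (k * x * ki - c *\<^sub>s x)) \<in> pres_ideal rels"
    by (intro li(3) li(4) li(5) pres_ideal_mult_right assms)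
  then show "ki * x - inverse c *\<^sub>s (x * ki) \<in> pres_ideal rels"
    using assms(4)
    by (simp add: scale_mult_left mult_scale_right fs.scale_right_diff_distrib algebra_simps)
qed

text \<open>Multiplication modulo a left ideal satisfies every relation of the presentation.\<close>

locale quotient_ops =
  fixes rels L :: "('g, 'k::field) free_alg set" and nf
  assumes nf: "lin nf" "\<And>p. nf p = 0 \<longleftrightarrow> p \<in> L" "\<And>p. p - nf p \<in> L"
    and L: "left_ideal L" "pres_ideal rels \<subseteq> L"
begin

lemma nf_eq_iff: "nf a = nf b \<longleftrightarrow> a - b \<in> L"
  using nf(2)[of "a - b"] by (simp add: fsp.linear_diff[OF nf(1)])

lemma nf_absorb: "nf (a * nf b) = nf (a * b)"
  using left_idealD(4)[OF L(1) nf(3)[of b], of a] left_idealD(6)[OF L(1)]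
  by (metis (no_types) nf_eq_iff minus_diff_eq right_diff_distrib)

lemma nf_nf: "nf (nf b) = nf b"
  using nf_absorb[of 1 b] by simp

lemma nf_rel: "a - b \<in> pres_ideal rels \<Longrightarrow> nf (a * z) = nf (b * z)"
  unfolding nf_eq_iff using pres_ideal_mult_right[of "a - b" rels z] L(2)
  by (auto simp: left_diff_distrib)

lemma lin_nf_mult: "lin (\<lambda>z. nf (a * z))"
  by (intro lin_comp[OF nf(1)] lin_mult_right)

lemmas nf_simps = fsp.linear_add[OF nf(1)] fsp.linear_diff[OF nf(1)] fsp.linear_scale[OF nf(1)]
  fsp.linear_0[OF nf(1)]

lemma act_nf: "act (\<lambda>g z. nf (free_gen g * z)) p (nf y) = nf (p * y)"
proof (rule lin_eqI[where f = "\<lambda>p. act (\<lambda>g z. nf (free_gen g * z)) p (nf y)",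
      OF lin_act_left lin_comp[OF nf(1) lin_mult_left]])
  show "act (\<lambda>g z. nf (free_gen g * z)) (bv w) (nf y) = nf (bv w * y)" for w
  proof (induction w)
    case Nil
    show ?case unfolding one_eq_bv[symmetric] act_one by simp
  next
    case (Cons g w)
    have "act (\<lambda>g z. nf (free_gen g * z)) (bv (g # w)) (nf y) = nf (free_gen g * nf (bv w * y))"
      using Cons by (simp add: act_def)
    also have "\<dots> = nf ((free_gen g * bv w) * y)"
      by (simp add: nf_absorb mult.assoc)
    also have "free_gen g * bv w = bv (g # w)" by (simp add: free_gen_def mult_single_list)
    finally show ?case .
  qed
qed

text \<open>The value of the inverse of k on the class of 1 follows by cancelling k.\<close>

lemma weight_of_one:
  assumes "ki * k - 1 \<in> pres_ideal rels" "k - free_scal s \<in> L" "s \<noteq> 0"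
  shows "nf (k * nf 1) = s *\<^sub>s nf 1" "nf (ki * nf 1) = inverse s *\<^sub>s nf 1"
proof -
  have "nf k = nf (s *\<^sub>s 1)"
    using assms(2) by (simp add: nf_eq_iff free_scal_mult[of s 1, simplified])
  then show k: "nf (k * nf 1) = s *\<^sub>s nf 1" by (simp add: nf_absorb nf_simps)
  have "nf 1 = nf (ki * k)" using nf_rel[OF assms(1), of 1] by simp
  also have "\<dots> = nf (ki * nf (k * nf 1))" by (simp add: nf_absorb)
  also have "\<dots> = s *\<^sub>s nf (ki * nf 1)" unfolding k by (simp add: mult_scale_right nf_simps)
  finally have "inverse s *\<^sub>s nf 1 = inverse s *\<^sub>s s *\<^sub>s nf (ki * nf 1)" by (rule arg_cong)
  then show "nf (ki * nf 1) = inverse s *\<^sub>s nf 1" using assms(3) by simp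
qed

text \<open>The map T computes the normal form of p from the action of p on the cyclic vector, so an
  element that kills this vector has normal form 0.\<close>

lemma annihilator_subset:
  assumes T: "lin T" "\<And>g v. T (\<rho> g v) = nf (free_gen g * T v)" "T u = nf 1"
    and p: "act \<rho> p u = 0"
  shows "p \<in> L"
proof -
  have "nf p = T (act \<rho> p u)"
    using act_intertwine[OF T(1), of \<rho> "\<lambda>g z. nf (free_gen g * z)" p u] T(2,3)
    by (simp add: act_nf)
  then show ?thesis using nf(2) p by (simp add: fsp.linear_0[OF T(1)])
qed

lemma uq_ops_quotient:
  assumes "quantum_parameter q"
    and rel: "k * ki - 1 \<in> pres_ideal rels" "ki * k - 1 \<in> pres_ideal rels"
    "k * e * ki - q ^ 2 *\<^sub>s e \<in> pres_ideal rels"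
    "k * f * ki - inverse (q ^ 2) *\<^sub>s f \<in> pres_ideal rels"
    "e * f - f * e - inverse (q - inverse q) *\<^sub>s (k - ki) \<in> pres_ideal rels"
  shows "uq_ops q (\<lambda>z. nf (e * z)) (\<lambda>z. nf (f * z)) (\<lambda>z. nf (k * z)) (\<lambda>z. nf (ki * z))"
proof -
  interpret quantum_parameter q by (rule assms(1))
  have q2: "q ^ 2 \<noteq> 0" using q_nz by simp
  note kf = commute_up_to_scalar[OF rel(1,2,4)] and ke = commute_up_to_scalar[OF rel(1,2,3)]
  show ?thesis
  proof (intro uq_ops.intro uq_ops_axioms.intro quantum_parameter_axioms)
    fix v
    show "nf (e * nf (f * v)) = nf (f * nf (e * v)) + inverse dq *\<^sub>s (nf (k * v) - nf (ki * v))"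
      using nf_rel[of "e * f" "f * e + inverse dq *\<^sub>s (k - ki)" v] rel(5)
      by (simp add: dq_def nf_absorb mult.assoc distrib_right scale_mult_left left_diff_distrib nf_simps
          diff_diff_add)
    show "nf (k * nf (f * v)) = inverse (q ^ 2) *\<^sub>s nf (f * nf (k * v))"
      using nf_rel[OF kf(1), of v] q2
      by (simp add: nf_absorb mult.assoc scale_mult_left nf_simps)
    show "nf (ki * nf (f * v)) = q ^ 2 *\<^sub>s nf (f * nf (ki * v))"
      using nf_rel[OF kf(2), of v] q2
      by (simp add: nf_absorb mult.assoc scale_mult_left nf_simps)
    show "nf (k * nf (e * v)) = q ^ 2 *\<^sub>s nf (e * nf (k * v))"
      using nf_rel[OF ke(1), of v] q2
      by (simp add: nf_absorb mult.assoc scale_mult_left nf_simps)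
    show "nf (ki * nf (e * v)) = inverse (q ^ 2) *\<^sub>s nf (e * nf (ki * v))"
      using nf_rel[OF ke(2), of v] q2
      by (simp add: nf_absorb mult.assoc scale_mult_left nf_simps)
  qed (rule lin_nf_mult)+
qed

end

context quantum_parameter
begin

lemma usl_rels_in_ideal:
  "free_gen gK * free_gen gKi - 1 \<in> pres_ideal (usl_rels q)"
  "free_gen gKi * free_gen gK - 1 \<in> pres_ideal (usl_rels q)"
  "free_gen gK * free_gen gE * free_gen gKi - q ^ 2 *\<^sub>s free_gen gE \<in> pres_ideal (usl_rels q)"
  "free_gen gK * free_gen gF * free_gen gKi - inverse (q ^ 2) *\<^sub>s free_gen gF
     \<in> pres_ideal (usl_rels q)"
  "free_gen gE * free_gen gF - free_gen gF * free_gen gE -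
     inverse (q - inverse q) *\<^sub>s (free_gen gK - free_gen gKi) \<in> pres_ideal (usl_rels q)"
  using rels_subset_pres_ideal[of "usl_rels q"]
  unfolding usl_rels_def Let_def free_scal_mult by blast+

lemma act_verma_F_power:
  "act (verma_op s) (free_gen gF ^ j) (bv i) = bv (i + j)"
  by (induction j) (simp_all add: act_one act_mult[OF lin_verma_op] act_free_gen)

text \<open>In the quotient by the defining left ideal the class of 1 is maximal of weight s, so it
  receives the concrete module; hence the concrete module has no smaller annihilator.\<close>

lemma usl_verma_ideal_eq:
  assumes "s \<noteq> 0"
  shows "(carrier (usl q) #>\<^bsub>usl q\<^esub> pres_gen (usl_rels q) gE) <+>\<^bsub>usl q\<^esub>
      (carrier (usl q) #>\<^bsub>usl q\<^esub> (pres_gen (usl_rels q) gK \<ominus>\<^bsub>usl q\<^esub> pres_scal (usl_rels q) s))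
    = pres_class (usl_rels q) ` {p. act (verma_op s) p (bv 0) = 0}"
proof -
  let ?e = "free_gen gE :: (usl_gen, 'k) free_alg" and ?k = "free_gen gK :: (usl_gen, 'k) free_alg"
  let ?Ann = "{p. act (verma_op s) p (bv 0) = 0}"
  let ?L = "left_span (usl_rels q) ?e 0 (?k - free_scal s)"
  note LI = left_ideal_left_span[of "usl_rels q" ?e 0 "?k - free_scal s"]
    and sup = left_span_superset[where rels = "usl_rels q" and ?g1.0 = ?e and ?g2.0 = 0
        and ?g3.0 = "?k - free_scal s"]
  have "?L \<subseteq> ?Ann"
    by (rule left_span_minimal[OF left_ideal_annihilator[OF lin_verma_op]])
      (use pres_ideal_annihilates[OF lin_verma_op verma_rels[OF assms]] in
        \<open>auto simp: act_simps act_free_gen act_free_scal\<close>)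
  moreover have "?Ann \<subseteq> ?L"
  proof
    fix p assume "p \<in> ?Ann"
    then have p: "act (verma_op s) p (bv 0) = 0" by simp
    obtain nf where nf: "lin nf" "\<And>p. nf p = 0 \<longleftrightarrow> p \<in> ?L" "\<And>p. p - nf p \<in> ?L"
      using exists_normal_form[OF left_ideal_subspace[OF LI]] by blast
    interpret quotient_ops "usl_rels q" ?L nf
      by (intro quotient_ops.intro nf LI sup)
    define \<rho> where "\<rho> g z = nf (free_gen g * z)" for g z
    have ops: "uq_ops q (\<rho> gE) (\<rho> gF) (\<rho> gK) (\<rho> gKi)"
      unfolding \<rho>_def[abs_def]
      by (rule uq_ops_quotient[OF quantum_parameter_axioms usl_rels_in_ideal])
    have "nf ?e = 0" using sup(2) nf(2) by simp
    then have 1: "\<rho> gE (nf 1) = 0" by (simp add: \<rho>_def nf_absorb)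
    have 2: "\<rho> gK (nf 1) = s *\<^sub>s nf 1" and 3: "\<rho> gKi (nf 1) = inverse s *\<^sub>s nf 1"
      unfolding \<rho>_def using weight_of_one[OF usl_rels_in_ideal(2) sup(4) assms] by blast+
    show "p \<in> ?L"
    proof (rule annihilator_subset[OF lin_lin_ext _ _ p])
      show "lin_ext (\<lambda>j. (\<rho> gF ^^ j) (nf 1)) (verma_op s g v) =
          nf (free_gen g * lin_ext (\<lambda>j. (\<rho> gF ^^ j) (nf 1)) v)" for g v
        unfolding verma_intertwine[OF ops 1 2 3] by (simp add: \<rho>_def)
    qed simp
  qed
  ultimately have L: "?L = ?Ann" by (rule subset_antisym)
  show ?thesis
    unfolding L[symmetric] image_left_span
    by (auto simp: usl_def set_add_def set_mult_def r_coset_def carrier_pres_alg pres_alg_minus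
        pres_alg_mult pres_alg_add)
qed

lemma verma_cyclic: "\<exists>p. act (verma_op s) p (bv 0) = v"
proof -
  have "act (verma_op s) (lin_ext (\<lambda>j. free_gen gF ^ j) v) (bv 0) = v"
    by (rule lin_eqI[where f = "\<lambda>v. act (verma_op s) (lin_ext (\<lambda>j. free_gen gF ^ j) v) (bv 0)",
          OF lin_comp[OF lin_act_left lin_lin_ext] lin_id])
       (simp add: act_simps act_verma_F_power)
  then show ?thesis by blast
qed

lemma usl_verma_realised:
  assumes "s \<noteq> 0"
  obtains \<Phi> where "realises (usl_rels q) (usl_verma q s) (verma_op s) \<Phi>"
proof -
  let ?L = "{p. act (verma_op s) p (bv 0) = 0}"
  have I: "pres_ideal (usl_rels q) \<subseteq> ?L"
    using pres_ideal_annihilates[OF lin_verma_op verma_rels[OF assms]] by auto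
  obtain \<Phi> where "realises (usl_rels q)
      (quot_module (pres_alg (usl_rels q)) (pres_class (usl_rels q) ` ?L)) (verma_op s) \<Phi>"
    by (rule quot_module_realised[OF left_ideal_annihilator[OF lin_verma_op] I lin_verma_op _ verma_cyclic])
       simp_all
  then show thesis
    by (intro that[of \<Phi>]) (simp add: usl_verma_def Let_def usl_verma_ideal_eq[OF assms] usl_def[symmetric])
qed

lemma lookup_lin_ext:
  "coef (lin_ext f v) i =
   (\<Sum>k\<in>supp v. coef v k * coef (f k) i)"
  by (simp add: lin_ext_def lookup_sum)

lemma lookup_diagonal:
  "coef (lin_ext (\<lambda>j. a j *\<^sub>s bv j) v) i = a i * coef v i"
  by (auto simp: lookup_lin_ext lookup_single when_def if_distrib in_keys_iff cong: if_cong)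

text \<open>A central element preserves the one-dimensional highest weight space and commutes with F.\<close>

lemma central_acts_by_scalar:
  assumes "s \<noteq> 0" and central: "pres_class (usl_rels q) c \<in> ring_center (usl q)"
  shows "act (verma_op s) c v = c0 q (pres_class (usl_rels q) c) s *\<^sub>s v"
proof -
  let ?cl = "pres_class (usl_rels q)"
  define a where "a = coef (act (verma_op s) c (bv 0)) 0"
  have comm: "act (verma_op s) c (act (verma_op s) p v) = act (verma_op s) p (act (verma_op s) c v)" for p v
  proof -
    have "?cl c \<otimes>\<^bsub>usl q\<^esub> ?cl p = ?cl p \<otimes>\<^bsub>usl q\<^esub> ?cl c"
      using central by (auto simp: ring_center_def usl_def carrier_pres_alg)
    then have "c * p - p * c \<in> pres_ideal (usl_rels q)"
      by (simp add: usl_def pres_alg_mult pres_class_eq_iff)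
    from pres_ideal_annihilates[OF lin_verma_op verma_rels[OF assms(1)] this] show ?thesis
      by (simp add: act_simps act_mult[OF lin_verma_op])
  qed
  have lin_c: "lin (act (verma_op s) c)" by (rule lin_act[OF lin_verma_op])
  have top: "act (verma_op s) c (bv 0) = a *\<^sub>s bv 0"
  proof (rule poly_mapping_eqI)
    fix j
    let ?w = "act (verma_op s) c (bv 0)"
    have "verma_op s gK ?w = s *\<^sub>s ?w"
      using comm[of "free_gen gK" "bv 0"]
      by (simp add: act_free_gen fsp.linear_scale[OF lin_c])
    then have "coef (verma_op s gK ?w) j = s * coef ?w j" by simp
    then have "s / q ^ (2 * j) * coef ?w j = s * coef ?w j"
      by (simp add: verma_op.simps(3) lookup_diagonal)
    then have "coef ?w j = 0 \<or> q ^ (2 * j) = 1"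
      using assms(1) q_nz by (auto simp: field_simps)
    then have "coef ?w j = 0 \<or> j = 0" using q_power[of "2 * j"] by auto
    then show "coef ?w j = coef (a *\<^sub>s bv 0) j"
      by (auto simp: a_def lookup_single when_def)
  qed
  have all: "act (verma_op s) c w = a *\<^sub>s w" for w
  proof (rule lin_eqI[where f = "act (verma_op s) c", OF lin_c lin_scale_fs[OF lin_id]])
    fix j
    have "act (verma_op s) c (bv j) = act (verma_op s) c (act (verma_op s) (free_gen gF ^ j) (bv 0))"
      by (simp add: act_verma_F_power)
    also have "\<dots> = a *\<^sub>s bv j"
      unfolding comm top by (simp add: fsp.linear_scale[OF lin_act[OF lin_verma_op]] act_verma_F_power)
    finally show "act (verma_op s) c (bv j) = a *\<^sub>s bv j" .
  qed
  obtain \<Phi> where \<Phi>: "realises (usl_rels q) (usl_verma q s) (verma_op s) \<Phi>"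
    using usl_verma_realised[OF assms(1)] .
  have scal: "?cl c \<odot>\<^bsub>usl_verma q s\<^esub> m = pres_scal (usl_rels q) b \<odot>\<^bsub>usl_verma q s\<^esub> m
      \<longleftrightarrow> act (verma_op s) c (\<Phi> m) = b *\<^sub>s \<Phi> m" if "m \<in> carrier (usl_verma q s)" for b m
    using realisesD(8)[OF \<Phi> realisesD(6)[OF \<Phi> that] realisesD(6)[OF \<Phi> that], symmetric]
      realisesD(7)[OF \<Phi> that]
    by (simp add: act_free_scal)
  have "c0 q (?cl c) s = a"
    unfolding c0_def
  proof (rule the_equality)
    show "\<forall>m\<in>carrier (usl_verma q s).
        ?cl c \<odot>\<^bsub>usl_verma q s\<^esub> m = pres_scal (usl_rels q) a \<odot>\<^bsub>usl_verma q s\<^esub> m"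
      using scal all by simp
  next
    fix b assume b: "\<forall>m\<in>carrier (usl_verma q s).
        ?cl c \<odot>\<^bsub>usl_verma q s\<^esub> m = pres_scal (usl_rels q) b \<odot>\<^bsub>usl_verma q s\<^esub> m"
    obtain m where "m \<in> carrier (usl_verma q s)" "\<Phi> m = bv 0" using realisesD(9)[OF \<Phi>] by blast
    then have "a *\<^sub>s bv 0 = (b *\<^sub>s bv 0 :: nat \<Rightarrow>\<^sub>0 'k)" using b scal[of m b] all by metis
    then show "b = a" by (metis lookup_scale_fs lookup_single_eq mult.right_neutral)
  qed
  then show ?thesis using all by simp
qed

end

section \<open>Laurent polynomials\<close>

definition leval :: "(int \<Rightarrow>\<^sub>0 'k::field) \<Rightarrow> 'k \<Rightarrow> 'k" where
  "leval f s = (\<Sum>n\<in>supp f. coef f n * s powi n)"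

lemma leval_superset:
  assumes "finite S" "supp f \<subseteq> S"
  shows "leval f s = (\<Sum>n\<in>S. coef f n * s powi n)"
  unfolding leval_def
  by (rule sum.mono_neutral_left) (use assms in \<open>auto simp: in_keys_iff\<close>)

lemma leval_add: "leval (f + g) s = leval f s + leval g s"
proof -
  let ?S = "supp f \<union> supp g"
  have "leval (f + g) s = (\<Sum>n\<in>?S. coef (f + g) n * s powi n)"
    by (rule leval_superset) (auto simp: keys_add)
  also have "\<dots> = leval f s + leval g s"
    by (simp add: leval_superset[of ?S] lookup_add distrib_right sum.distrib)
  finally show ?thesis .
qed

lemma leval_single [simp]: "leval (Poly_Mapping.single n a) s = a * s powi n"
  by (cases "a = 0") (simp_all add: leval_def)

lemma leval_0 [simp]: "leval 0 s = 0"
  by (simp add: leval_def)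

lemma leval_diff: "leval (f - g) s = leval f s - leval g s"
  using leval_add[of "f - g" g s] by simp

lemma leval_sum: "leval (\<Sum>i\<in>S. f i) s = (\<Sum>i\<in>S. leval (f i) s)"
  by (induction S rule: infinite_finite_induct) (simp_all add: leval_add)

text \<open>A power of s clears the negative exponents and leaves an ordinary polynomial.\<close>

lemma finite_zeros_leval:
  fixes f :: "int \<Rightarrow>\<^sub>0 'k::field"
  assumes "f \<noteq> 0"
  shows "finite {s. s \<noteq> 0 \<and> leval f s = 0}"
proof -
  let ?S = "supp f"
  define N where "N = (\<Sum>n\<in>?S. nat \<bar>n\<bar>)"
  have N: "n + int N \<ge> 0" if "n \<in> ?S" for n
  proof -
    have "nat \<bar>n\<bar> \<le> N" unfolding N_def by (rule member_le_sum) (use that in auto)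
    then show ?thesis by linarith
  qed
  define P where "P = (\<Sum>n\<in>?S. monom (coef f n) (nat (n + int N)))"
  obtain k where k: "k \<in> ?S" using assms by (metis all_not_in_conv keys_zero poly_mapping_eqI in_keys_iff lookup_zero)
  have "coeff P (nat (k + int N)) = (\<Sum>n\<in>?S. if n = k then coef f n else 0)"
    unfolding P_def coeff_sum
  proof (rule sum.cong)
    fix n assume "n \<in> ?S"
    then show "coeff (monom (coef f n) (nat (n + int N))) (nat (k + int N)) =
        (if n = k then coef f n else 0)"
      using N[of n] N[OF k] by (auto simp: nat_eq_iff)
  qed simp
  also have "\<dots> \<noteq> 0" using k by (simp add: in_keys_iff)
  finally have "P \<noteq> 0" by auto
  then have "finite {s. poly P s = 0}" by (rule poly_roots_finite)
  moreover have "poly P s = s ^ N * leval f s" if "s \<noteq> 0" for s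
  proof -
    have "s ^ nat (n + int N) = s ^ N * s powi n" if "n \<in> ?S" for n
    proof -
      have "s ^ nat (n + int N) = s powi (n + int N)" using N[OF that] by (simp add: power_int_def)
      then show ?thesis using \<open>s \<noteq> 0\<close> by (simp add: power_int_add mult.commute)
    qed
    then show ?thesis
      by (simp add: P_def poly_sum poly_monom leval_def sum_distrib_left mult_ac)
  qed
  ultimately show ?thesis by (auto elim: rev_finite_subset)
qed

lemma leval_eq_0I:
  assumes "infinite S" "\<And>s. s \<in> S \<Longrightarrow> s \<noteq> 0 \<and> leval f s = 0"
  shows "f = 0"
  using assms finite_subset[of S, OF _ finite_zeros_leval[of f]] by blast


section \<open>Triangular decomposition and the central character\<close>

context quantum_parameter
begin

abbreviation (input) ge :: "(usl_gen, 'k) free_alg" where "ge \<equiv> free_gen gE"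
abbreviation (input) gf :: "(usl_gen, 'k) free_alg" where "gf \<equiv> free_gen gF"

definition kpow :: "int \<Rightarrow> (usl_gen, 'k) free_alg" where
  "kpow n = (if n \<ge> 0 then free_gen gK ^ nat n else free_gen gKi ^ nat (- n))"

fun triang :: "nat \<times> int \<times> nat \<Rightarrow> (usl_gen, 'k) free_alg" where
  "triang (a, n, b) = gf ^ a * kpow n * ge ^ b"

lemma kpow_Suc: "free_gen gK * kpow n - kpow (n + 1) \<in> pres_ideal (usl_rels q)"
proof (cases "n \<ge> 0")
  case True
  then have "free_gen gK * kpow n = kpow (n + 1)" by (simp add: kpow_def nat_add_distrib)
  then show ?thesis using left_idealD(1)[OF left_ideal_pres_ideal] by simp
next
  case False
  define m where "m = nat (- n - 1)"
  have "nat (- n) = Suc m" "kpow (n + 1) = free_gen gKi ^ m"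
    using False by (auto simp: m_def kpow_def)
  then have "free_gen gK * kpow n - kpow (n + 1) = (free_gen gK * free_gen gKi - 1) * free_gen gKi ^ m"
    using False by (simp add: kpow_def algebra_simps)
  then show ?thesis using pres_ideal_mult_right[OF usl_rels_in_ideal(1)] by simp
qed

lemma kpow_pred: "free_gen gKi * kpow n - kpow (n - 1) \<in> pres_ideal (usl_rels q)"
proof (cases "n \<le> 0")
  case True
  then have "nat (1 - n) = Suc (nat (- n))" by simp
  then have "free_gen gKi * kpow n = kpow (n - 1)" using True by (cases "n = 0") (simp_all add: kpow_def)
  then show ?thesis using left_idealD(1)[OF left_ideal_pres_ideal] by simp
next
  case False
  define m where "m = nat (n - 1)"
  have "nat n = Suc m" "kpow (n - 1) = free_gen gK ^ m"
    using False by (auto simp: m_def kpow_def)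
  then have "free_gen gKi * kpow n - kpow (n - 1) = (free_gen gKi * free_gen gK - 1) * free_gen gK ^ m"
    using False by (simp add: kpow_def algebra_simps)
  then show ?thesis using pres_ideal_mult_right[OF usl_rels_in_ideal(2)] by simp
qed

text \<open>The span of the triangular elements contains 1 and is stable under left multiplication by the
  generators: K passes the powers of F up to a scalar, E passes them at the cost of further
  triangular elements, and then passes the powers of K up to a scalar.\<close>

lemma triangular_decomposition:
  "\<exists>u. p - lin_ext triang u \<in> pres_ideal (usl_rels q)"
proof -
  let ?I = "pres_ideal (usl_rels q)"
  obtain nf where nf: "lin nf" "\<And>p. nf p = 0 \<longleftrightarrow> p \<in> ?I" "\<And>p. p - nf p \<in> ?I"
    using exists_normal_form[OF left_ideal_subspace[OF left_ideal_pres_ideal]] by blast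
  interpret quotient_ops "usl_rels q" ?I nf
    by (intro quotient_ops.intro nf left_ideal_pres_ideal order_refl)
  define \<rho> where "\<rho> g z = nf (free_gen g * z)" for g z
  interpret uq_ops q "\<rho> gE" "\<rho> gF" "\<rho> gK" "\<rho> gKi"
    unfolding \<rho>_def[abs_def]
    by (rule uq_ops_quotient[OF quantum_parameter_axioms usl_rels_in_ideal])
  define W where "W = range (\<lambda>u. nf (lin_ext triang u))"
  have linW: "lin (\<lambda>u. nf (lin_ext triang u))" by (rule lin_comp[OF nf(1) lin_lin_ext])
  have W: "fs.subspace W"
    unfolding W_def by (rule fsp.linear_subspace_image[OF linW fs.subspace_UNIV])
  have triang_in: "nf (triang t) \<in> W" for t
    unfolding W_def by (rule range_eqI[of _ _ "bv t"]) simp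
  have pow: "(\<rho> g ^^ m) (nf z) = nf (free_gen g ^ m * z)" for g m z
    by (induction m) (simp_all add: \<rho>_def nf_absorb mult.assoc)
  have F_in: "(\<rho> gF ^^ a) (nf (kpow n * ge ^ b)) \<in> W" for a n b
    using triang_in[of "(a, n, b)"] by (simp add: pow mult.assoc)
  have K: "\<rho> gK (nf (kpow n * z)) = nf (kpow (n + 1) * z)" for n z
    using nf_rel[OF kpow_Suc, of n z] by (simp add: \<rho>_def nf_absorb mult.assoc)
  have Ki: "\<rho> gKi (nf (kpow n * z)) = nf (kpow (n - 1) * z)" for n z
    using nf_rel[OF kpow_pred, of n z] by (simp add: \<rho>_def nf_absorb mult.assoc)
  have EK: "\<rho> gE ((\<rho> gK ^^ m) v) = inverse (q ^ (2 * m)) *\<^sub>s (\<rho> gK ^^ m) (\<rho> gE v)" for m v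
  proof (induction m arbitrary: v)
    case (Suc m)
    have "\<rho> gE (\<rho> gK v) = inverse (q ^ 2) *\<^sub>s \<rho> gK (\<rho> gE v)" for v using q_nz by (simp add: KE)
    then show ?case by (simp add: Suc lin_simps power_add power2_eq_square mult_ac)
  qed simp
  have EKi: "\<rho> gE ((\<rho> gKi ^^ m) v) = q ^ (2 * m) *\<^sub>s (\<rho> gKi ^^ m) (\<rho> gE v)" for m v
  proof (induction m arbitrary: v)
    case (Suc m)
    have "\<rho> gE (\<rho> gKi v) = q ^ 2 *\<^sub>s \<rho> gKi (\<rho> gE v)" for v using q_nz by (simp add: KiE)
    then show ?case by (simp add: Suc lin_simps power_add power2_eq_square mult_ac)
  qed simp
  have E: "\<exists>c. \<rho> gE (nf (kpow n * ge ^ b)) = c *\<^sub>s nf (kpow n * ge ^ Suc b)" for n b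
  proof -
    have Eb: "\<rho> gE (nf (ge ^ b)) = nf (ge ^ Suc b)" by (simp add: \<rho>_def nf_absorb)
    show ?thesis
    proof (cases "n \<ge> 0")
      case True
      then show ?thesis
        using EK[of "nat n" "nf (ge ^ b)"] unfolding Eb pow by (auto simp: kpow_def simp del: power_Suc)
    next
      case False
      then show ?thesis
        using EKi[of "nat (- n)" "nf (ge ^ b)"] unfolding Eb pow by (auto simp: kpow_def simp del: power_Suc)
    qed
  qed
  note sub = fs.subspace_add[OF W] fs.subspace_diff[OF W] fs.subspace_scale[OF W]
  have gen: "\<rho> g (nf (triang t)) \<in> W" for g t
  proof -
    obtain a n b where t: "t = (a, n, b)" by (cases t)
    have tr: "nf (triang t) = (\<rho> gF ^^ a) (nf (kpow n * ge ^ b))" by (simp add: t pow mult.assoc)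
    show ?thesis
    proof (cases g)
      case gE
      obtain c where "\<rho> gE (nf (kpow n * ge ^ b)) = c *\<^sub>s nf (kpow n * ge ^ Suc b)" using E by blast
      then show ?thesis
        unfolding gE tr E_F_power K Ki
        by (simp add: F_power_simps sub F_in del: power_Suc)
    next
      case gF
      then show ?thesis using F_in[of "Suc a" n b] unfolding tr by simp
    next
      case gK
      then show ?thesis unfolding gK tr K_F_power K by (intro sub F_in)
    next
      case gKi
      then show ?thesis unfolding gKi tr Ki_F_power Ki by (intro sub F_in)
    qed
  qed
  have lin\<rho>: "lin (\<rho> g)" for g unfolding \<rho>_def by (rule lin_nf_mult)
  have inv: "\<rho> g v \<in> W" if "v \<in> W" for g v
  proof -
    obtain u where v: "v = nf (lin_ext triang u)" using \<open>v \<in> W\<close> by (auto simp: W_def)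
    have "\<rho> g v = (\<Sum>t\<in>supp u. coef u t *\<^sub>s \<rho> g (nf (triang t)))"
      unfolding v using lin_expand[OF lin_comp[OF lin\<rho> linW], of g u] by simp
    then show ?thesis using gen by (auto intro!: fs.subspace_sum[OF W] sub)
  qed
  have "nf 1 \<in> W" using triang_in[of "(0, 0, 0)"] by (simp add: kpow_def)
  then have "act \<rho> p (nf 1) \<in> W" by (intro act_invariant[OF W] inv)
  then have "nf p \<in> W" unfolding \<rho>_def[abs_def] act_nf by simp
  then show ?thesis unfolding W_def by (auto simp: nf_eq_iff)
qed

definition eprod :: "nat \<Rightarrow> nat \<Rightarrow> 'k \<Rightarrow> 'k" where
  "eprod b j s = (\<Prod>i<b. ecoef (j - i) s)"

lemma act_E_power: "act (verma_op s) (ge ^ b) (bv j) = eprod b j s *\<^sub>s bv (j - b)"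
proof (induction b)
  case 0
  show ?case by (simp add: eprod_def act_one)
next
  case (Suc b)
  have "act (verma_op s) (ge ^ Suc b) (bv j) = verma_op s gE (act (verma_op s) (ge ^ b) (bv j))"
    by (simp add: act_mult[OF lin_verma_op] act_free_gen)
  then show ?case by (simp add: Suc verma_lin_simps eprod_def mult.commute)
qed

lemma act_kpow:
  assumes "s \<noteq> 0"
  shows "act (verma_op s) (kpow n) (bv j) = (s / q ^ (2 * j)) powi n *\<^sub>s bv j"
proof -
  have K: "act (verma_op s) (free_gen gK ^ m) (bv j) = (s / q ^ (2 * j)) ^ m *\<^sub>s bv j" for m
    by (induction m) (simp_all add: act_one act_mult[OF lin_verma_op] act_free_gen verma_lin_simps mult.commute)
  have Ki: "act (verma_op s) (free_gen gKi ^ m) (bv j) = (q ^ (2 * j) / s) ^ m *\<^sub>s bv j" for m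
    by (induction m) (simp_all add: act_one act_mult[OF lin_verma_op] act_free_gen verma_lin_simps mult.commute)
  show ?thesis by (simp add: kpow_def power_int_def K Ki)
qed

lemma act_triang:
  assumes "s \<noteq> 0"
  shows "act (verma_op s) (triang (a, n, b)) (bv j) =
    (eprod b j s * (s / q ^ (2 * (j - b))) powi n) *\<^sub>s bv (j - b + a)"
  by (simp add: act_mult[OF lin_verma_op] act_E_power act_kpow[OF assms] act_verma_F_power
      fsp.linear_scale[OF lin_act[OF lin_verma_op]])

text \<open>On the basis vector number b only the terms with at most b factors E survive. If there are
  no terms with fewer than b factors, the coefficients are Laurent polynomials in the highest
  weight.\<close>

lemma lookup_act_triang:
  assumes s: "s \<noteq> 0" and min: "\<And>a n b'. (a, n, b') \<in> supp u \<Longrightarrow> b \<le> b'"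
  shows "coef (act (verma_op s) (lin_ext triang u) (bv b)) a =
    eprod b b s * leval (Poly_Mapping.map_key (\<lambda>n. (a, n, b)) u) s"
proof -
  let ?i = "\<lambda>n. (a, n, b)"
  let ?f = "Poly_Mapping.map_key ?i u"
  have inj: "inj ?i" by (auto simp: inj_def)
  have f: "coef ?f n = coef u (a, n, b)" for n
    by (simp add: map_key.rep_eq[OF inj] map_key_def)
  let ?t = "\<lambda>t. coef u t *
    coef (act (verma_op s) (triang t) (bv b)) a"
  have "coef (act (verma_op s) (lin_ext triang u) (bv b)) a = (\<Sum>t\<in>supp u. ?t t)"
    using lin_expand[where f = "\<lambda>u. act (verma_op s) (lin_ext triang u) (bv b)" and v = u,
        OF lin_comp[OF lin_act_left lin_lin_ext]]
    by (simp add: lookup_sum)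
  also have "\<dots> = (\<Sum>t\<in>?i ` supp ?f. ?t t)"
  proof (rule sum.mono_neutral_right)
    show "\<forall>t\<in>supp u - ?i ` supp ?f. ?t t = 0"
    proof
      fix t assume t: "t \<in> supp u - ?i ` supp ?f"
      obtain a' n b' where tt: "t = (a', n, b')" by (cases t)
      then have "b \<le> b'" using min t by blast
      moreover have "eprod b' b s = 0" if "b < b'"
        unfolding eprod_def using that by (intro prod_zero) (auto intro!: bexI[of _ b])
      moreover have "a' \<noteq> a" if "b = b'" using t tt that f[of n] by (auto simp: in_keys_iff image_iff)
      ultimately show "?t t = 0"
        unfolding tt act_triang[OF s] by (auto simp: lookup_single when_def nat_less_le)
    qed
  qed (auto simp: in_keys_iff f)
  also have "\<dots> = (\<Sum>n\<in>supp ?f. ?t (?i n))"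
    by (rule sum.reindex_cong[where l = ?i]) (auto simp: inj_on_def)
  also have "\<dots> = eprod b b s * leval ?f s"
    unfolding act_triang[OF s] leval_def f by (simp add: sum_distrib_left mult_ac)
  finally show ?thesis .
qed

lemma infinite_powers: "infinite (range (\<lambda>m. q ^ m))"
  by (rule range_inj_infinite) (simp add: inj_def q_power_eq_iff)

lemma infinite_inverse_powers: "infinite (range (\<lambda>m. inverse (q ^ Suc m)))"
  by (rule range_inj_infinite) (simp only: inj_def inverse_eq_iff_eq q_power_eq_iff, simp)

text \<open>Look at the terms with the fewest factors E, say b of them, on the basis vector number b.
  For highest weights that are inverse powers of q, E kills no basis vector except the first, so
  the Laurent polynomials in the highest weight that collect these terms have infinitely many
  zeros.\<close>

lemma triang_faithful:
  assumes "\<And>s v. s \<noteq> 0 \<Longrightarrow> act (verma_op s) (lin_ext triang u) v = 0"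
  shows "u = 0"
proof (rule ccontr)
  assume "u \<noteq> 0"
  then have ne: "supp u \<noteq> {}" by (metis keys_eq_empty)
  let ?B = "(\<lambda>(a, n, b). b) ` supp u"
  define b where "b = Min ?B"
  have fin: "finite ?B" "?B \<noteq> {}" using ne by auto
  have min: "b \<le> b'" if "(a, n, b') \<in> supp u" for a n b'
    unfolding b_def by (rule Min_le[OF fin(1)]) (use that in force)
  have "b \<in> ?B" unfolding b_def by (rule Min_in[OF fin])
  then obtain a n where an: "(a, n, b) \<in> supp u" by auto
  let ?f = "Poly_Mapping.map_key (\<lambda>n. (a, n, b)) u"
  have "?f = 0"
  proof (rule leval_eq_0I[OF infinite_inverse_powers])
    fix s assume "s \<in> range (\<lambda>m. inverse (q ^ Suc m))"
    then obtain m where s: "s = inverse (q ^ Suc m)" by blast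
    then have s0: "s \<noteq> 0" using q_nz by simp
    have "ecoef l s \<noteq> 0" if "l > 0" for l
    proof (rule ecoef_nz[OF s0 that])
      have "q * s = inverse (q ^ m)" using q_nz by (simp add: s)
      then have "(q * s) ^ 2 * q ^ (2 * m) = 1"
        using q_nz by (simp add: power_inverse power_mult[symmetric] mult.commute)
      moreover have "q ^ (2 * l) * q ^ (2 * m) \<noteq> 1"
        using q_power[of "2 * l + 2 * m"] that by (simp add: power_add)
      ultimately show "(q * s)\<^sup>2 \<noteq> q ^ (2 * l)" by auto
    qed
    then have "eprod b b s \<noteq> 0" by (simp add: eprod_def)
    moreover have "coef (act (verma_op s) (lin_ext triang u) (bv b)) a =
        eprod b b s * leval ?f s"
      by (rule lookup_act_triang[OF s0]) (rule min)
    ultimately show "s \<noteq> 0 \<and> leval ?f s = 0"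
      using assms[OF s0] s0 by simp
  qed
  moreover have "coef ?f n = coef u (a, n, b)"
    by (subst map_key.rep_eq) (auto simp: inj_def)
  ultimately show False using an by (simp add: in_keys_iff)
qed

text \<open>Harish-Chandra: the terms without E and F compute the central character, and an element
  whose central character is 0 kills every Verma module, so it is 0 by faithfulness.\<close>

lemma c0_laurent:
  assumes C: "C \<in> ring_center (usl q)" "C \<noteq> \<zero>\<^bsub>usl q\<^esub>"
  obtains f where "f \<noteq> 0" "\<And>s. s \<noteq> 0 \<Longrightarrow> c0 q C s = leval f s"
proof -
  obtain c where c: "C = pres_class (usl_rels q) c"
    using C(1) by (auto simp: ring_center_def usl_def carrier_pres_alg)
  obtain u where u: "c - lin_ext triang u \<in> pres_ideal (usl_rels q)"
    using triangular_decomposition by blast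
  have act_u: "act (verma_op s) (lin_ext triang u) v = c0 q C s *\<^sub>s v" if "s \<noteq> 0" for s v
    using pres_ideal_annihilates[OF lin_verma_op verma_rels[OF that] u, of v]
      central_acts_by_scalar[OF that C(1)[unfolded c], of v]
    by (simp add: act_simps c)
  let ?f = "Poly_Mapping.map_key (\<lambda>n. (0, n, 0)) u"
  have f: "c0 q C s = leval ?f s" if "s \<noteq> 0" for s
    using lookup_act_triang[OF that, of u 0 0] act_u[OF that] by (simp add: eprod_def)
  moreover have "?f \<noteq> 0"
  proof
    assume "?f = 0"
    then have "u = 0" using f act_u by (intro triang_faithful) simp
    then have "C = \<zero>\<^bsub>usl q\<^esub>"
      using u by (simp add: c usl_def pres_alg_zero pres_class_eq_iff lin_ext_def)
    then show False using C(2) by simp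
  qed
  ultimately show thesis using that by blast
qed

lemma qbrace_inverse: "qbrace q (inverse a) = - qbrace q a"
  by (simp add: qbrace_def divide_inverse algebra_simps)

text \<open>The Verma module of highest weight q^m has a maximal vector of weight q^-(m+2), at the index
  m + 1, and a central element acts by the same scalar on both.\<close>

lemma c0_symmetric:
  assumes C: "C \<in> ring_center (usl q)"
  shows "c0 q C (q ^ m) = c0 q C (inverse (q ^ 2 * q ^ m))"
proof -
  obtain c where c: "C = pres_class (usl_rels q) c"
    using C by (auto simp: ring_center_def usl_def carrier_pres_alg)
  let ?s = "q ^ m" and ?t = "inverse (q ^ 2 * q ^ m)"
  let ?T = "lin_ext (\<lambda>j. bv (Suc m + j)) :: (nat \<Rightarrow>\<^sub>0 'k) \<Rightarrow> _"
  have nz: "?s \<noteq> 0" "?t \<noteq> 0" using q_nz by simp_all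
  have T: "?T (verma_op ?t g v) = verma_op ?s g (?T v)" for g v
  proof (rule lin_eqI[where f = "\<lambda>v. ?T (verma_op ?t g v)"])
    fix j
    have "ecoef (Suc m + j) ?s = qbrace q (q ^ (Suc m + j)) * qbrace q (inverse (q ^ j))"
      using q_nz by (simp add: ecoef_def power_add field_simps)
    moreover have "ecoef j ?t = qbrace q (q ^ j) * qbrace q (inverse (q ^ (Suc m + j)))"
      using q_nz by (simp add: ecoef_def power_add field_simps power2_eq_square)
    ultimately have e: "ecoef (Suc m + j) ?s = ecoef j ?t" by (simp only: qbrace_inverse) simp
    have E: "ecoef j ?t *\<^sub>s bv (Suc m + (j - 1)) = (ecoef j ?t *\<^sub>s bv (m + j) :: nat \<Rightarrow>\<^sub>0 'k)"
      by (cases j) simp_all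
    have "2 * (Suc m + j) = 2 + m + m + 2 * j" by simp
    then have pw: "q ^ (2 * (Suc m + j)) = q ^ 2 * q ^ m * q ^ m * q ^ (2 * j)"
      by (simp only: power_add)
    show "?T (verma_op ?t g (bv j)) = verma_op ?s g (?T (bv j))"
    proof (cases g)
      case gE
      then show ?thesis using e E by (simp add: fsp.linear_scale[OF lin_lin_ext])
    next
      case gF
      then show ?thesis by simp
    next
      case gK
      then show ?thesis using q_nz
        by (simp add: fsp.linear_scale[OF lin_lin_ext] pw[simplified]) (simp add: field_simps)
    next
      case gKi
      then show ?thesis using q_nz
        by (simp add: fsp.linear_scale[OF lin_lin_ext] pw[simplified]) (simp add: field_simps)
    qed
  qed (intro lin_comp[OF lin_lin_ext lin_verma_op] lin_comp[OF lin_verma_op lin_lin_ext])+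
  have "?T (act (verma_op ?t) c (bv 0)) = act (verma_op ?s) c (?T (bv 0))"
    by (rule act_intertwine[where T = ?T and \<rho> = "verma_op ?t" and \<rho>' = "verma_op ?s",
          OF lin_lin_ext]) (rule T)
  then have "?T (c0 q C ?t *\<^sub>s bv 0) = c0 q C ?s *\<^sub>s ?T (bv 0)"
    unfolding c central_acts_by_scalar[OF nz(1) C[unfolded c]]
      central_acts_by_scalar[OF nz(2) C[unfolded c]] .
  then have "c0 q C ?t *\<^sub>s bv (Suc m) = (c0 q C ?s *\<^sub>s bv (Suc m) :: nat \<Rightarrow>\<^sub>0 'k)"
    unfolding fsp.linear_scale[OF lin_lin_ext] lin_ext_single by simp
  then show ?thesis by simp
qed

text \<open>The symmetry holds at infinitely many points, so it holds for the coefficients.\<close>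

lemma coef_symmetric:
  assumes C: "C \<in> ring_center (usl q)" and f: "\<And>s. s \<noteq> 0 \<Longrightarrow> c0 q C s = leval f s"
  shows "coef f n = q powi (2 * n) * coef f (- n)"
proof -
  define f' where "f' = (\<Sum>n\<in>supp f.
    Poly_Mapping.single (- n) (coef f n * q powi (- 2 * n)))"
  have f': "leval f' s = leval f (inverse (q ^ 2 * s))" if "s \<noteq> 0" for s
  proof -
    have "inverse (q ^ 2 * s) powi n = q powi (- 2 * n) * s powi (- n)" for n
      using q_nz that
      by (simp add: power_int_mult_distrib power_int_inverse power_int_minus power_int_mult)
    then show ?thesis by (simp add: f'_def leval_sum leval_def[of f] mult_ac)
  qed
  have "f - f' = 0"
  proof (rule leval_eq_0I[OF infinite_powers])
    fix s assume "s \<in> range (\<lambda>m. q ^ m)"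
    then obtain m where m: "s = q ^ m" by blast
    then have "s \<noteq> 0" "inverse (q ^ 2 * s) \<noteq> 0" using q_nz by simp_all
    then show "s \<noteq> 0 \<and> leval (f - f') s = 0"
      using c0_symmetric[OF C, of m] f m by (simp add: leval_diff f')
  qed
  then have "coef f n = coef f' n" by simp
  also have "\<dots> = (\<Sum>k\<in>supp f. if k = - n then coef f k * q powi (- 2 * k) else 0)"
    unfolding f'_def lookup_sum by (rule sum.cong) (auto simp: lookup_single when_def)
  also have "\<dots> = q powi (2 * n) * coef f (- n)"
    by (auto simp: in_keys_iff)
  finally show ?thesis .
qed

lemma power_int_q_eq_1: "q powi n = 1 \<longleftrightarrow> n = 0"
proof
  assume a: "q powi n = 1"
  show "n = 0"
  proof (rule ccontr)
    assume "n \<noteq> 0"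
    then consider "n > 0" | "n < 0" by linarith
    then show False
    proof cases
      case 1
      then show False using a q_power[of "nat n"] by (simp add: power_int_def)
    next
      case 2
      then have "inverse (q ^ nat (- n)) = 1" using a by (simp add: power_int_def power_inverse)
      then show False using 2 q_power[of "nat (- n)"] by (simp add: inverse_eq_1_iff)
    qed
  qed
qed simp

text \<open>The summand of alpha is, up to a constant, a Laurent polynomial g in the weight whose
  constant term vanishes by the symmetry of the central character. So each monomial contributes a
  geometric sum with ratio different from 1, and the whole sum is a nonconstant Laurent polynomial
  in q^n.\<close>

lemma finite_alpha_zeros:
  assumes C: "C \<in> ring_center (usl q)" "C \<noteq> \<zero>\<^bsub>usl q\<^esub>" and r: "r \<noteq> 0"
  shows "finite {n. alpha q C r (Suc n) = 0}"
proof -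
  obtain f where f0: "f \<noteq> 0" and f: "\<And>s. s \<noteq> 0 \<Longrightarrow> c0 q C s = leval f s"
    by (rule c0_laurent[OF C]) blast
  define g where "g = (\<Sum>n\<in>supp f. Poly_Mapping.single (n + 1) (q * coef f n) -
    Poly_Mapping.single (n - 1) (coef f n / q))"
  \<comment> \<open>g(t) is the product of qt - 1/(qt) and f(t).\<close>
  have g: "dq * (qbrace q (q * t) * c0 q C t) = leval g t" if "t \<noteq> 0" for t
  proof -
    have "dq * (qbrace q (q * t) * c0 q C t) = (q * t - inverse (q * t)) * leval f t"
      using dq_nz f[OF that] by (simp add: qbrace_def dq_def)
    also have "\<dots> = (\<Sum>n\<in>supp f. (q * t - inverse (q * t)) * (coef f n * t powi n))"
      by (simp add: leval_def sum_distrib_left)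
    also have "\<dots> = leval g t"
      unfolding g_def leval_sum
      by (rule sum.cong) (use that q_nz in
          \<open>simp_all add: leval_diff power_int_add power_int_diff field_simps\<close>)
    finally show ?thesis .
  qed
  have "coef g 0 = (\<Sum>n\<in>supp f.
      (if n = - 1 then q * coef f n else 0) -
      (if n = 1 then coef f n / q else 0))"
    unfolding g_def lookup_sum
    by (rule sum.cong) (auto simp: lookup_minus lookup_single when_def)
  also have "\<dots> = q * coef f (- 1) - coef f 1 / q"
    by (auto simp: sum_subtractf in_keys_iff)
  also have "\<dots> = 0"
    using coef_symmetric[OF C(1) f, of 1] q_nz by (simp add: power2_eq_square field_simps)
  finally have g0: "coef g 0 = 0" .
  have "g \<noteq> 0"
  proof
    assume "g = 0"
    have "f = 0"
    proof (rule leval_eq_0I[OF infinite_powers])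
      fix s assume "s \<in> range (\<lambda>m. q ^ m)"
      then obtain m where s: "s = q ^ m" by blast
      then have s0: "s \<noteq> 0" using q_nz by simp
      have "(q * s) ^ 2 \<noteq> 1"
        using q_power[of "Suc m * 2"] unfolding s power_mult by simp
      then have "qbrace q (q * s) \<noteq> 0" using s0 q_nz by (simp add: qbrace_eq_0_iff)
      then show "s \<noteq> 0 \<and> leval f s = 0"
        using g[OF s0] f[OF s0] dq_nz \<open>g = 0\<close> s0 by simp
    qed
    then show False using f0 by simp
  qed
  then obtain k0 where k0: "k0 \<in> supp g" by (metis all_not_in_conv keys_eq_empty)
  have k_nz: "k \<noteq> 0" if "k \<in> supp g" for k
    using that g0 by (auto simp: in_keys_iff)
  \<comment> \<open>The coefficient of the geometric sum that the monomial of degree k contributes.\<close>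
  define A where "A k = coef g k * r powi k / (q powi (- k) - 1)" for k
  define h where "h = (\<Sum>k\<in>supp g. Poly_Mapping.single (- k) (A k) - Poly_Mapping.single 0 (A k))"
  have "coef h (- k0) = (\<Sum>k\<in>supp g. if k = k0 then A k else 0)"
    unfolding h_def lookup_sum
    by (rule sum.cong) (use k_nz[OF k0] in \<open>auto simp: lookup_minus lookup_single when_def\<close>)
  also have "\<dots> = A k0" using k0 by simp
  also have "\<dots> \<noteq> 0"
    using k0 k_nz[OF k0] r power_int_q_eq_1[of "- k0"] by (auto simp: A_def in_keys_iff)
  finally have "h \<noteq> 0" by auto
  have "dq * alpha q C r (Suc n) = leval h (q ^ n)" for n
  proof -
    have "dq * alpha q C r (Suc n) = (\<Sum>j<n. leval g (q powi (- int j) * r))"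
    proof -
      have "dq * (qbrace q (q powi (1 - int j) * r) * c0 q C (q powi (- int j) * r)) =
          leval g (q powi (- int j) * r)" for j
      proof -
        have "q powi (1 - int j) * r = q * (q powi (- int j) * r)"
          using q_nz power_int_add[of q 1 "- int j"] by simp
        then show ?thesis using g[of "q powi (- int j) * r"] q_nz r by (simp add: mult.assoc)
      qed
      then show ?thesis by (simp add: alpha_def sum_distrib_left)
    qed
    also have "\<dots> = (\<Sum>k\<in>supp g. \<Sum>j<n. coef g k * r powi k * (q powi (- k)) ^ j)"
    proof -
      have "(q powi (- int j) * r) powi k = r powi k * (q powi (- k)) ^ j" for j k
      proof -
        have "(q powi (- int j)) powi k = (q powi (- k)) ^ j"
          using q_nz by (metis mult.commute minus_mult_commute power_int_mult power_int_of_nat)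
        then show ?thesis by (simp add: power_int_mult_distrib mult.commute)
      qed
      then show ?thesis unfolding leval_def by (subst sum.swap) (simp add: mult.assoc)
    qed
    also have "\<dots> = (\<Sum>k\<in>supp g. A k * (q ^ n) powi (- k) - A k)"
    proof (rule sum.cong)
      fix k assume k: "k \<in> supp g"
      let ?w = "q powi (- k)"
      have "?w \<noteq> 1" using power_int_q_eq_1[of "- k"] k_nz[OF k] by simp
      then have "(\<Sum>j<n. ?w ^ j) = (?w ^ n - 1) / (?w - 1)" by (rule geometric_sum)
      moreover have "?w ^ n = (q ^ n) powi (- k)"
        using q_nz by (metis mult.commute power_int_mult power_int_of_nat)
      ultimately show "(\<Sum>j<n. coef g k * r powi k * ?w ^ j) =
          A k * (q ^ n) powi (- k) - A k"
        by (simp add: sum_distrib_left[symmetric] A_def diff_divide_distrib right_diff_distrib)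
    qed simp
    also have "\<dots> = leval h (q ^ n)"
      by (simp add: h_def leval_sum leval_diff)
    finally show ?thesis .
  qed
  then have "(\<lambda>n. q ^ n) ` {n. alpha q C r (Suc n) = 0} \<subseteq> {s. s \<noteq> 0 \<and> leval h s = 0}"
    using q_nz by (auto, metis mult_zero_right)
  then have "finite ((\<lambda>n. q ^ n) ` {n. alpha q C r (Suc n) = 0})"
    using finite_zeros_leval[OF \<open>h \<noteq> 0\<close>] by (rule finite_subset)
  then show ?thesis by (rule finite_imageD) (simp add: inj_on_def q_power_eq_iff)
qed

end

section \<open>The Verma module of the oscillator algebra\<close>

locale osc_parameter = quantum_parameter q for q :: "'k::field" +
  fixes C :: "(usl_gen, 'k) free_alg set" and r :: 'k
  assumes C: "C \<in> ring_center (usl q)" and r_nz: "r \<noteq> 0"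
    and r_generic: "r ^ 2 \<noteq> q ^ (2 * n)"
begin

abbreviation "oE \<equiv> free_gen (Usl gE) :: (osc_gen, 'k) free_alg"
abbreviation "oF \<equiv> free_gen (Usl gF) :: (osc_gen, 'k) free_alg"
abbreviation "oK \<equiv> free_gen (Usl gK) :: (osc_gen, 'k) free_alg"
abbreviation "oKi \<equiv> free_gen (Usl gKi) :: (osc_gen, 'k) free_alg"
abbreviation "oX \<equiv> free_gen gX :: (osc_gen, 'k) free_alg"
abbreviation "oY \<equiv> free_gen gY :: (osc_gen, 'k) free_alg"
abbreviation "osc_ideal \<equiv> pres_ideal (osc_rels q C)"

definition wt :: "nat \<Rightarrow> 'k" where "wt i = r / q ^ i"

definition cs :: "nat \<Rightarrow> 'k" where "cs i = c0 q C (wt i)"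

text \<open>Call a weight vector U-maximal if E kills it. The U-maximal vector number i + 1 is obtained from
  Y times number i by subtracting mu times F applied to number i - 1; X sends number i to lam times
  number i - 1. Since lam 0 and mu 0 are 0, all formulas below also hold for i = 0, where the
  index i - 1 is truncated to 0.\<close>

primrec lam :: "nat \<Rightarrow> 'k" where
  "lam 0 = 0"
| "lam (Suc i) = lam i / qbrace q (q * wt i) * qbrace q (q ^ 2 * wt i) - cs i"

definition mu :: "nat \<Rightarrow> 'k" where "mu i = lam i / qbrace q (q * wt i)"

lemma wt_nz: "wt i \<noteq> 0"
  using r_nz q_nz by (simp add: wt_def)

lemma wt_Suc: "wt (Suc i) = wt i / q"
  by (simp add: wt_def)

lemma wt_powi: "q powi (- int i) * r = wt i"
  by (simp add: wt_def power_int_minus divide_inverse mult.commute)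

lemma mu_0 [simp]: "mu 0 = 0"
  by (simp add: mu_def)

lemma qbrace_wt_nz:
  assumes "i > 0"
  shows "qbrace q (q * wt i) \<noteq> 0"
proof -
  obtain k where i: "i = Suc k" using assms by (cases i) auto
  have "q * wt i = r / q ^ k" using q_nz by (simp add: i wt_def)
  moreover have "(r / q ^ k) ^ 2 \<noteq> 1"
    using r_generic[of k] q_nz by (simp add: power_divide power_mult[symmetric] mult.commute)
  ultimately show ?thesis using r_nz q_nz by (simp add: qbrace_eq_0_iff)
qed

lemma lam_eq: "lam i = mu i * qbrace q (q * wt i)"
  by (cases "i = 0") (simp_all add: mu_def qbrace_wt_nz)

lemma lam_Suc_mu: "lam (Suc i) = mu i * qbrace q (q ^ 2 * wt i) - cs i"
  by (simp add: mu_def)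

lemma mu_wt_pred: "mu i * wt (i - 1) = mu i * (q * wt i)"
  using q_nz by (cases i) (simp_all add: wt_def)

lemma mu_wt_pred_inv: "mu i / wt (i - 1) = mu i / (q * wt i)"
  using q_nz by (cases i) (simp_all add: wt_def)

lemma ecoef_wt_nz: "ecoef (Suc j) (wt i) \<noteq> 0"
proof (rule ecoef_nz[OF wt_nz])
  have "(q * wt i) ^ 2 * q ^ (2 * i) = q ^ 2 * r ^ 2"
    using q_nz by (simp add: wt_def power_mult_distrib power_divide power_mult[symmetric] mult.commute)
  moreover have "q ^ (2 * Suc j) * q ^ (2 * i) = q ^ 2 * q ^ (2 * (j + i))"
    by (simp add: power_add power2_eq_square distrib_left mult_ac)
  ultimately show "(q * wt i)\<^sup>2 \<noteq> q ^ (2 * Suc j)"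
    using r_generic[of "j + i"] q_nz by (metis mult_cancel_left power_not_zero)
qed simp

text \<open>The two coefficients of X on F^j applied to the U-maximal vector number i: down to row
  i - 1, where the factor mu is split off, and up to row i + 1.\<close>

definition xdown :: "nat \<Rightarrow> nat \<Rightarrow> 'k" where
  "xdown i j = (q * wt i - q ^ (2 * j) / (q * wt i)) / dq"

definition xup :: "nat \<Rightarrow> nat \<Rightarrow> 'k" where
  "xup i j = (q ^ (2 * j) - 1) / (q * dq * wt i)"

lemma xup_0 [simp]: "xup i 0 = 0"
  by (simp add: xup_def)

text \<open>The basis vector (i, j) stands for F^j applied to the U-maximal vector number i.\<close>

fun osc_op :: "osc_gen \<Rightarrow> (nat \<times> nat \<Rightarrow>\<^sub>0 'k) \<Rightarrow> (nat \<times> nat \<Rightarrow>\<^sub>0 'k)" where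
  "osc_op (Usl gE) = lin_ext (\<lambda>(i, j). ecoef j (wt i) *\<^sub>s bv (i, j - 1))"
| "osc_op (Usl gF) = lin_ext (\<lambda>(i, j). bv (i, Suc j))"
| "osc_op (Usl gK) = lin_ext (\<lambda>(i, j). (wt i / q ^ (2 * j)) *\<^sub>s bv (i, j))"
| "osc_op (Usl gKi) = lin_ext (\<lambda>(i, j). (q ^ (2 * j) / wt i) *\<^sub>s bv (i, j))"
| "osc_op gX = lin_ext (\<lambda>(i, j). (mu i * xdown i j) *\<^sub>s bv (i - 1, j) - xup i j *\<^sub>s bv (Suc i, j - 1))"
| "osc_op gY = lin_ext (\<lambda>(i, j). bv (Suc i, j) + mu i *\<^sub>s bv (i - 1, Suc j))"

lemma lin_osc_op: "lin (osc_op g)"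
  by (cases g rule: osc_op.cases) (simp_all add: lin_lin_ext)

lemma osc_op_bv [simp]:
  "osc_op (Usl gE) (bv (i, j)) = ecoef j (wt i) *\<^sub>s bv (i, j - 1)"
  "osc_op (Usl gF) (bv (i, j)) = bv (i, Suc j)"
  "osc_op (Usl gK) (bv (i, j)) = (wt i / q ^ (2 * j)) *\<^sub>s bv (i, j)"
  "osc_op (Usl gKi) (bv (i, j)) = (q ^ (2 * j) / wt i) *\<^sub>s bv (i, j)"
  "osc_op gX (bv (i, j)) = (mu i * xdown i j) *\<^sub>s bv (i - 1, j) - xup i j *\<^sub>s bv (Suc i, j - 1)"
  "osc_op gY (bv (i, j)) = bv (Suc i, j) + mu i *\<^sub>s bv (i - 1, Suc j)"
  by simp_all

declare osc_op.simps [simp del]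

lemmas osc_lin_simps = fsp.linear_add[OF lin_osc_op] fsp.linear_diff[OF lin_osc_op]
  fsp.linear_scale[OF lin_osc_op] fsp.linear_0[OF lin_osc_op] fsp.linear_neg[OF lin_osc_op]

text \<open>The i-th row is a copy of a Verma module of the quantum group.\<close>

definition row :: "nat \<Rightarrow> (nat \<Rightarrow>\<^sub>0 'k) \<Rightarrow> (nat \<times> nat \<Rightarrow>\<^sub>0 'k)" where
  "row i = lin_ext (\<lambda>j. bv (i, j))"

lemma lin_row: "lin (row i)"
  unfolding row_def by (rule lin_lin_ext)

lemma row_bv [simp]: "row i (bv j) = bv (i, j)"
  by (simp add: row_def)

lemma row_intertwine: "row i (verma_op (wt i) g v) = osc_op (Usl g) (row i v)"
proof (rule lin_eqI[where f = "\<lambda>v. row i (verma_op (wt i) g v)"])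
  show "row i (verma_op (wt i) g (bv j)) = osc_op (Usl g) (row i (bv j))" for j
    by (cases g) (simp_all add: fsp.linear_scale[OF lin_row])
qed (intro lin_comp[OF lin_row lin_verma_op] lin_comp[OF lin_osc_op lin_row])+

lemma act_row: "row i (act (verma_op (wt i)) p v) = act osc_op (free_map Usl p) (row i v)"
  unfolding act_free_map
  by (rule act_intertwine[where T = "row i" and \<rho> = "verma_op (wt i)" and \<rho>' = "\<lambda>g. osc_op (Usl g)",
        OF lin_row row_intertwine])

lemma act_osc_eqI:
  assumes "\<And>i j. act osc_op p (bv (i, j)) = act osc_op p' (bv (i, j))"
  shows "act osc_op p v = act osc_op p' v"
  by (rule lin_eqI[where f = "act osc_op p"]) (use assms in \<open>auto intro: lin_act lin_osc_op\<close>)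

lemma osc_rel_eqI:
  assumes "\<And>i j. act osc_op p (bv (i, j)) = act osc_op p' (bv (i, j))"
  shows "act osc_op (p - p') v = 0"
  using act_osc_eqI[of p p' v] assms by (simp add: act_simps)

lemma xup_pred:
  "xup i' j *\<^sub>s bv (i, Suc (j - Suc 0)) = xup i' j *\<^sub>s (bv (i, j) :: nat \<times> nat \<Rightarrow>\<^sub>0 'k)"
  by (cases j) simp_all

text \<open>The relations, compared on a basis vector, amount to the following identities between rational
  functions in q, the weight s and q^j. Only the last one also uses the recursion for lam.\<close>

lemma ecoef_eq:
  "s \<noteq> 0 \<Longrightarrow> ecoef j s = (q ^ (2 * j) - 1) * (q * q * s * s - q ^ (2 * j)) * q /
     (q ^ (2 * j) * s * (q * q - 1) * (q * q - 1))"
proof -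
  assume s: "s \<noteq> 0"
  have Q: "q ^ (2 * j) = q ^ j * q ^ j" by (simp add: power_add[symmetric] mult_2)
  show ?thesis
    unfolding ecoef_def Q using s q_nz qq by (simp add: qbrace_eq divide_simps)
qed

lemma EX_coefs:
  "mu i * xdown i j * ecoef j (wt (i - 1)) = q * ecoef j (wt i) * (mu i * xdown i (j - 1))"
  "xup i j * ecoef (j - 1) (wt (Suc i)) = q * ecoef j (wt i) * xup i (j - 1)"
proof -
  define s where "s = wt i"
  define S where "S = q ^ (2 * (j - 1))"
  have nz: "s \<noteq> 0" "S \<noteq> 0" using wt_nz q_nz by (simp_all add: s_def S_def)
  show "mu i * xdown i j * ecoef j (wt (i - 1)) = q * ecoef j (wt i) * (mu i * xdown i (j - 1))"
  proof (cases "i = 0 \<or> j = 0")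
    case False
    then have w: "wt (i - 1) = q * s" using q_nz by (cases i) (simp_all add: s_def wt_Suc)
    have S: "q ^ (2 * j) = q * q * S" using False by (cases j) (simp_all add: S_def mult.assoc)
    have "xdown i j * ecoef j (q * s) = q * ecoef j s * xdown i (j - 1)"
      unfolding xdown_def s_def[symmetric] S S_def[symmetric] dq_eq
      using nz q_nz qq by (simp add: ecoef_eq S divide_simps) (simp add: algebra_simps)
    then show ?thesis unfolding w s_def[symmetric] by simp
  qed auto
  show "xup i j * ecoef (j - 1) (wt (Suc i)) = q * ecoef j (wt i) * xup i (j - 1)"
  proof (cases "j = 0")
    case False
    then have S: "q ^ (2 * j) = q * q * S" by (cases j) (simp_all add: S_def mult.assoc)
    have sq: "s / q \<noteq> 0" using nz q_nz by simp
    show ?thesis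
      unfolding xup_def wt_Suc s_def[symmetric] dq_eq ecoef_eq[OF nz(1)] ecoef_eq[OF sq]
        S S_def[symmetric]
      using nz q_nz qq
      by (simp add: divide_simps) (simp add: algebra_simps)
  qed simp
qed

lemma EY_coefs:
  "ecoef j (wt (Suc i)) = inverse q * ecoef j (wt i) - xup i j"
  "mu i * ecoef (Suc j) (wt (i - 1)) = mu i * (xdown i j + inverse q * ecoef j (wt i))"
proof -
  define s where "s = wt i"
  define S where "S = q ^ (2 * j)"
  have nz: "s \<noteq> 0" "S \<noteq> 0" using wt_nz q_nz by (simp_all add: s_def S_def)
  show "ecoef j (wt (Suc i)) = inverse q * ecoef j (wt i) - xup i j"
    unfolding xup_def wt_Suc s_def[symmetric] S_def[symmetric] dq_eq
    using nz q_nz qq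
    by (simp add: ecoef_eq S_def[symmetric] divide_simps) (simp add: algebra_simps)
  show "mu i * ecoef (Suc j) (wt (i - 1)) = mu i * (xdown i j + inverse q * ecoef j (wt i))"
  proof (cases "i = 0")
    case False
    then have w: "wt (i - 1) = q * s" using q_nz by (cases i) (simp_all add: s_def wt_Suc)
    have S: "q ^ (2 * Suc j) = q * q * S" by (simp add: S_def mult.assoc)
    have "ecoef (Suc j) (q * s) = xdown i j + inverse q * ecoef j s"
      unfolding xdown_def s_def[symmetric] S_def[symmetric] dq_eq
      using nz q_nz qq unfolding ecoef_eq[OF nz(1)] ecoef_eq[of "q * s"] S S_def[symmetric]
      by (simp add: ecoef_eq S[simplified] S_def[symmetric] divide_simps) (simp add: algebra_simps)
    then show ?thesis unfolding w s_def[symmetric] by simp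
  qed simp
qed

lemma FX_coefs:
  "xdown i j = q ^ (2 * j) / wt i + xdown i (Suc j)"
  "xup i (Suc j) = xup i j + q ^ (2 * j) / wt i"
proof -
  have S: "q ^ (2 * Suc j) = q * q * q ^ (2 * j)" by (simp add: mult.assoc)
  show "xdown i j = q ^ (2 * j) / wt i + xdown i (Suc j)"
    unfolding xdown_def S dq_eq using wt_nz[of i] q_nz qq
    by (simp add: divide_simps) (simp add: algebra_simps)
  show "xup i (Suc j) = xup i j + q ^ (2 * j) / wt i"
    unfolding xup_def S dq_eq using wt_nz[of i] q_nz qq
    by (simp add: divide_simps) (simp add: algebra_simps)
qed

lemma KX_coefs:
  "q ^ (2 * j) / wt i * (mu i * xdown i j * (wt (i - 1) / q ^ (2 * j))) = q * (mu i * xdown i j)"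
  "q ^ (2 * j) / wt i * (xup i j * (wt (Suc i) / q ^ (2 * (j - 1)))) = q * xup i j"
  "q ^ (2 * j) / wt i * (wt (Suc i) / q ^ (2 * j)) = inverse q"
  "q ^ (2 * j) / wt i * (mu i * (wt (i - 1) / q ^ (2 * Suc j))) = inverse q * mu i"
proof -
  define S w where "S = q ^ (2 * j)" and "w = wt (i - 1)"
  have nz: "wt i \<noteq> 0" "S \<noteq> 0" using wt_nz q_nz by (simp_all add: S_def)
  have S: "q ^ (2 * Suc j) = q * q * S" by (simp add: S_def mult.assoc)
  have mw: "mu i * w = mu i * (q * wt i)" unfolding w_def by (rule mu_wt_pred)
  have "S / wt i * (mu i * xdown i j * (w / S)) = xdown i j * (mu i * w) / wt i"
    using nz by simp
  then show "q ^ (2 * j) / wt i * (mu i * xdown i j * (wt (i - 1) / q ^ (2 * j))) =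
      q * (mu i * xdown i j)"
    unfolding mw S_def[symmetric] w_def[symmetric] using nz by (simp add: mult_ac)
  show "q ^ (2 * j) / wt i * (xup i j * (wt (Suc i) / q ^ (2 * (j - 1)))) = q * xup i j"
  proof (cases j)
    case (Suc k)
    then have "q ^ (2 * j) = q * q * q ^ (2 * (j - 1))" by (simp add: mult.assoc)
    then show ?thesis using nz q_nz by (simp add: wt_Suc)
  qed simp
  show "q ^ (2 * j) / wt i * (wt (Suc i) / q ^ (2 * j)) = inverse q"
    unfolding S_def[symmetric] using nz q_nz by (simp add: wt_Suc field_simps)
  have "S / wt i * (mu i * (w / (q * q * S))) = mu i * w / (wt i * (q * q))"
    using nz by simp
  then show "q ^ (2 * j) / wt i * (mu i * (wt (i - 1) / q ^ (2 * Suc j))) = inverse q * mu i"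
    unfolding mw S S_def[symmetric] w_def[symmetric] using nz q_nz by (simp add: field_simps)
qed

lemma XY_coefs:
  "q * (mu i * xdown i j * mu (i - 1)) = mu i * (mu (i - 1) * xdown (i - 1) (Suc j))"
  "q * xup i j = xup (Suc i) j"
  "q * (mu i * xdown i j) - q * (xup i j * mu (Suc i)) -
     mu (Suc i) * xdown (Suc i) j + mu i * xup (i - 1) (Suc j) = cs i"
proof -
  define s where "s = wt i"
  define S where "S = q ^ (2 * j)"
  have nz: "s \<noteq> 0" "S \<noteq> 0" using wt_nz q_nz by (simp_all add: s_def S_def)
  have S: "q ^ (2 * Suc j) = q * q * S" by (simp add: S_def mult.assoc)
  have w: "wt (i - 1) = q * s" if "i > 0" using that q_nz by (cases i) (simp_all add: s_def wt_Suc)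
  show "q * (mu i * xdown i j * mu (i - 1)) = mu i * (mu (i - 1) * xdown (i - 1) (Suc j))"
  proof (cases "i = 0")
    case False
    then have "q * xdown i j = xdown (i - 1) (Suc j)"
      unfolding xdown_def w[OF False[unfolded neq0_conv]] S s_def[symmetric] S_def[symmetric] dq_eq
      using nz q_nz qq by (simp add: divide_simps)
    then show ?thesis by (simp add: mult_ac)
  qed simp
  show "q * xup i j = xup (Suc i) j"
    unfolding xup_def wt_Suc using q_nz dq_nz wt_nz[of i]
    by (simp add: divide_simps)
  have 1: "q * xup i j + xdown (Suc i) j = qbrace q s"
    unfolding xup_def xdown_def wt_Suc s_def[symmetric] S_def[symmetric] dq_eq
    using nz q_nz qq by (simp add: qbrace_eq divide_simps) (simp add: algebra_simps)
  have 2: "mu i * (q * xdown i j + xup (i - 1) (Suc j)) = mu i * qbrace q (q ^ 2 * s)"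
  proof (cases "i = 0")
    case False
    have "q * xdown i j + xup (i - 1) (Suc j) = qbrace q (q * q * s)"
      unfolding xup_def xdown_def w[OF False[unfolded neq0_conv]] S s_def[symmetric]
        S_def[symmetric] dq_eq
      using nz q_nz qq by (simp add: qbrace_eq divide_simps) (simp add: algebra_simps)
    then show ?thesis by (simp add: power2_eq_square)
  qed simp
  have 3: "mu (Suc i) * qbrace q s = mu i * qbrace q (q ^ 2 * s) - cs i"
    using lam_eq[of "Suc i"] lam_Suc_mu[of i] q_nz by (simp add: wt_Suc s_def)
  show "q * (mu i * xdown i j) - q * (xup i j * mu (Suc i)) -
     mu (Suc i) * xdown (Suc i) j + mu i * xup (i - 1) (Suc j) = cs i"
  proof -
    have "q * (mu i * xdown i j) - q * (xup i j * mu (Suc i)) -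
       mu (Suc i) * xdown (Suc i) j + mu i * xup (i - 1) (Suc j) =
       mu i * (q * xdown i j + xup (i - 1) (Suc j)) - mu (Suc i) * (q * xup i j + xdown (Suc i) j)"
      by (simp add: algebra_simps)
    also have "\<dots> = cs i" unfolding 1 2 3 by simp
    finally show ?thesis .
  qed
qed

text \<open>The relations of the quantum group hold row by row. In the relation of X and Y the central
  element acts on a row by the scalar cs, which is what the recursion for lam provides.\<close>

lemma osc_rels_hold:
  assumes "p \<in> osc_rels q C"
  shows "act osc_op p v = 0"
proof -
  note sim = act_simps act_one act_free_gen act_free_scal act_mult[OF lin_osc_op]
    free_scal_mult osc_lin_simps fs.scale_right_distrib fs.scale_right_diff_distrib
  consider p' where "p = free_map Usl p'" "p' \<in> usl_rels q"
    | "p = oE * oX - free_scal q * oX * oE"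
    | "p = oE * oY - (oX + free_scal (inverse q) * oY * oE)"
    | "p = oF * oX - (oY * oKi + oX * oF)"
    | "p = oF * oY - oY * oF"
    | "p = oK * oX * oKi - free_scal q * oX"
    | "p = oK * oY * oKi - free_scal (inverse q) * oY"
    | c where "p = free_scal q * oY * oX - oX * oY - free_map Usl c" "c \<in> C"
    using assms unfolding osc_rels_def Let_def by blast
  then show ?thesis
  proof cases
    case 1
    have "act osc_op p (bv (i, j)) = act osc_op 0 (bv (i, j))" for i j
      using act_row[of i p' "bv j"] verma_rels[OF wt_nz 1(2)] 1(1)
      by (simp add: fsp.linear_0[OF lin_row] act_simps)
    from act_osc_eqI[OF this] show ?thesis by (simp add: act_simps)
  next
    case 2
    show ?thesis unfolding 2
    proof (rule osc_rel_eqI)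
      show "act osc_op (oE * oX) (bv (i, j)) = act osc_op (free_scal q * oX * oE) (bv (i, j))" for i j
        by (simp add: sim mult.assoc EX_coefs[unfolded mult.assoc One_nat_def])
    qed
  next
    case 3
    show ?thesis unfolding 3
    proof (rule osc_rel_eqI)
      show "act osc_op (oE * oY) (bv (i, j)) = act osc_op (oX + free_scal (inverse q) * oY * oE) (bv (i, j))" for i j
      proof -
        have "(inverse q * (mu i * ecoef j (wt i))) *\<^sub>s bv (i - Suc 0, Suc (j - Suc 0)) =
            (inverse q * (mu i * ecoef j (wt i))) *\<^sub>s (bv (i - Suc 0, j) :: nat \<times> nat \<Rightarrow>\<^sub>0 'k)"
          by (cases j) simp_all
        then show ?thesis
          by (simp add: sim EY_coefs[unfolded One_nat_def] fs.scale_left_distrib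
              fs.scale_left_diff_distrib algebra_simps del: fs.scale_cancel_left)
      qed
    qed
  next
    case 4
    show ?thesis unfolding 4
    proof (rule osc_rel_eqI)
      show "act osc_op (oF * oX) (bv (i, j)) = act osc_op (oY * oKi + oX * oF) (bv (i, j))" for i j
      proof -
        have "mu i * xdown i j = q ^ (2 * j) / wt i * mu i + mu i * xdown i (Suc j)"
          using FX_coefs(1)[of i j] by (simp add: algebra_simps)
        then show ?thesis
          using FX_coefs(2)[of i j] xup_pred[of i j "Suc i"]
          by (simp add: sim fs.scale_left_distrib del: FX_coefs)
      qed
    qed
  next
    case 5
    show ?thesis unfolding 5 by (rule osc_rel_eqI) (simp add: sim)
  next
    case 6
    show ?thesis unfolding 6
    proof (rule osc_rel_eqI)
      show "act osc_op (oK * oX * oKi) (bv (i, j)) = act osc_op (free_scal q * oX) (bv (i, j))" for i j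
        by (simp only: sim osc_op_bv fs.scale_scale mult.assoc KX_coefs[unfolded mult.assoc])
    qed
  next
    case 7
    show ?thesis unfolding 7
    proof (rule osc_rel_eqI)
      show "act osc_op (oK * oY * oKi) (bv (i, j)) = act osc_op (free_scal (inverse q) * oY) (bv (i, j))" for i j
        by (simp only: sim osc_op_bv fs.scale_scale mult.assoc KX_coefs[unfolded mult.assoc])
    qed
  next
    case 8
    have cC: "pres_class (usl_rels q) c = C"
    proof -
      obtain c' where c': "C = pres_class (usl_rels q) c'"
        using C by (auto simp: ring_center_def usl_def carrier_pres_alg)
      then show ?thesis using 8(2) by (simp add: pres_class_eq_iff) (simp add: pres_class_eq_set)
    qed
    show ?thesis unfolding 8(1)
    proof (rule osc_rel_eqI)
      fix i j
      have c: "act osc_op (free_map Usl c) (bv (i, j)) = cs i *\<^sub>s bv (i, j)"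
        using act_row[of i c "bv j"] central_acts_by_scalar[OF wt_nz, of c i "bv j"] C
        by (simp add: cC cs_def fsp.linear_scale[OF lin_row])
      let ?P = "bv (i, j) :: nat \<times> nat \<Rightarrow>\<^sub>0 'k" and ?Q = "bv (i - 1 - 1, Suc j) :: nat \<times> nat \<Rightarrow>\<^sub>0 'k"
        and ?R = "bv (Suc (Suc i), j - 1) :: nat \<times> nat \<Rightarrow>\<^sub>0 'k"
      have yx: "act osc_op (free_scal q * oY * oX) (bv (i, j)) =
          (q * (mu i * xdown i j * mu (i - 1))) *\<^sub>s ?Q - (q * xup i j) *\<^sub>s ?R +
          ((q * (mu i * xdown i j)) *\<^sub>s ?P - (q * (xup i j * mu (Suc i))) *\<^sub>s ?P)"
        by (cases i; cases j) (simp_all add: sim algebra_simps del: power_Suc lam.simps)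
      have xy: "act osc_op (oX * oY) (bv (i, j)) =
          (mu i * (mu (i - 1) * xdown (i - 1) (Suc j))) *\<^sub>s ?Q - xup (Suc i) j *\<^sub>s ?R +
          ((mu (Suc i) * xdown (Suc i) j) *\<^sub>s ?P - (mu i * xup (i - 1) (Suc j)) *\<^sub>s ?P)"
        by (cases i; cases j) (simp_all add: sim algebra_simps del: power_Suc lam.simps)
      show "act osc_op (free_scal q * oY * oX - oX * oY) (bv (i, j)) = act osc_op (free_map Usl c) (bv (i, j))"
        unfolding c act_simps(2) yx xy XY_coefs(1,2) XY_coefs(3)[of i j, symmetric]
        by (simp add: fs.scale_left_distrib fs.scale_left_diff_distrib)
    qed
  qed
qed


text \<open>An operator X with XF = FX - YK' moves past a power of F at the cost of a geometric sum.\<close>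

lemma X_F_power:
  assumes "uq_ops q E F K Ki" and "lin Xop" "lin Y"
    and FX: "\<And>v. F (Xop v) = Y (Ki v) + Xop (F v)" and FY: "\<And>v. F (Y v) = Y (F v)"
  shows "Xop ((F ^^ j) v) = (F ^^ j) (Xop v) - ((q ^ (2 * j) - 1) / (q * dq)) *\<^sub>s (F ^^ (j - 1)) (Y (Ki v))"
proof -
  interpret uq_ops q E F K Ki by (rule assms(1))
  have Y_pow: "(F ^^ j) (Y v) = Y ((F ^^ j) v)" for j v
    by (induction j) (simp_all add: FY)
  show ?thesis
  proof (induction j)
    case 0
    show ?case by simp
  next
    case (Suc j)
    define S where "S = q ^ (2 * j)"
    have F1: "((S - 1) / (q * dq)) *\<^sub>s F ((F ^^ (j - Suc 0)) w) = ((S - 1) / (q * dq)) *\<^sub>s (F ^^ j) w" for w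
      by (cases j) (simp_all add: S_def)
    have S: "q ^ (2 * Suc j) = q * q * S" by (simp add: S_def mult.assoc)
    have c: "(q * q * S - 1) / (q * dq) = (S - 1) / (q * dq) + S"
    proof -
      have "q * q = q * dq + 1" using dq_mult by (simp add: power2_eq_square)
      then show ?thesis using dq_nz q_nz by (simp add: field_simps)
    qed
    have "Xop ((F ^^ Suc j) v) = F (Xop ((F ^^ j) v)) - Y (Ki ((F ^^ j) v))"
      using FX[of "(F ^^ j) v"] by (simp add: algebra_simps)
    also have "Y (Ki ((F ^^ j) v)) = S *\<^sub>s (F ^^ j) (Y (Ki v))"
      by (simp add: Ki_F_power fsp.linear_scale[OF assms(3)] Y_pow S_def)
    also have "F (Xop ((F ^^ j) v)) = (F ^^ Suc j) (Xop v) - ((S - 1) / (q * dq)) *\<^sub>s (F ^^ j) (Y (Ki v))"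
      unfolding Suc.IH S_def[symmetric] by (simp add: lin_simps F1 del: fs.scale_cancel_left)
    also have "\<dots> - S *\<^sub>s (F ^^ j) (Y (Ki v)) = (F ^^ Suc j) (Xop v) -
        ((q * q * S - 1) / (q * dq)) *\<^sub>s (F ^^ j) (Y (Ki v))"
      unfolding c by (simp add: fs.scale_left_distrib)
    finally show ?case unfolding S by simp
  qed
qed

text \<open>In any representation, the vectors zeta built from a maximal vector by the recursion are
  U-maximal and behave like the first column of the concrete module, and the powers of F fill in
  the rows. The last assumption is the relation for X and Y, with the central element already
  replaced by its scalar on a U-maximal vector.\<close>

lemma osc_intertwine:
  fixes \<rho> :: "osc_gen \<Rightarrow> ('i \<Rightarrow>\<^sub>0 'k) \<Rightarrow> ('i \<Rightarrow>\<^sub>0 'k)" and \<zeta> :: "nat \<Rightarrow> ('i \<Rightarrow>\<^sub>0 'k)"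
  assumes ops: "uq_ops q (\<rho> (Usl gE)) (\<rho> (Usl gF)) (\<rho> (Usl gK)) (\<rho> (Usl gKi))"
    and linXY: "lin (\<rho> gX)" "lin (\<rho> gY)"
    and EY: "\<And>v. \<rho> (Usl gE) (\<rho> gY v) = \<rho> gX v + inverse q *\<^sub>s \<rho> gY (\<rho> (Usl gE) v)"
    and FX: "\<And>v. \<rho> (Usl gF) (\<rho> gX v) = \<rho> gY (\<rho> (Usl gKi) v) + \<rho> gX (\<rho> (Usl gF) v)"
    and FY: "\<And>v. \<rho> (Usl gF) (\<rho> gY v) = \<rho> gY (\<rho> (Usl gF) v)"
    and KY: "\<And>v. \<rho> (Usl gK) (\<rho> gY v) = inverse q *\<^sub>s \<rho> gY (\<rho> (Usl gK) v)"
    and KiY: "\<And>v. \<rho> (Usl gKi) (\<rho> gY v) = q *\<^sub>s \<rho> gY (\<rho> (Usl gKi) v)"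
    and \<zeta>_0: "\<rho> (Usl gE) (\<zeta> 0) = 0" "\<rho> gX (\<zeta> 0) = 0" "\<rho> (Usl gK) (\<zeta> 0) = r *\<^sub>s \<zeta> 0"
      "\<rho> (Usl gKi) (\<zeta> 0) = inverse r *\<^sub>s \<zeta> 0"
    and \<zeta>_Suc: "\<And>i. \<zeta> (Suc i) = \<rho> gY (\<zeta> i) - mu i *\<^sub>s \<rho> (Usl gF) (\<zeta> (i - 1))"
    and XY: "\<And>i. \<rho> (Usl gE) (\<zeta> i) = 0 \<Longrightarrow> \<rho> (Usl gK) (\<zeta> i) = wt i *\<^sub>s \<zeta> i \<Longrightarrow>
      \<rho> (Usl gKi) (\<zeta> i) = inverse (wt i) *\<^sub>s \<zeta> i \<Longrightarrow>
      \<rho> gX (\<rho> gY (\<zeta> i)) = q *\<^sub>s \<rho> gY (\<rho> gX (\<zeta> i)) - cs i *\<^sub>s \<zeta> i"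
  shows "lin_ext (\<lambda>(i, j). (\<rho> (Usl gF) ^^ j) (\<zeta> i)) (osc_op g w) =
    \<rho> g (lin_ext (\<lambda>(i, j). (\<rho> (Usl gF) ^^ j) (\<zeta> i)) w)"
proof -
  define E F K Ki Xop Y where "E = \<rho> (Usl gE)" and "F = \<rho> (Usl gF)" and "K = \<rho> (Usl gK)"
    and "Ki = \<rho> (Usl gKi)" and "Xop = \<rho> gX" and "Y = \<rho> gY"
  note defs = E_def[symmetric] F_def[symmetric] K_def[symmetric] Ki_def[symmetric]
    Xop_def[symmetric] Y_def[symmetric]
  note EY = EY[unfolded defs] and FX = FX[unfolded defs] and FY = FY[unfolded defs]
    and KY = KY[unfolded defs] and KiY = KiY[unfolded defs] and \<zeta>_0 = \<zeta>_0[unfolded defs]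
    and \<zeta>_Suc = \<zeta>_Suc[unfolded defs] and XY = XY[unfolded defs] and linXY = linXY[unfolded defs]
  interpret uq_ops q E F K Ki using ops unfolding defs .
  note XY_simps = fsp.linear_add[OF linXY(1)] fsp.linear_diff[OF linXY(1)]
    fsp.linear_scale[OF linXY(1)] fsp.linear_0[OF linXY(1)] fsp.linear_add[OF linXY(2)]
    fsp.linear_diff[OF linXY(2)] fsp.linear_scale[OF linXY(2)] fsp.linear_0[OF linXY(2)]
  have \<zeta>: "E (\<zeta> i) = 0 \<and> K (\<zeta> i) = wt i *\<^sub>s \<zeta> i \<and> Ki (\<zeta> i) = inverse (wt i) *\<^sub>s \<zeta> i \<and>
      Xop (\<zeta> i) = lam i *\<^sub>s \<zeta> (i - 1)" for i
  proof (induction i rule: less_induct)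
    case (less i)
    show ?case
    proof (cases i)
      case 0
      then show ?thesis using \<zeta>_0 by (simp add: wt_def)
    next
      case (Suc n)
      define m where "m = n - 1"
      note IHn = less.IH[of n] and IHp = less.IH[of m]
      have n: "E (\<zeta> n) = 0" "K (\<zeta> n) = wt n *\<^sub>s \<zeta> n" "Ki (\<zeta> n) = inverse (wt n) *\<^sub>s \<zeta> n"
        "Xop (\<zeta> n) = lam n *\<^sub>s \<zeta> m"
        using IHn Suc by (auto simp: m_def)
      have p: "E (\<zeta> m) = 0" "K (\<zeta> m) = wt m *\<^sub>s \<zeta> m" "Ki (\<zeta> m) = inverse (wt m) *\<^sub>s \<zeta> m"
        "Xop (\<zeta> m) = lam m *\<^sub>s \<zeta> (m - 1)"
        using IHp Suc by (auto simp: m_def)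
      have \<zeta>S: "\<zeta> (Suc n) = Y (\<zeta> n) - mu n *\<^sub>s F (\<zeta> m)" by (simp add: \<zeta>_Suc m_def)
      have wp: "mu n * wt m = mu n * (q * wt n)" "mu n * inverse (wt m) = mu n * inverse (q * wt n)"
        using mu_wt_pred[of n] mu_wt_pred_inv[of n] unfolding m_def divide_inverse by blast+
      \<comment> \<open>mu is chosen such that E kills the new vector.\<close>
      have "E (\<zeta> (Suc n)) = lam n *\<^sub>s \<zeta> m - (inverse dq * (mu n * wt m - mu n * inverse (wt m))) *\<^sub>s \<zeta> m"
        by (simp add: \<zeta>S lin_simps EY EF n p XY_simps fs.scale_left_diff_distrib
            fs.scale_right_diff_distrib algebra_simps)
      also have "inverse dq * (mu n * wt m - mu n * inverse (wt m)) = lam n"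
        unfolding wp lam_eq[of n] by (simp add: qbrace_def dq_def divide_inverse algebra_simps)
      finally have E: "E (\<zeta> (Suc n)) = 0" by simp
      have "K (\<zeta> (Suc n)) = (inverse q * wt n) *\<^sub>s Y (\<zeta> n) - (inverse (q ^ 2) * (mu n * wt m)) *\<^sub>s F (\<zeta> m)"
        by (simp add: \<zeta>S lin_simps KY KF n p XY_simps mult_ac)
      also have "\<dots> = wt (Suc n) *\<^sub>s \<zeta> (Suc n)"
        unfolding wp using q_nz
        by (simp add: \<zeta>S wt_Suc fs.scale_right_diff_distrib power2_eq_square field_simps)
      finally have K: "K (\<zeta> (Suc n)) = wt (Suc n) *\<^sub>s \<zeta> (Suc n)" .
      have "Ki (\<zeta> (Suc n)) = (q * inverse (wt n)) *\<^sub>s Y (\<zeta> n) - (q ^ 2 * (mu n * inverse (wt m))) *\<^sub>s F (\<zeta> m)"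
        by (simp add: \<zeta>S lin_simps KiY KiF n p XY_simps mult_ac)
      also have "\<dots> = inverse (wt (Suc n)) *\<^sub>s \<zeta> (Suc n)"
        unfolding wp using q_nz
        by (simp add: \<zeta>S wt_Suc fs.scale_right_diff_distrib power2_eq_square field_simps)
      finally have Ki: "Ki (\<zeta> (Suc n)) = inverse (wt (Suc n)) *\<^sub>s \<zeta> (Suc n)" .
      have XFp: "Xop (F (\<zeta> m)) = lam m *\<^sub>s F (\<zeta> (m - 1)) - inverse (wt m) *\<^sub>s Y (\<zeta> m)"
        using FX[of "\<zeta> m"] by (simp add: p lin_simps XY_simps algebra_simps)
      have Yp: "mu n *\<^sub>s Y (\<zeta> m) = mu n *\<^sub>s \<zeta> n + (mu n * mu m) *\<^sub>s F (\<zeta> (m - 1))"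
        by (cases n) (simp_all add: \<zeta>_Suc m_def fs.scale_right_diff_distrib)
      have c1: "q * qbrace q (q * wt n) + inverse (q * wt n) = qbrace q (q ^ 2 * wt n)"
        using wt_nz[of n] q_nz qq
        by (simp add: qbrace_eq power2_eq_square divide_simps) (simp add: algebra_simps)
      have c2: "mu n * lam m = mu n * (mu m * qbrace q (q ^ 2 * wt n))"
        by (cases n) (use q_nz in \<open>simp_all add: lam_eq wt_Suc m_def power2_eq_square\<close>)
      \<comment> \<open>The terms with F cancel by c2, and c1 collects the rest into the recursion for lam.\<close>
      have "Xop (\<zeta> (Suc n)) = q *\<^sub>s Y (lam n *\<^sub>s \<zeta> m) - cs n *\<^sub>s \<zeta> n - mu n *\<^sub>s Xop (F (\<zeta> m))"
        using XY[of n] n by (simp add: \<zeta>S XY_simps)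
      also have "\<dots> = (q * lam n + mu n * inverse (wt m)) *\<^sub>s Y (\<zeta> m) - cs n *\<^sub>s \<zeta> n -
          (mu n * lam m) *\<^sub>s F (\<zeta> (m - 1))"
        by (simp add: XFp XY_simps fs.scale_left_distrib fs.scale_right_diff_distrib)
      also have "q * lam n + mu n * inverse (wt m) = qbrace q (q ^ 2 * wt n) * mu n"
        unfolding wp lam_eq[of n] c1[symmetric] by (simp add: algebra_simps)
      also have "(qbrace q (q ^ 2 * wt n) * mu n) *\<^sub>s Y (\<zeta> m) =
          qbrace q (q ^ 2 * wt n) *\<^sub>s (mu n *\<^sub>s \<zeta> n + (mu n * mu m) *\<^sub>s F (\<zeta> (m - 1)))"
        unfolding Yp[symmetric] by simp
      also have "\<dots> - cs n *\<^sub>s \<zeta> n - (mu n * lam m) *\<^sub>s F (\<zeta> (m - 1)) = lam (Suc n) *\<^sub>s \<zeta> n"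
        unfolding c2 lam_Suc_mu
        by (simp add: fs.scale_right_distrib fs.scale_left_diff_distrib mult_ac)
      finally have "Xop (\<zeta> (Suc n)) = lam (Suc n) *\<^sub>s \<zeta> n" .
      then show ?thesis using E K Ki by (simp add: Suc)
    qed
  qed
  have E1: "E (\<zeta> i) = 0" and K1: "K (\<zeta> i) = wt i *\<^sub>s \<zeta> i" and Ki1: "Ki (\<zeta> i) = inverse (wt i) *\<^sub>s \<zeta> i"
    and X1: "Xop (\<zeta> i) = lam i *\<^sub>s \<zeta> (i - 1)" for i
    using \<zeta> by auto
  have Y1: "Y (\<zeta> i) = \<zeta> (Suc i) + mu i *\<^sub>s F (\<zeta> (i - 1))" for i by (simp add: \<zeta>_Suc)
  have Y_pow: "Y ((F ^^ j) v) = (F ^^ j) (Y v)" for j v by (induction j) (simp_all add: FY[symmetric])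
  let ?T = "lin_ext (\<lambda>(i, j). (F ^^ j) (\<zeta> i))"
  note T = fsp.linear_add[OF lin_lin_ext] fsp.linear_diff[OF lin_lin_ext] fsp.linear_scale[OF lin_lin_ext]
  have lin\<rho>: "lin (\<rho> g)" for g
  proof (cases g)
    case (Usl x1)
    then show ?thesis
      by (cases x1) (use linE linF linK linKi in \<open>simp_all add: defs\<close>)
  qed (use linXY in \<open>simp_all add: defs\<close>)
  have bas: "?T (osc_op g (bv (i, j))) = \<rho> g (?T (bv (i, j)))" for i j
  proof (cases g rule: osc_op.cases)
    case 1
    then show ?thesis
      using E_F_power_maximal[OF E1 K1 Ki1] by (simp add: T defs)
  next
    case 2
    then show ?thesis by (simp add: defs)
  next
    case 3
    then show ?thesis by (simp add: T defs K_F_power K1 F_power_simps divide_inverse mult.commute)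
  next
    case 4
    then show ?thesis by (simp add: T defs Ki_F_power Ki1 F_power_simps divide_inverse mult.commute)
  next
    case 5
    define J where "J = (q ^ (2 * j) - 1) / (q * dq)"
    have F1: "J *\<^sub>s (F ^^ (j - 1)) (F v) = J *\<^sub>s (F ^^ j) v" for v
      by (cases j) (simp_all add: J_def funpow_swap1)
    have up: "xup i j = J * inverse (wt i)"
      by (simp add: xup_def J_def divide_inverse)
    have down: "xdown i j = qbrace q (q * wt i) - J * inverse (wt i)"
      unfolding xdown_def J_def dq_eq using wt_nz[of i] q_nz qq
      by (simp add: qbrace_eq divide_simps)
    have "Xop ((F ^^ j) (\<zeta> i)) = (F ^^ j) (Xop (\<zeta> i)) - J *\<^sub>s (F ^^ (j - 1)) (Y (Ki (\<zeta> i)))"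
      unfolding J_def by (rule X_F_power[OF uq_ops_axioms linXY FX FY])
    also have "\<dots> = lam i *\<^sub>s (F ^^ j) (\<zeta> (i - 1)) -
        inverse (wt i) *\<^sub>s J *\<^sub>s (F ^^ (j - 1)) (\<zeta> (Suc i) + mu i *\<^sub>s F (\<zeta> (i - 1)))"
      by (simp add: X1 Ki1 XY_simps F_power_simps Y1 mult.commute)
    also have "\<dots> = (lam i - inverse (wt i) * J * mu i) *\<^sub>s (F ^^ j) (\<zeta> (i - 1)) -
        (inverse (wt i) * J) *\<^sub>s (F ^^ (j - 1)) (\<zeta> (Suc i))"
      using F1[of "\<zeta> (i - 1)"]
      by (simp add: F_power_simps fs.scale_right_distrib fs.scale_left_diff_distrib
          del: fs.scale_scale fs.scale_cancel_left) (auto simp: mult_ac)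
    also have "lam i - inverse (wt i) * J * mu i = mu i * xdown i j"
      unfolding down lam_eq[of i] by (simp add: algebra_simps)
    finally show ?thesis using 5 by (simp add: T defs up mult.commute)
  next
    case 6
    then show ?thesis
      by (simp add: T defs Y_pow Y1 F_power_simps funpow_swap1)
  qed
  have "?T (osc_op g w) = \<rho> g (?T w)"
  proof (rule lin_eqI[where f = "\<lambda>w. ?T (osc_op g w)", OF lin_comp[OF lin_lin_ext lin_osc_op]
        lin_comp[OF lin\<rho> lin_lin_ext]])
    show "?T (osc_op g (bv x)) = \<rho> g (?T (bv x))" for x using bas by (cases x) simp
  qed
  then show ?thesis unfolding defs .
qed


lemma osc_rels_in_ideal:
  "oK * oKi - 1 \<in> osc_ideal"
  "oKi * oK - 1 \<in> osc_ideal"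
  "oK * oE * oKi - q ^ 2 *\<^sub>s oE
     \<in> osc_ideal"
  "oK * oF * oKi - inverse (q ^ 2) *\<^sub>s oF
     \<in> osc_ideal"
  "oE * oF - oF * oE -
     inverse (q - inverse q) *\<^sub>s (oK - oKi) \<in> osc_ideal"
  "oE * oY - (oX + inverse q *\<^sub>s (oY * oE))
     \<in> osc_ideal"
  "oF * oX - (oY * oKi + oX * oF)
     \<in> osc_ideal"
  "oF * oY - oY * oF \<in> osc_ideal"
  "oK * oY * oKi - inverse q *\<^sub>s oY
     \<in> osc_ideal"
  "c \<in> C \<Longrightarrow> oX * oY - (q *\<^sub>s (oY * oX) - free_map Usl c)
     \<in> osc_ideal"
proof -
  note sub = subsetD[OF rels_subset_pres_ideal[of "osc_rels q C"]]
  have U: "free_map Usl p \<in> osc_ideal" if "p \<in> usl_rels q" for p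
    by (rule sub) (use that in \<open>auto simp: osc_rels_def Let_def\<close>)
  note U' = U[unfolded usl_rels_def Let_def free_scal_mult]
  note fm = free_map_simps free_map_mult
  show "oK * oKi - 1 \<in> osc_ideal"
    using U'[of "free_gen gK * free_gen gKi - 1"] by (simp add: fm)
  show "oKi * oK - 1 \<in> osc_ideal"
    using U'[of "free_gen gKi * free_gen gK - 1"] by (simp add: fm)
  show "oK * oE * oKi - q ^ 2 *\<^sub>s oE \<in> osc_ideal"
    using U'[of "free_gen gK * free_gen gE * free_gen gKi - q ^ 2 *\<^sub>s free_gen gE"] by (simp add: fm)
  show "oK * oF * oKi -
      inverse (q ^ 2) *\<^sub>s oF \<in> osc_ideal"
    using U'[of "free_gen gK * free_gen gF * free_gen gKi - inverse (q ^ 2) *\<^sub>s free_gen gF"]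
    by (simp add: fm)
  show "oE * oF - oF * oE -
     inverse (q - inverse q) *\<^sub>s (oK - oKi) \<in> osc_ideal"
    using U'[of "free_gen gE * free_gen gF - free_gen gF * free_gen gE -
      inverse (q - inverse q) *\<^sub>s (free_gen gK - free_gen gKi)"] by (simp add: fm)
  show "oE * oY - (oX + inverse q *\<^sub>s (oY * oE)) \<in> osc_ideal"
    by (rule sub) (unfold osc_rels_def Let_def free_scal_mult scale_mult_left, blast)
  show "oF * oX - (oY * oKi + oX * oF) \<in> osc_ideal"
    by (rule sub) (unfold osc_rels_def Let_def free_scal_mult scale_mult_left, blast)
  show "oF * oY - oY * oF \<in> osc_ideal"
    by (rule sub) (unfold osc_rels_def Let_def free_scal_mult scale_mult_left, blast)
  show "oK * oY * oKi - inverse q *\<^sub>s oY \<in> osc_ideal"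
    by (rule sub) (unfold osc_rels_def Let_def free_scal_mult scale_mult_left, blast)
  show "oX * oY - (q *\<^sub>s (oY * oX) - free_map Usl c) \<in> osc_ideal" if "c \<in> C"
  proof -
    have "q *\<^sub>s (oY * oX) - oX * oY - free_map Usl c \<in> osc_ideal"
      by (rule sub) (unfold osc_rels_def Let_def free_scal_mult scale_mult_left, use that in blast)
    from left_idealD(6)[OF left_ideal_pres_ideal this] show ?thesis by (simp add: algebra_simps)
  qed
qed

lemma two_step_recursion:
  obtains z :: "nat \<Rightarrow> 'b" where "z 0 = a" "\<And>i. z (Suc i) = f i (z i) (z (i - 1))"
proof -
  define w where "w = rec_nat (a, a) (\<lambda>i (x, y). (f i x y, x))"
  have snd: "snd (w i) = fst (w (i - 1))" for i
    by (cases i) (simp_all add: w_def split: prod.split)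
  show thesis
  proof (rule that[of "\<lambda>i. fst (w i)"])
    show "fst (w 0) = a" by (simp add: w_def)
    have "fst (w (Suc i)) = f i (fst (w i)) (snd (w i))" for i
      by (simp add: w_def split: prod.split)
    then show "fst (w (Suc i)) = f i (fst (w i)) (fst (w (i - 1)))" for i by (simp add: snd)
  qed
qed

text \<open>The recursion maps the concrete module to the quotient by the defining left ideal, so nothing
  else can annihilate the corner basis vector. This takes the place of a basis theorem for the
  oscillator algebra.\<close>

lemma annihilator_eq_left_span:
  "left_span (osc_rels q C) (oE) (oX) (oK - free_scal r) =
   {p. act osc_op p (bv (0, 0)) = 0}" (is "?L = ?Ann")
proof (rule subset_antisym)
  note sup = left_span_superset[where rels = "osc_rels q C" and ?g1.0 = "oE"
      and ?g2.0 = "oX" and ?g3.0 = "oK - free_scal r"]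
  show "?L \<subseteq> ?Ann"
    by (rule left_span_minimal[OF left_ideal_annihilator[OF lin_osc_op]])
      (use pres_ideal_annihilates[OF lin_osc_op osc_rels_hold] in
        \<open>auto simp: act_simps act_free_gen act_free_scal wt_def\<close>)
  show "?Ann \<subseteq> ?L"
  proof
    fix p assume "p \<in> ?Ann"
    then have p: "act osc_op p (bv (0, 0)) = 0" by simp
    obtain nf where nf: "lin nf" "\<And>p. nf p = 0 \<longleftrightarrow> p \<in> ?L" "\<And>p. p - nf p \<in> ?L"
      using exists_normal_form[OF left_ideal_subspace[OF left_ideal_left_span]] by blast
    interpret quotient_ops "osc_rels q C" ?L nf
      by (intro quotient_ops.intro nf left_ideal_left_span sup)
    define \<rho> where "\<rho> g z = nf (free_gen g * z)" for g z
    have ops: "uq_ops q (\<rho> (Usl gE)) (\<rho> (Usl gF)) (\<rho> (Usl gK)) (\<rho> (Usl gKi))"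
      unfolding \<rho>_def[abs_def]
      by (rule uq_ops_quotient[OF quantum_parameter_axioms osc_rels_in_ideal(1-5)])
    obtain \<zeta> where \<zeta>: "\<zeta> 0 = nf 1"
      "\<And>i. \<zeta> (Suc i) = \<rho> gY (\<zeta> i) - mu i *\<^sub>s \<rho> (Usl gF) (\<zeta> (i - 1))"
      by (rule two_step_recursion[of "nf 1" "\<lambda>i x y. \<rho> gY x - mu i *\<^sub>s \<rho> (Usl gF) y"]) blast
    have \<zeta>_nf: "nf (\<zeta> i) = \<zeta> i" for i
      by (cases i) (simp_all add: \<zeta> \<rho>_def nf_simps nf_nf)
    obtain c where c: "c \<in> C" "C = pres_class (usl_rels q) c"
      using C pres_class_self by (auto simp: ring_center_def usl_def carrier_pres_alg)
    have qi: "inverse q \<noteq> 0" using q_nz by simp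
    note ky = commute_up_to_scalar[OF osc_rels_in_ideal(1,2,9) qi]
    have one: "nf (oE) = 0" "nf (oX) = 0"
      using sup(2,3) nf(2) by simp_all
    note weight = weight_of_one[OF osc_rels_in_ideal(2) sup(4) r_nz]
    show "p \<in> ?L"
    proof (rule annihilator_subset[OF lin_lin_ext _ _ p])
      fix g v
      show "lin_ext (\<lambda>(i, j). (\<rho> (Usl gF) ^^ j) (\<zeta> i)) (osc_op g v) =
          nf (free_gen g * lin_ext (\<lambda>(i, j). (\<rho> (Usl gF) ^^ j) (\<zeta> i)) v)"
        unfolding \<rho>_def[symmetric]
      proof (rule osc_intertwine[OF ops])
        show "lin (\<rho> gX)" "lin (\<rho> gY)" unfolding \<rho>_def by (rule lin_nf_mult)+
        fix v
        show "\<rho> (Usl gE) (\<rho> gY v) = \<rho> gX v + inverse q *\<^sub>s \<rho> gY (\<rho> (Usl gE) v)"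
          using nf_rel[OF osc_rels_in_ideal(6), of v]
          by (simp add: \<rho>_def nf_absorb mult.assoc distrib_right scale_mult_left nf_simps)
        show "\<rho> (Usl gF) (\<rho> gX v) = \<rho> gY (\<rho> (Usl gKi) v) + \<rho> gX (\<rho> (Usl gF) v)"
          using nf_rel[OF osc_rels_in_ideal(7), of v]
          by (simp add: \<rho>_def nf_absorb mult.assoc distrib_right nf_simps)
        show "\<rho> (Usl gF) (\<rho> gY v) = \<rho> gY (\<rho> (Usl gF) v)"
          using nf_rel[OF osc_rels_in_ideal(8), of v] by (simp add: \<rho>_def nf_absorb mult.assoc)
        show "\<rho> (Usl gK) (\<rho> gY v) = inverse q *\<^sub>s \<rho> gY (\<rho> (Usl gK) v)"
          using nf_rel[OF ky(1), of v]
          by (simp add: \<rho>_def nf_absorb mult.assoc scale_mult_left nf_simps)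
        show "\<rho> (Usl gKi) (\<rho> gY v) = q *\<^sub>s \<rho> gY (\<rho> (Usl gKi) v)"
          using nf_rel[OF ky(2), of v]
          by (simp add: \<rho>_def nf_absorb mult.assoc scale_mult_left nf_simps)
      next
        show "\<rho> (Usl gE) (\<zeta> 0) = 0" "\<rho> gX (\<zeta> 0) = 0"
          using one by (simp_all add: \<rho>_def \<zeta>(1) nf_absorb)
        show "\<rho> (Usl gK) (\<zeta> 0) = r *\<^sub>s \<zeta> 0" "\<rho> (Usl gKi) (\<zeta> 0) = inverse r *\<^sub>s \<zeta> 0"
          unfolding \<rho>_def \<zeta>(1) using weight by blast+
        show "\<zeta> (Suc i) = \<rho> gY (\<zeta> i) - mu i *\<^sub>s \<rho> (Usl gF) (\<zeta> (i - 1))" for i by (rule \<zeta>(2))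
      next
        fix i assume max: "\<rho> (Usl gE) (\<zeta> i) = 0" "\<rho> (Usl gK) (\<zeta> i) = wt i *\<^sub>s \<zeta> i"
          "\<rho> (Usl gKi) (\<zeta> i) = inverse (wt i) *\<^sub>s \<zeta> i"
        \<comment> \<open>A U-maximal vector receives a Verma module of the quantum group, and with it the scalar.\<close>
        let ?T = "lin_ext (\<lambda>j. (\<rho> (Usl gF) ^^ j) (\<zeta> i))"
        have "?T (act (verma_op (wt i)) c (bv 0)) = act (\<lambda>g. \<rho> (Usl g)) c (?T (bv 0))"
          by (rule act_intertwine[where T = ?T and \<rho> = "verma_op (wt i)" and \<rho>' = "\<lambda>g. \<rho> (Usl g)",
                OF lin_lin_ext])
            (rule verma_intertwine[where \<rho> = "\<lambda>g. \<rho> (Usl g)", OF ops max])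
        then have "cs i *\<^sub>s \<zeta> i = act \<rho> (free_map Usl c) (\<zeta> i)"
          unfolding act_free_map central_acts_by_scalar[OF wt_nz C[unfolded c(2)]]
          by (simp add: fsp.linear_scale[OF lin_lin_ext] cs_def c(2)[symmetric])
        then have "cs i *\<^sub>s \<zeta> i = nf (free_map Usl c * \<zeta> i)"
          using act_nf[of "free_map Usl c" "\<zeta> i"] unfolding \<zeta>_nf \<rho>_def[abs_def] by simp
        then show "\<rho> gX (\<rho> gY (\<zeta> i)) = q *\<^sub>s \<rho> gY (\<rho> gX (\<zeta> i)) - cs i *\<^sub>s \<zeta> i"
          using nf_rel[OF osc_rels_in_ideal(10)[OF c(1)], of "\<zeta> i"]
          by (simp add: \<rho>_def nf_absorb mult.assoc scale_mult_left left_diff_distrib nf_simps)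
      qed
    qed (simp add: \<zeta>(1))
  qed
qed

lemma osc_verma_ideal_eq:
  "osc_verma_ideal q C r = pres_class (osc_rels q C) ` {p. act osc_op p (bv (0, 0)) = 0}"
  unfolding annihilator_eq_left_span[symmetric] image_left_span
  by (auto simp: osc_verma_ideal_def Let_def osc_def set_add_def set_mult_def r_coset_def
      carrier_pres_alg pres_alg_minus pres_alg_mult pres_alg_add)

definition rows :: "nat \<Rightarrow> (nat \<times> nat \<Rightarrow>\<^sub>0 'k) set" where
  "rows n = {v. \<forall>(i, j)\<in>supp v. n \<le> i}"

lemma subspace_rows: "fs.subspace (rows n)"
  unfolding fs.subspace_def
proof (intro conjI ballI allI)
  show "0 \<in> rows n" by (simp add: rows_def)
  fix u assume u: "u \<in> rows n"
  show "a *\<^sub>s u \<in> rows n" for a using u by (auto simp: rows_def in_keys_iff)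
  fix v assume "v \<in> rows n"
  then show "u + v \<in> rows n" using u keys_add[of u v] by (fastforce simp: rows_def)
qed

lemma bv_in_rows: "n \<le> i \<Longrightarrow> bv (i, j) \<in> rows n"
  by (simp add: rows_def)

lemma rows_expand:
  assumes "fs.subspace W" "\<And>i j. n \<le> i \<Longrightarrow> bv (i, j) \<in> W" "v \<in> rows n"
  shows "v \<in> W"
  by (subst bv_expansion)
    (use assms in \<open>auto simp: rows_def intro!: fs.subspace_sum[OF assms(1)] fs.subspace_scale[OF assms(1)]\<close>)

text \<open>Y adds the next U-maximal vector, up to a term in the row before the current one; at row n the
  factor mu n of that term is 0. The set D stands for the polynomials in Y and F.\<close>

lemma rows_reachable:
  assumes lam: "lam n = 0" and D1: "1 \<in> D"
    and D: "\<And>p s. p \<in> D \<Longrightarrow> s \<in> D \<Longrightarrow> p + s \<in> D" "\<And>a p. p \<in> D \<Longrightarrow> a *\<^sub>s p \<in> D"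
      "\<And>p. p \<in> D \<Longrightarrow> oY * p \<in> D" "\<And>p. p \<in> D \<Longrightarrow> oF * p \<in> D"
    and v: "v \<in> rows n"
  shows "\<exists>p\<in>D. act osc_op p (bv (n, 0)) = v"
proof -
  define W where "W = {act osc_op p (bv (n, 0)) | p. p \<in> D}"
  have W: "fs.subspace W"
    unfolding fs.subspace_def
  proof (intro conjI ballI allI)
    have "0 *\<^sub>s 1 \<in> D" by (rule D(2)[OF D1])
    moreover have "act osc_op (0 *\<^sub>s 1) (bv (n, 0)) = 0" by (simp add: act_simps)
    ultimately show "0 \<in> W" unfolding W_def by (metis (mono_tags, lifting) mem_Collect_eq)
    fix u assume "u \<in> W"
    then obtain p where p: "p \<in> D" "u = act osc_op p (bv (n, 0))" by (auto simp: W_def)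
    show "a *\<^sub>s u \<in> W" for a
      unfolding p(2) act_simps(4)[symmetric] W_def using D(2)[OF p(1)] by blast
    fix v assume "v \<in> W"
    then obtain s where s: "s \<in> D" "v = act osc_op s (bv (n, 0))" by (auto simp: W_def)
    show "u + v \<in> W"
      unfolding p(2) s(2) act_simps(1)[symmetric] W_def using D(1)[OF p(1) s(1)] by blast
  qed
  have gen: "osc_op g u \<in> W" if "u \<in> W" "g = gY \<or> g = Usl gF" for g u
  proof -
    obtain p where p: "p \<in> D" "u = act osc_op p (bv (n, 0))" using \<open>u \<in> W\<close> by (auto simp: W_def)
    have "osc_op g u = act osc_op (free_gen g * p) (bv (n, 0))"
      by (simp add: p(2) act_mult[OF lin_osc_op] act_free_gen)
    moreover have "free_gen g * p \<in> D" using that(2) D(3,4) p(1) by blast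
    ultimately show ?thesis unfolding W_def by blast
  qed
  have F: "bv (i, j) \<in> W" if "bv (i, 0) \<in> W" for i j
  proof (induction j)
    case (Suc j)
    then show ?case using gen[of "bv (i, j)" "Usl gF"] by simp
  qed (rule that)
  have "bv (n + i, 0) \<in> W" for i
  proof (induction i rule: less_induct)
    case (less i)
    show ?case
    proof (cases i)
      case 0
      have "bv (n, 0) = act osc_op 1 (bv (n, 0))" by (simp add: act_one)
      then show ?thesis using D1 0 unfolding W_def by auto
    next
      case (Suc k)
      have 1: "osc_op gY (bv (n + k, 0)) \<in> W" by (rule gen) (use less.IH[of k] Suc in auto)
      have 2: "mu (n + k) *\<^sub>s bv (n + k - 1, 1) \<in> W"
      proof (cases k)
        case 0
        then show ?thesis using lam fs.subspace_0[OF W] by (simp add: mu_def)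
      next
        case (Suc l)
        then have "bv (n + l, 1) \<in> W" using F less.IH[of l] \<open>i = Suc k\<close> by simp
        then show ?thesis using Suc fs.subspace_scale[OF W] by simp
      qed
      show ?thesis using fs.subspace_diff[OF W 1 2] Suc by simp
    qed
  qed
  then have "bv (i, j) \<in> W" if "n \<le> i" for i j using F[of i j] that by (metis le_Suc_ex)
  from rows_expand[OF W this v] have "v \<in> W" .
  then show ?thesis by (auto simp: W_def)
qed

lemma osc_verma_realised:
  obtains \<Phi> where "realises (osc_rels q C) (osc_verma q C r) osc_op \<Phi>"
    "osc_verma_gen q C r \<in> carrier (osc_verma q C r)" "\<Phi> (osc_verma_gen q C r) = bv (0, 0)"
proof -
  let ?L = "{p. act osc_op p (bv (0, 0)) = 0}"
  have I: "osc_ideal \<subseteq> ?L"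
    using pres_ideal_annihilates[OF lin_osc_op osc_rels_hold] by auto
  have cyclic: "\<exists>p. act osc_op p (bv (0, 0)) = v" for v
    using rows_reachable[of 0 UNIV v] by (simp add: rows_def)
  obtain \<Phi> where \<Phi>: "realises (osc_rels q C)
      (quot_module (pres_alg (osc_rels q C)) (pres_class (osc_rels q C) ` ?L)) osc_op \<Phi>"
    "\<And>p. \<Phi> (quot_class (osc_rels q C) ?L p) = act osc_op p (bv (0, 0))"
    by (rule quot_module_realised[OF left_ideal_annihilator[OF lin_osc_op] I lin_osc_op _ cyclic])
       simp_all
  show thesis
  proof (rule that)
    show "realises (osc_rels q C) (osc_verma q C r) osc_op \<Phi>"
      using \<Phi>(1) unfolding osc_verma_def osc_verma_ideal_eq osc_def .
    have gen: "osc_verma_gen q C r = quot_class (osc_rels q C) ?L 1"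
      unfolding osc_verma_gen_def osc_verma_ideal_eq osc_def pres_alg_one
      by (rule quot_class_rcoset[OF left_ideal_annihilator[OF lin_osc_op] I])
    then show "osc_verma_gen q C r \<in> carrier (osc_verma q C r)"
      unfolding osc_verma_def osc_verma_ideal_eq osc_def
      using carrier_quot_module[OF left_ideal_annihilator[OF lin_osc_op] I] by auto
    show "\<Phi> (osc_verma_gen q C r) = bv (0, 0)" by (simp add: gen \<Phi>(2) act_one)
  qed
qed

end

section \<open>Submodules and maximal vectors\<close>

context osc_parameter
begin

lemma lookup_K: "coef (osc_op (Usl gK) v) (i, j) =
    wt i / q ^ (2 * j) * coef v (i, j)"
  using lookup_diagonal[of "\<lambda>(i, j). wt i / q ^ (2 * j)" v "(i, j)"]
  by (simp add: osc_op.simps(3) case_prod_unfold)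

lemma lookup_E: "coef (osc_op (Usl gE) v) (i, j) =
    ecoef (Suc j) (wt i) * coef v (i, Suc j)"
proof -
  have "coef (osc_op (Usl gE) v) (i, j) = (\<Sum>x\<in>supp v.
      if x = (i, Suc j) then ecoef (Suc j) (wt i) * coef v (i, Suc j) else 0)"
    unfolding osc_op.simps(1) lookup_lin_ext
  proof (rule sum.cong)
    fix x assume "x \<in> supp v"
    obtain i' j' where x: "x = (i', j')" by (cases x)
    show "coef v x *
        coef (case x of (i, j) \<Rightarrow> ecoef j (wt i) *\<^sub>s bv (i, j - 1)) (i, j) =
        (if x = (i, Suc j) then ecoef (Suc j) (wt i) * coef v (i, Suc j) else 0)"
      by (cases j') (auto simp: x lookup_single when_def)
  qed simp
  also have "\<dots> = ecoef (Suc j) (wt i) * coef v (i, Suc j)"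
    by (auto simp: in_keys_iff)
  finally show ?thesis .
qed

lemma lookup_E_power:
  "\<exists>c. c \<noteq> 0 \<and> coef ((osc_op (Usl gE) ^^ n) v) (i, j) = c * coef v (i, j + n)"
proof (induction n arbitrary: j)
  case 0
  show ?case by (intro exI[of _ 1]) simp
next
  case (Suc n)
  obtain c where "c \<noteq> 0" "coef ((osc_op (Usl gE) ^^ n) v) (i, Suc j) =
      c * coef v (i, Suc j + n)"
    using Suc.IH by blast
  then show ?case
    using ecoef_wt_nz[of j i] by (intro exI[of _ "ecoef (Suc j) (wt i) * c"]) (simp add: lookup_E)
qed

lemma stable_rows:
  assumes "lam n = 0"
  shows "stable osc_op (rows n)"
  unfolding stable_def
proof (intro conjI allI ballI subspace_rows)
  fix g v assume v: "v \<in> rows n"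
  have "osc_op g (bv (i, j)) \<in> rows n" if "n \<le> i" for i j
  proof -
    have mu: "a *\<^sub>s mu i *\<^sub>s bv (i - Suc 0, l) \<in> rows n" for a l
    proof (cases "i = n")
      case True
      then show ?thesis using assms fs.subspace_0[OF subspace_rows] by (simp add: mu_def)
    next
      case False
      then show ?thesis using that by (intro fs.subspace_scale[OF subspace_rows] bv_in_rows) auto
    qed
    note sub = fs.subspace_add[OF subspace_rows] fs.subspace_diff[OF subspace_rows]
      fs.subspace_scale[OF subspace_rows]
    show ?thesis
    proof (cases g rule: osc_op.cases)
      case 5
      have "(mu i * xdown i j) *\<^sub>s bv (i - 1, j) \<in> rows n" using mu[of "xdown i j" j] by (simp add: mult.commute)
      moreover have "xup i j *\<^sub>s bv (Suc i, j - 1) \<in> rows n" using that by (intro sub(3) bv_in_rows) simp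
      ultimately show ?thesis using 5 sub(2) by simp
    next
      case 6
      have "mu i *\<^sub>s bv (i - 1, Suc j) \<in> rows n" using mu[of 1 "Suc j"] by simp
      moreover have "bv (Suc i, j) \<in> rows n" using that by (intro bv_in_rows) simp
      ultimately show ?thesis using 6 sub(1) by simp
    qed (use that in \<open>auto intro!: sub(3) bv_in_rows\<close>)
  qed
  then have "coef v x *\<^sub>s osc_op g (bv x) \<in> rows n" if "x \<in> supp v" for x
  proof -
    obtain i j where x: "x = (i, j)" by (cases x)
    then have "n \<le> i" using that v by (auto simp: rows_def)
    with \<open>\<And>j i. n \<le> i \<Longrightarrow> osc_op g (bv (i, j)) \<in> rows n\<close> show ?thesis
      unfolding x by (intro fs.subspace_scale[OF subspace_rows])
  qed
  then show "osc_op g v \<in> rows n"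
    unfolding lin_expand[OF lin_osc_op, of g v] by (rule fs.subspace_sum[OF subspace_rows])
qed

text \<open>Subtracting a multiple of v from its image under K removes one basis vector of another weight
  and keeps the given one, as the weights r q^-m are distinct.\<close>

lemma stable_weight_part:
  assumes V: "stable osc_op V" and "v \<in> V" "(i, j) \<in> supp v"
  shows "\<exists>w\<in>V. (i, j) \<in> supp w \<and> (\<forall>(i', j')\<in>supp w. i' + 2 * j' = i + 2 * j)"
  using assms(2,3)
proof (induction "card (supp v)" arbitrary: v rule: less_induct)
  case less
  show ?case
  proof (cases "\<forall>(i', j')\<in>supp v. i' + 2 * j' = i + 2 * j")
    case True
    then show ?thesis using less.prems by blast
  next
    case False
    then obtain i' j' where y: "(i', j') \<in> supp v" "i' + 2 * j' \<noteq> i + 2 * j" by blast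
    define w where "w = osc_op (Usl gK) v - (wt i' / q ^ (2 * j')) *\<^sub>s v"
    have wtq: "wt a / q ^ (2 * b) = r / q ^ (a + 2 * b)" for a b by (simp add: wt_def power_add)
    have w: "coef w (a, b) = (wt a / q ^ (2 * b) - wt i' / q ^ (2 * j')) * coef v (a, b)"
      for a b by (simp add: w_def lookup_minus lookup_K left_diff_distrib)
    have wV: "w \<in> V"
      unfolding w_def using V less.prems(1)
      by (auto simp: stable_def intro!: fs.subspace_diff fs.subspace_scale)
    have "r / q ^ (i + 2 * j) \<noteq> r / q ^ (i' + 2 * j')"
      using y(2) r_nz q_nz q_power_eq_iff[of "i + 2 * j" "i' + 2 * j'"] by (simp add: divide_eq_eq eq_divide_eq)
    then have ij: "(i, j) \<in> supp w"
      using less.prems(2) unfolding in_keys_iff w wtq by simp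
    have "supp w \<subseteq> supp v" by (auto simp: in_keys_iff w)
    moreover have "(i', j') \<notin> supp w" unfolding in_keys_iff w by simp
    ultimately have "supp w \<subset> supp v" using y(1) by blast
    then have "card (supp w) < card (supp v)" by (intro psubset_card_mono) auto
    then show ?thesis using less.hyps wV ij by blast
  qed
qed

text \<open>In a weight space each row has at most one basis vector. The power of E that belongs to the
  largest j isolates the row with that j, because E kills no basis vector outside the first column:
  the Verma modules of the quantum group that occur here are simple.\<close>

lemma stable_weight_vector:
  assumes V: "stable osc_op V" and "v \<in> V"
    and "\<forall>(i, j)\<in>supp v. i + 2 * j = m" "(i, j) \<in> supp v"
  shows "bv (i, 0) \<in> V"
  using assms(2-4)
proof (induction "card (supp v)" arbitrary: v rule: less_induct)
  case less
  have sub: "fs.subspace V" and gen: "\<And>g u. u \<in> V \<Longrightarrow> osc_op g u \<in> V" using V by (auto simp: stable_def)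
  let ?J = "snd ` supp v"
  define b where "b = Max ?J"
  have fin: "finite ?J" "?J \<noteq> {}" using less.prems(3) by auto
  obtain a where ab: "(a, b) \<in> supp v"
    using Max_in[OF fin] unfolding b_def by fastforce
  have le: "j' \<le> b" if "(i', j') \<in> supp v" for i' j'
    unfolding b_def by (rule Max_ge[OF fin(1)]) (use that in force)
  have pow: "(osc_op g ^^ l) u \<in> V" if "u \<in> V" for g l u
    by (induction l) (use that gen in auto)
  obtain c where c: "c \<noteq> 0" "coef ((osc_op (Usl gE) ^^ b) v) (a, 0) = c * coef v (a, b)"
    using lookup_E_power[of b v a 0] by auto
  have "(osc_op (Usl gE) ^^ b) v = (c * coef v (a, b)) *\<^sub>s bv (a, 0)"
  proof (rule poly_mapping_eqI)
    fix x :: "nat \<times> nat"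
    obtain i' j' where x: "x = (i', j')" by (cases x)
    show "coef ((osc_op (Usl gE) ^^ b) v) x =
        coef ((c * coef v (a, b)) *\<^sub>s bv (a, 0)) x"
    proof (cases "x = (a, 0)")
      case True
      then show ?thesis using c by simp
    next
      case False
      have "(i', j' + b) \<notin> supp v"
      proof
        assume k: "(i', j' + b) \<in> supp v"
        then have "j' = 0" using le[OF k] by simp
        moreover have "i' + 2 * (j' + b) = m" "a + 2 * b = m" using less.prems(2) k ab by auto
        ultimately show False using False x by simp
      qed
      then show ?thesis
        using lookup_E_power[of b v i' j'] False by (auto simp: x in_keys_iff lookup_single when_def)
    qed
  qed
  then have "(c * coef v (a, b)) *\<^sub>s bv (a, 0) \<in> V" using pow[OF less.prems(1)] by metis
  then have "inverse (c * coef v (a, b)) *\<^sub>s (c * coef v (a, b)) *\<^sub>s bv (a, 0) \<in> V"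
    by (rule fs.subspace_scale[OF sub])
  moreover have "c * coef v (a, b) \<noteq> 0" using c(1) ab by (simp add: in_keys_iff)
  ultimately have a0: "bv (a, 0) \<in> V" by (metis fs.scale_scale left_inverse fs.scale_one)
  show ?case
  proof (cases "(i, j) = (a, b)")
    case True
    then show ?thesis using a0 by simp
  next
    case False
    have "(osc_op (Usl gF) ^^ l) (bv (a, 0)) = bv (a, l)" for l by (induction l) simp_all
    then have abV: "bv (a, b) \<in> V" using pow[OF a0] by metis
    define w where "w = v - coef v (a, b) *\<^sub>s bv (a, b)"
    have w: "coef w x = (if x = (a, b) then 0 else coef v x)" for x
      by (simp add: w_def lookup_minus lookup_single when_def)
    have keys: "supp w = supp v - {(a, b)}" by (auto simp: in_keys_iff w split: if_splits)
    show ?thesis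
    proof (rule less.hyps)
      show "card (supp w) < card (supp v)"
        unfolding keys using ab by (intro card_Diff1_less) auto
      show "w \<in> V" unfolding w_def by (intro fs.subspace_diff[OF sub] fs.subspace_scale[OF sub] less.prems abV)
      show "\<forall>(i, j)\<in>supp w. i + 2 * j = m" using less.prems(2) unfolding keys by auto
      show "(i, j) \<in> supp w" unfolding keys by (rule DiffI[OF less.prems(3)]) (use False in simp)
    qed
  qed
qed

lemma stable_bv:
  assumes V: "stable osc_op V" and "v \<in> V" "(i, j) \<in> supp v"
  shows "bv (i, 0) \<in> V"
proof -
  obtain w where w: "w \<in> V" "(i, j) \<in> supp w"
    "\<forall>(i', j')\<in>supp w. i' + 2 * j' = i + 2 * j"
    using stable_weight_part[OF assms] by blast
  show ?thesis by (rule stable_weight_vector[OF V w(1,3,2)])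
qed

lemma X_bv_0: "osc_op gX (bv (i, 0)) = lam i *\<^sub>s bv (i - 1, 0)"
  by (simp add: xdown_def lam_eq[of i] qbrace_def dq_def divide_inverse)

text \<open>A stable subspace with the U-maximal vector number i contains the one number i + 1, by way of
  Y, and the one number i - 1 unless X kills vector i. So it is cut out by the first row it meets.\<close>

lemma stable_classification:
  "stable osc_op V \<and> V \<noteq> {0} \<longleftrightarrow> (\<exists>n. lam n = 0 \<and> V = rows n)"
proof
  assume "stable osc_op V \<and> V \<noteq> {0}"
  then have V: "stable osc_op V" and ne: "V \<noteq> {0}" by auto
  have sub: "fs.subspace V" and gen: "\<And>g u. u \<in> V \<Longrightarrow> osc_op g u \<in> V" using V by (auto simp: stable_def)
  obtain v where v: "v \<in> V" "v \<noteq> 0" using ne fs.subspace_0[OF sub] by blast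
  then obtain x where "x \<in> supp v" by (metis all_not_in_conv keys_eq_empty)
  then have ex: "\<exists>i. bv (i, 0) \<in> V" using stable_bv[OF V v(1)] by (cases x) blast
  define n where "n = (LEAST i. bv (i, 0) \<in> V)"
  have n: "bv (n, 0) \<in> V" unfolding n_def by (rule LeastI_ex[OF ex])
  have min: "n \<le> i" if "bv (i, 0) \<in> V" for i unfolding n_def by (rule Least_le[of "\<lambda>i. bv (i, 0) \<in> V", OF that])
  have Suc: "bv (Suc i, 0) \<in> V" if "bv (i, 0) \<in> V" for i
  proof (rule stable_bv[OF V gen[OF that, of gY]])
    show "(Suc i, 0) \<in> supp (osc_op gY (bv (i, 0)))"
      by (simp add: in_keys_iff lookup_add lookup_single)
  qed
  have all: "bv (i, 0) \<in> V" if "n \<le> i" for i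
    using that by (induction rule: dec_induct) (simp_all add: n Suc)
  have "lam n = 0"
  proof (rule ccontr)
    assume l: "lam n \<noteq> 0"
    then have "n \<noteq> 0" by (metis lam.simps(1))
    have "lam n *\<^sub>s bv (n - 1, 0) \<in> V" using gen[OF n, of gX] unfolding X_bv_0 .
    then have "inverse (lam n) *\<^sub>s lam n *\<^sub>s bv (n - 1, 0) \<in> V" by (rule fs.subspace_scale[OF sub])
    then have "bv (n - 1, 0) \<in> V" using l by simp
    then show False using min[of "n - 1"] \<open>n \<noteq> 0\<close> by simp
  qed
  moreover have "V = rows n"
  proof (intro subset_antisym subsetI)
    fix w assume "w \<in> V"
    then show "w \<in> rows n" using stable_bv[OF V] min unfolding rows_def by blast
  next
    fix w assume w: "w \<in> rows n"
    have "bv (i, j) \<in> V" if "n \<le> i" for i j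
    proof (induction j)
      case (Suc j)
      then show ?case using gen[OF Suc, of "Usl gF"] by simp
    qed (rule all[OF that])
    then show "w \<in> V" using rows_expand[OF sub _ w] by blast
  qed
  ultimately show "\<exists>n. lam n = 0 \<and> V = rows n" by blast
next
  assume "\<exists>n. lam n = 0 \<and> V = rows n"
  then obtain n where n: "lam n = 0" "V = rows n" by blast
  have "bv (n, 0) \<in> V" unfolding n(2) by (rule bv_in_rows) simp
  then have "V \<noteq> {0}" by auto
  then show "stable osc_op V \<and> V \<noteq> {0}" using stable_rows[OF n(1)] n(2) by blast
qed

lemma rows_subset_iff: "rows m \<subseteq> rows n \<longleftrightarrow> n \<le> m"
proof
  assume "rows m \<subseteq> rows n"
  then have "bv (m, 0) \<in> rows n" using bv_in_rows[of m m 0] by blast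
  then show "n \<le> m" by (simp add: rows_def)
next
  assume "n \<le> m"
  then show "rows m \<subseteq> rows n" unfolding rows_def by fastforce
qed

lemma maximal_in_rows:
  "v \<noteq> 0 \<and> osc_op (Usl gE) v = 0 \<and> osc_op gX v = 0 \<and> osc_op (Usl gK) v = wt n *\<^sub>s v \<longleftrightarrow>
   lam n = 0 \<and> (\<exists>a. a \<noteq> 0 \<and> v = a *\<^sub>s bv (n, 0))"
proof
  assume v: "v \<noteq> 0 \<and> osc_op (Usl gE) v = 0 \<and> osc_op gX v = 0 \<and> osc_op (Usl gK) v = wt n *\<^sub>s v"
  define a where "a = coef v (n, 0)"
  have va: "v = a *\<^sub>s bv (n, 0)"
  proof (rule poly_mapping_eqI)
    fix x :: "nat \<times> nat"
    obtain i j where x: "x = (i, j)" by (cases x)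
    have "coef v (i, j) = 0" if "(i, j) \<noteq> (n, 0)"
    proof (cases j)
      case 0
      then have "i \<noteq> n" using that by simp
      then have "wt i \<noteq> wt n"
        using r_nz q_nz q_power_eq_iff[of i n] by (simp add: wt_def divide_eq_eq eq_divide_eq)
      moreover have "wt i / q ^ (2 * j) * coef v (i, j) = wt n * coef v (i, j)"
        using v lookup_K[of v i j] by simp
      ultimately show ?thesis using 0 by simp
    next
      case (Suc k)
      then show ?thesis using v lookup_E[of v i k] ecoef_wt_nz[of k i] by simp
    qed
    then show "coef v x = coef (a *\<^sub>s bv (n, 0)) x"
      by (auto simp: x a_def lookup_single when_def)
  qed
  have "a \<noteq> 0" using v va by auto
  moreover have "lam n = 0"
  proof -
    have "osc_op gX v = a *\<^sub>s lam n *\<^sub>s bv (n - 1, 0)"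
      unfolding va fsp.linear_scale[OF lin_osc_op] X_bv_0 ..
    then show ?thesis using v \<open>a \<noteq> 0\<close> by simp
  qed
  ultimately show "lam n = 0 \<and> (\<exists>a. a \<noteq> 0 \<and> v = a *\<^sub>s bv (n, 0))" using va by blast
next
  assume "lam n = 0 \<and> (\<exists>a. a \<noteq> 0 \<and> v = a *\<^sub>s bv (n, 0))"
  then obtain a where a: "lam n = 0" "a \<noteq> 0" "v = a *\<^sub>s bv (n, 0)" by blast
  have "osc_op gX v = 0" unfolding a(3) fsp.linear_scale[OF lin_osc_op] X_bv_0 a(1) by simp
  with a show "v \<noteq> 0 \<and> osc_op (Usl gE) v = 0 \<and> osc_op gX v = 0 \<and> osc_op (Usl gK) v = wt n *\<^sub>s v"
    by (simp add: osc_lin_simps mult.commute del: osc_op_bv(5))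
qed

text \<open>Multiplied by the brace of the weight, the recursion for lam telescopes to the sum alpha.\<close>

lemma lam_alpha: "lam n * qbrace q (q ^ 2 * wt n) = - alpha q C r (Suc n)"
proof (induction n)
  case 0
  show ?case by (simp add: alpha_def)
next
  case (Suc n)
  have w: "q ^ 2 * wt (Suc n) = q * wt n" using q_nz by (simp add: wt_Suc power2_eq_square)
  have "q powi (1 - int n) * r = q * wt n"
    using q_nz wt_powi[of n] power_int_add[of q 1 "- int n"] by (simp add: mult.assoc)
  then have a: "alpha q C r (Suc (Suc n)) = alpha q C r (Suc n) + qbrace q (q * wt n) * cs n"
    by (simp add: alpha_def cs_def wt_powi)
  have "lam (Suc n) * qbrace q (q * wt n) = lam n * qbrace q (q ^ 2 * wt n) - cs n * qbrace q (q * wt n)"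
    using qbrace_wt_nz[of n] by (cases "n = 0") (simp_all add: left_diff_distrib)
  then show ?case unfolding w a Suc.IH by (simp add: mult.commute)
qed

lemma alpha_eq_0: "lam n = 0 \<Longrightarrow> alpha q C r (Suc n) = 0"
  using lam_alpha[of n] by simp

text \<open>The factor of lam in the telescoped recursion vanishes only for n = 1 and r inverse to q up to
  sign. There alpha is 0 whatever the value of lam 1, which is the negative of the scalar of the
  central element.\<close>

lemma lam_eq_0:
  assumes "alpha q C r (Suc n) = 0"
    and "\<not> (n = 1 \<and> (r = inverse q \<or> r = - inverse q) \<and> c0 q C r \<noteq> 0)"
  shows "lam n = 0"
proof (cases "qbrace q (q ^ 2 * wt n) = 0")
  case False
  then show ?thesis using lam_alpha[of n] assms(1) by simp
next
  case True
  have "(q ^ 2 * wt n) ^ 2 = 1" using True wt_nz[of n] q_nz by (simp add: qbrace_eq_0_iff)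
  then have eq: "(q ^ 2 * r) ^ 2 = q ^ (2 * n)"
    using q_nz by (simp add: wt_def power_divide power_mult[symmetric] mult.commute)
  consider "n = 0" | "n = 1" | k where "n = Suc (Suc k)" by (cases n; cases "n - 1") auto
  then show ?thesis
  proof cases
    case 2
    have "(q * r) ^ 2 = 1"
      using eq q_nz 2 by (simp add: power_mult_distrib power2_eq_square mult_ac)
    then have "q * r = 1 \<or> q * r = - 1" by (simp add: power2_eq_1_iff)
    then have "r = inverse q \<or> r = - inverse q"
    proof
      assume "q * r = 1"
      then show ?thesis using q_nz by (simp add: field_simps)
    next
      assume "q * r = - 1"
      then have "q * (- r) = 1" by simp
      then have "- r = inverse q" using q_nz by (simp add: field_simps)
      then show ?thesis by (metis minus_minus)
    qed
    then have "c0 q C r = 0" using assms(2) 2 by blast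
    then show ?thesis using 2 by (simp add: cs_def wt_def)
  next
    case 3
    then have n: "2 * n = 4 + 2 * k" by simp
    have "q ^ 4 * r ^ 2 = q ^ (2 * n)"
      using eq by (simp add: power_mult_distrib power_mult[symmetric])
    then have "q ^ 4 * r ^ 2 = q ^ 4 * q ^ (2 * k)" unfolding n power_add .
    then show ?thesis using r_generic[of k] q_nz by simp
  qed simp
qed

lemma osc_parameter_wt: "osc_parameter q C (wt n)"
proof
  show "C \<in> ring_center (usl q)" by (rule C)
  show "wt n \<noteq> 0" by (rule wt_nz)
  fix m
  show "(wt n) ^ 2 \<noteq> q ^ (2 * m)"
  proof
    assume "(wt n) ^ 2 = q ^ (2 * m)"
    then have "r ^ 2 = q ^ (2 * (m + n))"
      using q_nz by (simp add: wt_def power_divide divide_eq_eq power_mult[symmetric] power_add[symmetric]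
          distrib_left mult.commute)
    then show False using r_generic by blast
  qed
qed

definition shift :: "'k \<Rightarrow> nat \<Rightarrow> (nat \<times> nat \<Rightarrow>\<^sub>0 'k) \<Rightarrow> (nat \<times> nat \<Rightarrow>\<^sub>0 'k)" where
  "shift a n = lin_ext (\<lambda>(i, j). a *\<^sub>s bv (n + i, j))"

lemma lin_shift: "lin (shift a n)"
  unfolding shift_def by (rule lin_lin_ext)

lemma shift_bv [simp]: "shift a n (bv (i, j)) = a *\<^sub>s bv (n + i, j)"
  by (simp add: shift_def)

text \<open>The recursion for lam at the weight number n starts with 0. As lam n = 0, it produces the values
  of lam from n on, so the rows from n on are the concrete Verma module of weight number n.\<close>

lemma shift_intertwine:
  assumes "lam n = 0"
  shows "shift a n (osc_parameter.osc_op q C (wt n) g v) = osc_op g (shift a n v)"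
proof -
  interpret T: osc_parameter q C "wt n" by (rule osc_parameter_wt)
  have w: "T.wt i = wt (n + i)" for i
    unfolding T.wt_def unfolding wt_def by (simp add: power_add)
  have lam: "T.lam i = lam (n + i)" for i
    by (induction i) (simp_all add: assms w T.cs_def cs_def)
  have mu: "T.mu i = mu (n + i)" for i by (simp add: T.mu_def mu_def lam w)
  have x: "T.xdown i j = xdown (n + i) j" "T.xup i j = xup (n + i) j" for i j
    by (simp_all add: T.xdown_def xdown_def T.xup_def xup_def w)
  have mu_n: "mu n = 0" using assms by (simp add: mu_def)
  note simps = fsp.linear_add[OF lin_shift] fsp.linear_diff[OF lin_shift] fsp.linear_neg[OF lin_shift]
    fsp.linear_scale[OF lin_shift] osc_lin_simps w mu x mu_n fs.scale_right_distrib
    fs.scale_right_diff_distrib mult_ac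
  show ?thesis
  proof (rule lin_eqI[where f = "\<lambda>v. shift a n (T.osc_op g v)" and g = "\<lambda>v. osc_op g (shift a n v)",
        OF lin_comp[OF lin_shift T.lin_osc_op] lin_comp[OF lin_osc_op lin_shift]])
    fix p :: "nat \<times> nat"
    obtain i j where p: "p = (i, j)" by (cases p)
    show "shift a n (T.osc_op g (bv p)) = osc_op g (shift a n (bv p))"
      unfolding p by (cases g rule: osc_op.cases; cases i) (simp_all add: simps)
  qed
qed

lemma lookup_shift:
  "coef (shift a n v) (n + i, j) = a * coef v (i, j)"
proof -
  have "coef (shift a n v) (n + i, j) =
      (\<Sum>x\<in>supp v. if x = (i, j) then a * coef v (i, j) else 0)"
    unfolding shift_def lookup_lin_ext
    by (rule sum.cong) (auto simp: lookup_single when_def split: if_splits)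
  then show ?thesis by (auto simp: in_keys_iff)
qed

lemma inj_shift:
  assumes "a \<noteq> 0"
  shows "inj (shift a n)"
proof (rule injI)
  fix u v
  assume eq: "shift a n u = shift a n v"
  have "a * coef u (i, j) = a * coef v (i, j)" for i j
    using arg_cong[OF eq, of "\<lambda>w. coef w (n + i, j)"] by (simp only: lookup_shift)
  then show "u = v" using assms by (intro poly_mapping_eqI) auto
qed

lemma range_shift:
  assumes "a \<noteq> 0"
  shows "range (shift a n) = rows n"
proof (intro subset_antisym subsetI)
  fix w assume "w \<in> range (shift a n)"
  then obtain v where "w = shift a n v" by blast
  then show "w \<in> rows n"
    by (auto simp: shift_def lin_ext_def intro!: fs.subspace_sum[OF subspace_rows]
        fs.subspace_scale[OF subspace_rows] bv_in_rows)
next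
  fix w assume w: "w \<in> rows n"
  have "fs.subspace (range (shift a n))" by (rule fsp.linear_subspace_image[OF lin_shift fs.subspace_UNIV])
  moreover have "bv (i, j) \<in> range (shift a n)" if "n \<le> i" for i j
    by (rule range_eqI[of _ _ "inverse a *\<^sub>s bv (i - n, j)"])
      (use assms that in \<open>simp add: fsp.linear_scale[OF lin_shift]\<close>)
  ultimately show "w \<in> range (shift a n)" using rows_expand[OF _ _ w] by blast
qed

lemma lookup_row: "coef (row i w) (i', j) = (if i' = i then coef w j else 0)"
proof -
  have "coef (row i w) (i', j) =
      (\<Sum>k\<in>supp w. if k = j then (if i' = i then coef w j else 0) else 0)"
    unfolding row_def lookup_lin_ext by (rule sum.cong) (auto simp: lookup_single when_def)
  then show ?thesis by (auto simp: in_keys_iff)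
qed

lemma inj_row: "inj (row i)"
proof (rule injI)
  fix u v assume "row i u = row i v"
  then have "coef u j = coef v j" for j
    using lookup_row[of i u i j] lookup_row[of i v i j] by simp
  then show "u = v" by (rule poly_mapping_eqI)
qed

lemma in_range_row_iff: "v \<in> range (row i) \<longleftrightarrow> (\<forall>i' j. i' \<noteq> i \<longrightarrow> coef v (i', j) = 0)"
proof
  assume "\<forall>i' j. i' \<noteq> i \<longrightarrow> coef v (i', j) = 0"
  moreover have "coef (Poly_Mapping.map_key (Pair i) v) j = coef v (i, j)" for j
    by (subst map_key.rep_eq) (auto simp: inj_def)
  ultimately have "v = row i (Poly_Mapping.map_key (Pair i) v)"
    by (intro poly_mapping_eqI) (auto simp: lookup_row)
  then show "v \<in> range (row i)" by blast
qed (auto simp: lookup_row)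

lemma stable_row: "stable (\<lambda>g. osc_op (Usl g)) (range (row i))"
  unfolding stable_def
  using fsp.linear_subspace_image[OF lin_row fs.subspace_UNIV]
  by (auto simp: row_intertwine[symmetric])

lemma row_decomposition:
  "\<exists>!y. (\<forall>i. y i \<in> range (row i)) \<and> finite {i. y i \<noteq> 0} \<and> v = (\<Sum>i\<in>{i. y i \<noteq> 0}. y i)"
proof (rule ex1I)
  define y where "y i = row i (Poly_Mapping.map_key (Pair i) v)" for i
  have key: "coef (Poly_Mapping.map_key (Pair i) v) j = coef v (i, j)" for i j
    by (subst map_key.rep_eq) (auto simp: inj_def)
  have y: "coef (y i) (i', j) = (if i' = i then coef v (i, j) else 0)" for i i' j
    by (simp add: y_def lookup_row key)
  have "{i. y i \<noteq> 0} \<subseteq> fst ` supp v"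
  proof
    fix i assume "i \<in> {i. y i \<noteq> 0}"
    then obtain i' j where "coef (y i) (i', j) \<noteq> 0"
      by (metis (mono_tags) mem_Collect_eq poly_mapping_eqI lookup_zero surj_pair)
    then have "(i, j) \<in> supp v" by (auto simp: y in_keys_iff split: if_splits)
    then show "i \<in> fst ` supp v" by force
  qed
  then have fin: "finite {i. y i \<noteq> 0}" by (rule finite_subset) simp
  have "v = (\<Sum>i\<in>{i. y i \<noteq> 0}. y i)"
  proof (rule poly_mapping_eqI)
    fix x :: "nat \<times> nat"
    obtain i j where x: "x = (i, j)" by (cases x)
    have "y i = 0 \<Longrightarrow> coef v (i, j) = 0" using y[of i i j] by simp
    then show "coef v x = coef (\<Sum>i\<in>{i. y i \<noteq> 0}. y i) x"
      using fin by (auto simp: x lookup_sum y)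
  qed
  then show "(\<forall>i. y i \<in> range (row i)) \<and> finite {i. y i \<noteq> 0} \<and> v = (\<Sum>i\<in>{i. y i \<noteq> 0}. y i)"
    using fin by (auto simp: y_def)
  fix z assume z: "(\<forall>i. z i \<in> range (row i)) \<and> finite {i. z i \<noteq> 0} \<and> v = (\<Sum>i\<in>{i. z i \<noteq> 0}. z i)"
  then have zr: "i' \<noteq> i \<Longrightarrow> coef (z i) (i', j) = 0" for i i' j
    using in_range_row_iff by blast
  have "coef v (i, j) = coef (z i) (i, j)" for i j
  proof -
    have "coef v (i, j) = (\<Sum>k\<in>{i. z i \<noteq> 0}. coef (z k) (i, j))"
      using z lookup_sum[of z "{i. z i \<noteq> 0}"] by simp
    also have "\<dots> = (\<Sum>k\<in>{i. z i \<noteq> 0}. if k = i then coef (z i) (i, j) else 0)"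
      by (rule sum.cong) (auto simp: zr)
    also have "\<dots> = coef (z i) (i, j)" using z by auto
    finally show ?thesis .
  qed
  then have "coef (z i) x = coef (y i) x" for i x
    by (cases x) (auto simp: y zr)
  then show "z = y" by (intro ext poly_mapping_eqI)
qed

end

section \<open>Back to the presented modules\<close>

text \<open>In a finite chain of submodules every member but the least has an immediate predecessor, and
  a composition series descends through these.\<close>

lemma finite_chain_finite_length:
  assumes fin: "finite {N. submodule N R M}"
    and chain: "\<And>N N'. submodule N R M \<Longrightarrow> submodule N' R M \<Longrightarrow> N \<subseteq> N' \<or> N' \<subseteq> N"
    and bot: "submodule {\<zero>\<^bsub>M\<^esub>} R M" "\<And>N. submodule N R M \<Longrightarrow> \<zero>\<^bsub>M\<^esub> \<in> N"
    and top: "submodule (carrier M) R M"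
  shows "finite_length R M"
proof -
  have "\<exists>l S. S 0 = {\<zero>\<^bsub>M\<^esub>} \<and> S l = N \<and> (\<forall>i\<le>l. submodule (S i) R M) \<and>
      (\<forall>i<l. S i \<subset> S (Suc i) \<and> \<not> (\<exists>N. submodule N R M \<and> S i \<subset> N \<and> N \<subset> S (Suc i)))"
    if "submodule N R M" for N
    using that
  proof (induction "card {N'. submodule N' R M \<and> N' \<subset> N}" arbitrary: N rule: less_induct)
    case less
    show ?case
    proof (cases "N = {\<zero>\<^bsub>M\<^esub>}")
      case True
      then show ?thesis using bot(1) by (intro exI[of _ 0] exI[of _ "\<lambda>_. {\<zero>\<^bsub>M\<^esub>}"]) simp
    next
      case False
      let ?P = "{N'. submodule N' R M \<and> N' \<subset> N}"
      have finP: "finite ?P" by (rule finite_subset[OF _ fin]) auto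
      have "{\<zero>\<^bsub>M\<^esub>} \<in> ?P" using bot False less.prems by auto
      then have "?P \<noteq> {}" by (metis empty_iff)
      from finite_has_maximal[OF finP this]
      obtain P where P: "P \<in> ?P" and max: "\<forall>Q\<in>?P. P \<subseteq> Q \<longrightarrow> P = Q" ..
      have "{N'. submodule N' R M \<and> N' \<subset> P} \<subset> ?P" using P by auto
      then have "card {N'. submodule N' R M \<and> N' \<subset> P} < card ?P" by (rule psubset_card_mono[OF finP])
      from less.hyps[OF this] P obtain l S where S: "S 0 = {\<zero>\<^bsub>M\<^esub>}" "S l = P"
        "\<forall>i\<le>l. submodule (S i) R M"
        "\<forall>i<l. S i \<subset> S (Suc i) \<and> \<not> (\<exists>N. submodule N R M \<and> S i \<subset> N \<and> N \<subset> S (Suc i))"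
        by auto
      let ?S = "\<lambda>i. if i \<le> l then S i else N"
      have step: "\<not> (\<exists>Q. submodule Q R M \<and> P \<subset> Q \<and> Q \<subset> N)" using max by auto
      have "?S 0 = {\<zero>\<^bsub>M\<^esub>} \<and> ?S (Suc l) = N \<and> (\<forall>i\<le>Suc l. submodule (?S i) R M) \<and>
        (\<forall>i<Suc l. ?S i \<subset> ?S (Suc i) \<and> \<not> (\<exists>N. submodule N R M \<and> ?S i \<subset> N \<and> N \<subset> ?S (Suc i)))"
        using S less.prems P step by (auto simp: less_Suc_eq)
      then show ?thesis by (intro exI[of _ "Suc l"] exI[of _ ?S])
    qed
  qed
  from this[OF top] show ?thesis unfolding finite_length_def by blast
qed

lemma usl_to_osc_class:
  "usl_to_osc q C (pres_class (usl_rels q) p) = pres_class (osc_rels q C) (free_map Usl p)"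
proof -
  let ?I = "pres_ideal (osc_rels q C)"
  have "pres_ideal (usl_rels q) \<subseteq> {p. free_map Usl p \<in> ?I}"
  proof (rule pres_ideal_minimal)
    show "left_ideal {p. free_map Usl p \<in> ?I}"
      using left_idealD[OF left_ideal_pres_ideal[of "osc_rels q C"]]
      by (simp add: left_ideal_def free_map_simps free_map_mult)
    show "usl_rels q \<subseteq> {p. free_map Usl p \<in> ?I}"
      using rels_subset_pres_ideal[of "osc_rels q C"] by (auto simp: osc_rels_def Let_def)
  qed (simp add: free_map_mult pres_ideal_mult_right)
  then have eq: "pres_class (osc_rels q C) (free_map Usl s) = pres_class (osc_rels q C) (free_map Usl p)"
    if "s \<in> pres_class (usl_rels q) p" for s
    using that by (auto simp: pres_class_eq_set[of "usl_rels q"] pres_class_eq_iff free_map_simps)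
  have "(\<lambda>s. pres_class (osc_rels q C) (free_map Usl s)) ` pres_class (usl_rels q) p =
      {pres_class (osc_rels q C) (free_map Usl p)}"
  proof (rule subset_antisym)
    show "(\<lambda>s. pres_class (osc_rels q C) (free_map Usl s)) ` pres_class (usl_rels q) p \<subseteq>
        {pres_class (osc_rels q C) (free_map Usl p)}"
      by (rule image_subsetI) (unfold singleton_iff, rule eq)
    show "{pres_class (osc_rels q C) (free_map Usl p)} \<subseteq>
        (\<lambda>s. pres_class (osc_rels q C) (free_map Usl s)) ` pres_class (usl_rels q) p"
      unfolding insert_subset by (intro conjI image_eqI[OF refl pres_class_self] empty_subsetI)
  qed
  then show ?thesis by (simp add: usl_to_osc_def)
qed

lemma realises_restrict_scalars:
  assumes "realises (osc_rels q C) M \<rho> \<Phi>"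
  shows "realises (usl_rels q) (restrict_scalars (usl_to_osc q C) M) (\<lambda>g. \<rho> (Usl g)) \<Phi>"
  using assms
  by (simp add: realises_def restrict_scalars_def usl_to_osc_class act_free_map)

locale osc_realisation = osc_parameter q C r for q :: "'k::field" and C r +
  fixes \<Phi> :: "(osc_gen, 'k) free_alg set set \<Rightarrow> (nat \<times> nat \<Rightarrow>\<^sub>0 'k)"
  assumes real: "realises (osc_rels q C) (osc_verma q C r) osc_op \<Phi>"
begin

lemma submodule_iff:
  "submodule N (osc q C) (osc_verma q C r) \<longleftrightarrow>
     N = {\<zero>\<^bsub>osc_verma q C r\<^esub>} \<or> (\<exists>n. lam n = 0 \<and> N = {x \<in> carrier (osc_verma q C r). \<Phi> x \<in> rows n})"
  (is "?L \<longleftrightarrow> ?R")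
proof
  note sub = submodule_iff_stable[OF real, folded osc_def]
  note z = realisesD(4,5)[OF real]
  have zero: "N = {\<zero>\<^bsub>osc_verma q C r\<^esub>}" if "N \<subseteq> carrier (osc_verma q C r)" "\<Phi> ` N = {0}" for N
  proof -
    have "x = \<zero>\<^bsub>osc_verma q C r\<^esub>" if "x \<in> N" for x
    proof (rule realises_eqI[OF real _ z(1)])
      show "x \<in> carrier (osc_verma q C r)" using that \<open>N \<subseteq> _\<close> by (rule subsetD[rotated])
      have "\<Phi> x \<in> \<Phi> ` N" using that by (rule imageI)
      then show "\<Phi> x = \<Phi> \<zero>\<^bsub>osc_verma q C r\<^esub>" unfolding \<open>\<Phi> ` N = {0}\<close> z(2) by (rule singletonD)
    qed
    moreover have "N \<noteq> {}" using that(2) by auto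
    ultimately show ?thesis by blast
  qed
  {
    assume ?L
    then have N: "N \<subseteq> carrier (osc_verma q C r)" "stable osc_op (\<Phi> ` N)" unfolding sub by auto
    show ?R
    proof (cases "\<Phi> ` N = {0}")
      case True
      then show ?thesis using zero N(1) by blast
    next
      case False
      then have "\<exists>n. lam n = 0 \<and> \<Phi> ` N = rows n"
        by (intro stable_classification[THEN iffD1] conjI N(2))
      then obtain n where n: "lam n = 0" "\<Phi> ` N = rows n" by (elim exE conjE)
      have "N = {x \<in> carrier (osc_verma q C r). \<Phi> x \<in> rows n}"
        using preimage_image[OF real N(1)] unfolding n(2) by simp
      then show ?thesis using n(1) by blast
    qed
  next
    assume ?R
    then show ?L
    proof
      assume "N = {\<zero>\<^bsub>osc_verma q C r\<^esub>}"
      moreover have "stable osc_op {0}"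
        by (simp add: stable_def fs.subspace_def fsp.linear_0[OF lin_osc_op])
      ultimately show ?L unfolding sub using z by simp
    next
      assume "\<exists>n. lam n = 0 \<and> N = {x \<in> carrier (osc_verma q C r). \<Phi> x \<in> rows n}"
      then obtain n where "lam n = 0" "N = {x \<in> carrier (osc_verma q C r). \<Phi> x \<in> rows n}" by blast
      then show ?L using submodule_preimage[OF real stable_rows, folded osc_def] by blast
    qed
  }
qed

lemma rows_preimage_nz:
  "{x \<in> carrier (osc_verma q C r). \<Phi> x \<in> rows n} \<noteq> {\<zero>\<^bsub>osc_verma q C r\<^esub>}"
proof
  assume a: "{x \<in> carrier (osc_verma q C r). \<Phi> x \<in> rows n} = {\<zero>\<^bsub>osc_verma q C r\<^esub>}"
  obtain x where "x \<in> carrier (osc_verma q C r)" "\<Phi> x = bv (n, 0)" using realisesD(9)[OF real] by blast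
  moreover from this have "x = \<zero>\<^bsub>osc_verma q C r\<^esub>" using a bv_in_rows[of n n 0] by auto
  ultimately have "bv (n, 0) = (0 :: nat \<times> nat \<Rightarrow>\<^sub>0 'k)" using realisesD(5)[OF real] by simp
  then show False by simp
qed

lemma maximal_vector_iff:
  "maximal_vector q C r (q powi (- int n) * r) v \<longleftrightarrow>
     v \<in> carrier (osc_verma q C r) \<and> lam n = 0 \<and> (\<exists>a. a \<noteq> 0 \<and> \<Phi> v = a *\<^sub>s bv (n, 0))"
proof (cases "v \<in> carrier (osc_verma q C r)")
  case True
  have eq: "x = y \<longleftrightarrow> \<Phi> x = \<Phi> y"
    if "x \<in> carrier (osc_verma q C r)" "y \<in> carrier (osc_verma q C r)" for x y
    using realisesD(8)[OF real that] by simp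
  have "maximal_vector q C r (q powi (- int n) * r) v \<longleftrightarrow>
      \<Phi> v \<noteq> 0 \<and> osc_op (Usl gE) (\<Phi> v) = 0 \<and> osc_op gX (\<Phi> v) = 0 \<and>
      osc_op (Usl gK) (\<Phi> v) = wt n *\<^sub>s \<Phi> v"
    using True unfolding maximal_vector_def Let_def wt_powi
    by (simp add: eq realisesD(4-7)[OF real] act_free_gen act_free_scal)
  then show ?thesis unfolding maximal_in_rows using True by blast
qed (simp add: maximal_vector_def Let_def)

text \<open>As X kills the U-maximal vector number n, the rows from n on are closed under all of A; and
  Y and F alone reach them.\<close>

lemma kYF_span_eq:
  assumes v: "v \<in> carrier (osc_verma q C r)" "\<Phi> v = a *\<^sub>s bv (n, 0)" and a: "a \<noteq> 0" and lam: "lam n = 0"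
  shows "kYF_span q C r v = {x \<in> carrier (osc_verma q C r). \<Phi> x \<in> rows n}"
proof -
  let ?A = "osc q C" and ?cl = "pres_class (osc_rels q C)" and ?M = "osc_verma q C r"
  let ?H = "range (pres_scal (osc_rels q C)) \<union> {pres_gen (osc_rels q C) gY, pres_gen (osc_rels q C) (Usl gF)}"
  have "?H \<subseteq> carrier ?A" by (auto simp: osc_def carrier_pres_alg)
  then have sub: "kYF q C \<subseteq> range ?cl"
    unfolding kYF_def using ring.generate_ring_incl[OF ring_pres_alg, of ?H "osc_rels q C"]
    by (simp add: osc_def carrier_pres_alg)
  define D where "D = {p. ?cl p \<in> kYF q C}"
  have mult: "p * s \<in> D" if "p \<in> D" "s \<in> D" for p s
    using generate_ring.eng_mult[of "?cl p" ?A ?H "?cl s"] that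
    by (simp add: D_def kYF_def osc_def pres_alg_mult)
  have add: "p + s \<in> D" if "p \<in> D" "s \<in> D" for p s
    using generate_ring.eng_add[of "?cl p" ?A ?H "?cl s"] that
    by (simp add: D_def kYF_def osc_def pres_alg_add)
  have gen: "free_scal b \<in> D" "oY \<in> D" "oF \<in> D" for b
    unfolding D_def kYF_def by (auto intro: generate_ring.incl)
  have "1 \<in> D" using generate_ring.one[of ?A ?H] by (simp add: D_def kYF_def osc_def pres_alg_one)
  have reach: "\<exists>p\<in>D. act osc_op p (bv (n, 0)) = w" if "w \<in> rows n" for w
    by (rule rows_reachable[OF lam \<open>1 \<in> D\<close> add _ mult mult])
      (use that gen mult in \<open>auto simp: free_scal_mult[symmetric]\<close>)
  have \<Phi>: "?cl p \<odot>\<^bsub>?M\<^esub> v \<in> carrier ?M" "\<Phi> (?cl p \<odot>\<^bsub>?M\<^esub> v) = a *\<^sub>s act osc_op p (bv (n, 0))" for p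
    using realisesD(6,7)[OF real v(1), of p] v(2)
    by (simp_all add: fsp.linear_scale[OF lin_act[OF lin_osc_op]])
  show ?thesis
  proof (intro subset_antisym subsetI)
    fix x assume "x \<in> kYF_span q C r v"
    then obtain p where x: "x = ?cl p \<odot>\<^bsub>?M\<^esub> v" using sub by (auto simp: kYF_span_def)
    have "act osc_op p (bv (n, 0)) \<in> rows n"
      by (rule act_invariant[OF subspace_rows])
        (use stable_rows[OF lam] bv_in_rows in \<open>auto simp: stable_def\<close>)
    then show "x \<in> {x \<in> carrier ?M. \<Phi> x \<in> rows n}"
      unfolding x using \<Phi>[of p] fs.subspace_scale[OF subspace_rows] by simp
  next
    fix x assume x: "x \<in> {x \<in> carrier ?M. \<Phi> x \<in> rows n}"
    then have "inverse a *\<^sub>s \<Phi> x \<in> rows n" by (intro fs.subspace_scale[OF subspace_rows]) simp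
    then obtain p where p: "p \<in> D" "act osc_op p (bv (n, 0)) = inverse a *\<^sub>s \<Phi> x" using reach by blast
    have "x = ?cl p \<odot>\<^bsub>?M\<^esub> v"
      using x \<Phi>[of p] p(2) a by (intro realises_eqI[OF real]) simp_all
    then show "x \<in> kYF_span q C r v" using p(1) unfolding kYF_span_def D_def by blast
  qed
qed

lemma maximal_kYF_span:
  assumes "maximal_vector q C r (q powi (- int n) * r) v"
  shows "lam n = 0 \<and> kYF_span q C r v = {x \<in> carrier (osc_verma q C r). \<Phi> x \<in> rows n}"
  using assms kYF_span_eq unfolding maximal_vector_iff by blast

lemma maximal_vector_exists:
  assumes "lam n = 0"
  shows "\<exists>v. maximal_vector q C r (q powi (- int n) * r) v"
proof -
  obtain x where "x \<in> carrier (osc_verma q C r)" "\<Phi> x = bv (n, 0)" using realisesD(9)[OF real] by blast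
  then have "maximal_vector q C r (q powi (- int n) * r) x"
    unfolding maximal_vector_iff using assms by (intro conjI exI[of _ 1]) simp_all
  then show ?thesis by blast
qed

lemma nonzero_submodules:
  "{N. submodule N (osc q C) (osc_verma q C r) \<and> N \<noteq> {\<zero>\<^bsub>osc_verma q C r\<^esub>}} =
     {kYF_span q C r v | n v. alpha q C r (n + 1) = 0 \<and>
        maximal_vector q C r (q powi (- int n) * r) v}"
proof (intro subset_antisym subsetI)
  fix N assume "N \<in> {N. submodule N (osc q C) (osc_verma q C r) \<and> N \<noteq> {\<zero>\<^bsub>osc_verma q C r\<^esub>}}"
  then obtain n where n: "lam n = 0" "N = {x \<in> carrier (osc_verma q C r). \<Phi> x \<in> rows n}"
    unfolding submodule_iff by blast
  obtain v where v: "maximal_vector q C r (q powi (- int n) * r) v"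
    using maximal_vector_exists[OF n(1)] by blast
  have "N = kYF_span q C r v" using maximal_kYF_span[OF v] n(2) by simp
  then show "N \<in> {kYF_span q C r v | n v. alpha q C r (n + 1) = 0 \<and>
      maximal_vector q C r (q powi (- int n) * r) v}"
    using v alpha_eq_0[OF n(1)] by auto
next
  fix N assume "N \<in> {kYF_span q C r v | n v. alpha q C r (n + 1) = 0 \<and>
      maximal_vector q C r (q powi (- int n) * r) v}"
  then obtain n v where "N = kYF_span q C r v" "maximal_vector q C r (q powi (- int n) * r) v" by blast
  then have "lam n = 0" "N = {x \<in> carrier (osc_verma q C r). \<Phi> x \<in> rows n}"
    using maximal_kYF_span by blast+
  then show "N \<in> {N. submodule N (osc q C) (osc_verma q C r) \<and> N \<noteq> {\<zero>\<^bsub>osc_verma q C r\<^esub>}}"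
    using rows_preimage_nz unfolding submodule_iff by blast
qed

lemma maximal_vector_verma:
  assumes v: "maximal_vector q C r (q powi (- int n) * r) v"
  shows "\<exists>h. mod_iso_onto (osc q C) (osc_verma q C (q powi (- int n) * r)) (osc_verma q C r)
      (kYF_span q C r v) h \<and> h (osc_verma_gen q C (q powi (- int n) * r)) = v"
proof -
  interpret T: osc_parameter q C "wt n" by (rule osc_parameter_wt)
  obtain \<Psi> where \<Psi>: "realises (osc_rels q C) (osc_verma q C (wt n)) T.osc_op \<Psi>"
    "osc_verma_gen q C (wt n) \<in> carrier (osc_verma q C (wt n))" "\<Psi> (osc_verma_gen q C (wt n)) = bv (0, 0)"
    by (rule T.osc_verma_realised)
  obtain a where a: "v \<in> carrier (osc_verma q C r)" "lam n = 0" "a \<noteq> 0" "\<Phi> v = a *\<^sub>s bv (n, 0)"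
    using v unfolding maximal_vector_iff by blast
  have "\<exists>h. mod_iso_onto (pres_alg (osc_rels q C)) (osc_verma q C (wt n)) (osc_verma q C r)
      {x \<in> carrier (osc_verma q C r). \<Phi> x \<in> range (shift a n)} h \<and>
      (\<forall>x\<in>carrier (osc_verma q C (wt n)). h x \<in> carrier (osc_verma q C r) \<and> \<Phi> (h x) = shift a n (\<Psi> x))"
    by (rule mod_iso_onto_realised[where T = "shift a n", OF \<Psi>(1) real lin_shift inj_shift[OF a(3)]])
      (rule shift_intertwine[OF a(2)])
  then obtain h where h: "mod_iso_onto (pres_alg (osc_rels q C)) (osc_verma q C (wt n)) (osc_verma q C r)
      {x \<in> carrier (osc_verma q C r). \<Phi> x \<in> range (shift a n)} h"
    "\<forall>x\<in>carrier (osc_verma q C (wt n)). h x \<in> carrier (osc_verma q C r) \<and> \<Phi> (h x) = shift a n (\<Psi> x)"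
    by (elim exE conjE)
  have "h (osc_verma_gen q C (wt n)) = v"
    using bspec[OF h(2) \<Psi>(2)] a by (intro realises_eqI[OF real]) (simp_all add: \<Psi>(3))
  then show ?thesis
    using h(1) unfolding wt_powi range_shift[OF a(3)] osc_def[symmetric] maximal_kYF_span[OF v, THEN conjunct2]
    by blast
qed

lemma submodules_chain:
  assumes "submodule N (osc q C) (osc_verma q C r)" "submodule N' (osc q C) (osc_verma q C r)"
  shows "N \<subseteq> N' \<or> N' \<subseteq> N"
proof -
  have z: "\<zero>\<^bsub>osc_verma q C r\<^esub> \<in> {x \<in> carrier (osc_verma q C r). \<Phi> x \<in> rows n}" for n
    using realisesD(4,5)[OF real] fs.subspace_0[OF subspace_rows] by simp
  have "rows m \<subseteq> rows n \<or> rows n \<subseteq> rows m" for m n unfolding rows_subset_iff by linarith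
  then show ?thesis using assms z unfolding submodule_iff by (elim disjE exE conjE) blast+
qed

lemma verma_finite_length:
  assumes "C \<noteq> \<zero>\<^bsub>usl q\<^esub>"
  shows "finite_length (osc q C) (osc_verma q C r)"
proof (rule finite_chain_finite_length)
  have "{n. lam n = 0} \<subseteq> {n. alpha q C r (Suc n) = 0}" using alpha_eq_0 by blast
  then have "finite {n. lam n = 0}" using finite_alpha_zeros[OF C assms r_nz] by (rule finite_subset)
  then have "finite (insert {\<zero>\<^bsub>osc_verma q C r\<^esub>}
      ((\<lambda>n. {x \<in> carrier (osc_verma q C r). \<Phi> x \<in> rows n}) ` {n. lam n = 0}))" by simp
  then show "finite {N. submodule N (osc q C) (osc_verma q C r)}"
    by (rule rev_finite_subset) (auto simp: submodule_iff)
  show "submodule {\<zero>\<^bsub>osc_verma q C r\<^esub>} (osc q C) (osc_verma q C r)" by (simp add: submodule_iff)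
  have "rows 0 = UNIV" by (auto simp: rows_def)
  then show "submodule (carrier (osc_verma q C r)) (osc q C) (osc_verma q C r)"
    unfolding submodule_iff by (intro disjI2 exI[of _ 0]) simp
  show "\<zero>\<^bsub>osc_verma q C r\<^esub> \<in> N" if "submodule N (osc q C) (osc_verma q C r)" for N
    using that realisesD(4,5)[OF real] fs.subspace_0[OF subspace_rows] by (auto simp: submodule_iff)
qed (rule submodules_chain)

lemma verma_direct_sum:
  "\<exists>N :: nat \<Rightarrow> _. internal_direct_sum (usl q)
        (restrict_scalars (usl_to_osc q C) (osc_verma q C r)) N \<and>
      (\<forall>i. \<exists>h. mod_iso_onto (usl q) (usl_verma q (q powi (- int i) * r))
        (restrict_scalars (usl_to_osc q C) (osc_verma q C r)) (N i) h)"
proof -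
  let ?M = "restrict_scalars (usl_to_osc q C) (osc_verma q C r)"
  note real' = realises_restrict_scalars[OF real]
  let ?N = "\<lambda>i. {x \<in> carrier ?M. \<Phi> x \<in> range (row i)}"
  have "internal_direct_sum (usl q) ?M ?N"
    unfolding usl_def by (rule internal_direct_sum_realised[OF real' stable_row row_decomposition])
  moreover have "\<exists>h. mod_iso_onto (usl q) (usl_verma q (q powi (- int i) * r)) ?M (?N i) h" for i
  proof -
    obtain \<Psi> where \<Psi>: "realises (usl_rels q) (usl_verma q (wt i)) (verma_op (wt i)) \<Psi>"
      by (rule usl_verma_realised[OF wt_nz])
    have "\<exists>h. mod_iso_onto (pres_alg (usl_rels q)) (usl_verma q (wt i)) ?M (?N i) h \<and>
        (\<forall>x\<in>carrier (usl_verma q (wt i)). h x \<in> carrier ?M \<and> \<Phi> (h x) = row i (\<Psi> x))"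
      by (rule mod_iso_onto_realised[where T = "row i", OF \<Psi> real' lin_row inj_row])
        (rule row_intertwine)
    then show ?thesis unfolding wt_powi usl_def by (elim exE conjE) (rule exI)
  qed
  ultimately show ?thesis by blast
qed

end

theorem theorem6p1:
  fixes q r :: "'k::field" and C :: "(usl_gen, 'k) free_alg set"
  assumes char: "CHAR('k) \<noteq> 2"
    and q: "q \<noteq> 0" "\<And>n::nat. n > 0 \<Longrightarrow> q ^ n \<noteq> 1"
    and C: "C \<in> ring_center (usl q)" "C \<noteq> \<zero>\<^bsub>usl q\<^esub>"
    and r: "r \<noteq> 0" "\<And>n::nat. r \<noteq> q ^ n \<and> r \<noteq> - (q ^ n)"
  shows
    "(\<exists>N :: nat \<Rightarrow> _. internal_direct_sum (usl q)
          (restrict_scalars (usl_to_osc q C) (osc_verma q C r)) N \<and>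
        (\<forall>i. \<exists>h. mod_iso_onto (usl q) (usl_verma q (q powi (- int i) * r))
          (restrict_scalars (usl_to_osc q C) (osc_verma q C r)) (N i) h))
     \<and>
     {N. submodule N (osc q C) (osc_verma q C r) \<and> N \<noteq> {\<zero>\<^bsub>osc_verma q C r\<^esub>}} =
       {kYF_span q C r v | n v. alpha q C r (n + 1) = 0 \<and>
          maximal_vector q C r (q powi (- int n) * r) v}
     \<and>
     (\<forall>n. alpha q C r (n + 1) = 0 \<and>
          \<not> (n = 1 \<and> (r = inverse q \<or> r = - inverse q) \<and> c0 q C r \<noteq> 0) \<longrightarrow>
        (\<exists>v. maximal_vector q C r (q powi (- int n) * r) v))
     \<and>
     (\<forall>n v. alpha q C r (n + 1) = 0 \<and> maximal_vector q C r (q powi (- int n) * r) v \<longrightarrow>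
        (\<exists>h. mod_iso_onto (osc q C) (osc_verma q C (q powi (- int n) * r)) (osc_verma q C r)
               (kYF_span q C r v) h \<and>
             h (osc_verma_gen q C (q powi (- int n) * r)) = v))
     \<and>
     (\<forall>N N'. submodule N (osc q C) (osc_verma q C r) \<and>
          submodule N' (osc q C) (osc_verma q C r) \<longrightarrow> N \<subseteq> N' \<or> N' \<subseteq> N)
     \<and>
     finite_length (osc q C) (osc_verma q C r)"
proof -
  interpret P: osc_parameter q C r
  proof
    show "r ^ 2 \<noteq> q ^ (2 * n)" for n
    proof
      assume "r ^ 2 = q ^ (2 * n)"
      then have "r ^ 2 = (q ^ n) ^ 2" by (simp add: power_mult[symmetric] mult.commute)
      then show False using r(2)[of n] by (simp add: power2_eq_iff)
    qed
  qed (use q C r in auto)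
  obtain \<Phi> where \<Phi>: "realises (osc_rels q C) (osc_verma q C r) P.osc_op \<Phi>"
    by (rule P.osc_verma_realised)
  interpret osc_realisation q C r \<Phi> by unfold_locales (rule \<Phi>)
  have vectors: "\<forall>n. alpha q C r (n + 1) = 0 \<and>
      \<not> (n = 1 \<and> (r = inverse q \<or> r = - inverse q) \<and> c0 q C r \<noteq> 0) \<longrightarrow>
      (\<exists>v. maximal_vector q C r (q powi (- int n) * r) v)"
    by (intro allI impI maximal_vector_exists P.lam_eq_0) simp_all
  have copies: "\<forall>n v. alpha q C r (n + 1) = 0 \<and> maximal_vector q C r (q powi (- int n) * r) v \<longrightarrow>
      (\<exists>h. mod_iso_onto (osc q C) (osc_verma q C (q powi (- int n) * r)) (osc_verma q C r)
             (kYF_span q C r v) h \<and>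
           h (osc_verma_gen q C (q powi (- int n) * r)) = v)"
    by (intro allI impI, elim conjE, rule maximal_vector_verma)
  have chain: "\<forall>N N'. submodule N (osc q C) (osc_verma q C r) \<and>
      submodule N' (osc q C) (osc_verma q C r) \<longrightarrow> N \<subseteq> N' \<or> N' \<subseteq> N"
    by (intro allI impI, elim conjE, rule submodules_chain)
  show ?thesis
    by (intro conjI verma_direct_sum nonzero_submodules vectors copies chain
        verma_finite_length[OF C(2)])
qed

end
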